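(* Let $X(t)$, $t>0$, be a Lévy process with symbol $\Psi$ (as in the context), $\mathbb{E}e^{i\mu X(t)}=e^{-t\Psi(\mu)}$, independent of $\mathfrak{H}_t$, $t>0$, where, for $b\ge0$, $\beta,\gamma\in(0,1]$, $\lambda>0$, $$\mathfrak{H}_t=\inf\{s\ge0:\ N(\mathfrak{A}^\gamma_s)+b\,\mathfrak{A}^\beta_s>t\}.$$ The governing equation of the process $X(\mathfrak{H}_t)$, $t>0$, is $$b^\beta\mathcal{D}^\beta_tu(x,t)+\lambda^\gamma(I-K_1)^\gamma u(x,t)=\mathcal{A}u(x,t),\qquad x\in\mathbb{R},\ t>0,$$ where $K_1=e^{-\partial_t}$ is the unit shift in $t$, subject to the initial and boundary conditions $$u(x,0)=\delta(x),\qquad u(0,t)=-\frac{\gamma\lambda^\gamma}{\Gamma(1-\gamma)}\sum_{k=0}^\infty\frac{\Gamma(k-\gamma)}{k!}H(t-k),$$ where $H$ is the Heaviside step function.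
   Context: The Lévy symbol is $\Psi(\xi)=ic\xi+\frac12\xi^2-\int_{\mathbb{R}\setminus\{0\}}(e^{i\xi y}-1-i\xi y\mathbf 1_{(|y|\le1)})M(dy)$ with $c\in\mathbb{R}$ and $M$ a Lévy measure, $\int(y^2\wedge1)M(dy)<\infty$. $\mathcal{A}$ is the infinitesimal generator of $X$, with Fourier multiplier $-\Psi$: $\mathcal{A}f(x)=-\frac1{2\pi}\int_{\mathbb{R}}e^{-i\xi x}\Psi(\xi)\widehat f(\xi)\,d\xi$, $\widehat f(\xi)=\int_{\mathbb R}e^{i\xi x}f(x)\,dx$. $N$ is a Poisson process of rate $\lambda$. For $\nu\in(0,1)$, $\mathfrak{A}^\nu$ is a $\nu$-stable subordinator with $\mathbb{E}e^{-\xi\mathfrak{A}^\nu_t}=e^{-t\xi^\nu}$, and $\mathfrak{A}^1_t=t$; $N,\mathfrak{A}^\gamma,\mathfrak{A}^\beta$ are independent. $\delta$ is the Dirac delta. $\mathcal{D}^\beta_tu=\partial^\beta_tu-u(0^+)\frac{t^{-\beta}}{\Gamma(1-\beta)}$ is the Dzhrbashyan–Caputo derivative, with $\partial_t^\beta u=\frac1{\Gamma(1-\beta)}\frac{\partial}{\partial t}\int_0^t\frac{u(s)\,ds}{(t-s)^\beta}$ ($\mathcal D^1_t=\partial_t$), and $(I-K_1)^\gamma=\sum_{j\ge0}(-1)^j\binom\gamma jK_1^j$. For $\gamma=1$ the boundary condition is read as $u(0,t)=\lambda[H(t)-H(t-1)]$.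
   Formalization: The equation is proved in the sense of distributions in x; the boundary condition on u(0,t), false as a value at x=0, becomes a source term (the same datum times δ(x)) on the right-hand side; for b=0, where u(x,0)=δ(x) fails, δ is asserted only for t<0. *)

theory Defs
  imports "HOL-Probability.Probability"
begin

definition is_levy_measure :: "real measure \<Rightarrow> bool" where
  "is_levy_measure m \<longleftrightarrow>
     sets m = sets borel \<and> emeasure m {0} = 0 \<and>
     (\<integral>\<^sup>+ y. ennreal (min (y\<^sup>2) 1) \<partial>m) < \<infinity>"

definition levy_symbol :: "real \<Rightarrow> real measure \<Rightarrow> real \<Rightarrow> complex" where
  "levy_symbol c m \<xi> =
     \<i> * complex_of_real (c * \<xi>) + complex_of_real (\<xi>\<^sup>2 / 2)
     - (\<integral>y. (iexp (\<xi> * y) - 1 - \<i> * complex_of_real (\<xi> * y * indicator {-1..1} y)) \<partial>m)"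

definition fourier :: "(real \<Rightarrow> complex) \<Rightarrow> real \<Rightarrow> complex" where
  "fourier f \<xi> = (\<integral>x. iexp (\<xi> * x) * f x \<partial>lborel)"

text \<open>The operator with Fourier multiplier \<open>- \<Psi>\<close>. Its transpose with respect to
  \<open>\<integral> f g dx\<close> is the same operator with \<open>\<Psi>(\<xi>)\<close> replaced by \<open>\<Psi>(- \<xi>)\<close>.\<close>

definition generator :: "(real \<Rightarrow> complex) \<Rightarrow> (real \<Rightarrow> complex) \<Rightarrow> real \<Rightarrow> complex" where
  "generator \<Psi> f x =
     - (1 / complex_of_real (2 * pi)) *
       (\<integral>\<xi>. iexp (- (\<xi> * x)) * \<Psi> \<xi> * fourier f \<xi> \<partial>lborel)"

text \<open>A process is a map \<open>Z t \<omega>\<close>; only the values for \<open>t \<ge> 0\<close> are meaningful. The path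
  properties, including the start at \<open>0\<close>, are required for every \<open>\<omega>\<close>, i.e. the usual regular
  version of the process is taken.\<close>

definition cadlag :: "(real \<Rightarrow> real) \<Rightarrow> bool" where
  "cadlag f \<longleftrightarrow>
     (\<forall>t\<ge>0. (f \<longlongrightarrow> f t) (at_right t)) \<and> (\<forall>t>0. \<exists>l. (f \<longlongrightarrow> l) (at_left t))"

definition levy_process :: "'a measure \<Rightarrow> (real \<Rightarrow> 'a \<Rightarrow> real) \<Rightarrow> bool" where
  "levy_process M Z \<longleftrightarrow>
     prob_space M \<and>
     (\<forall>t\<ge>0. Z t \<in> borel_measurable M) \<and>
     (\<forall>\<omega>\<in>space M. Z 0 \<omega> = 0) \<and>
     (\<forall>(\<tau>::nat \<Rightarrow> real) n. 0 \<le> \<tau> 0 \<and> mono \<tau> \<longrightarrow>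
        prob_space.indep_vars M (\<lambda>_. borel) (\<lambda>i \<omega>. Z (\<tau> (Suc i)) \<omega> - Z (\<tau> i) \<omega>) {..<n}) \<and>
     (\<forall>s\<ge>0. \<forall>t\<ge>0. distr M borel (\<lambda>\<omega>. Z (s + t) \<omega> - Z s \<omega>) = distr M borel (Z t)) \<and>
     (\<forall>\<omega>\<in>space M. cadlag (\<lambda>t. Z t \<omega>))"

definition poisson_process :: "'a measure \<Rightarrow> real \<Rightarrow> (real \<Rightarrow> 'a \<Rightarrow> nat) \<Rightarrow> bool" where
  "poisson_process M lam N \<longleftrightarrow>
     levy_process M (\<lambda>t \<omega>. real (N t \<omega>)) \<and>
     (\<forall>\<omega>\<in>space M. mono_on {0..} (\<lambda>t. N t \<omega>)) \<and>
     (\<forall>t>0. distr M (count_space UNIV) (N t) = measure_pmf (poisson_pmf (lam * t)))"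

definition stable_subordinator :: "'a measure \<Rightarrow> real \<Rightarrow> (real \<Rightarrow> 'a \<Rightarrow> real) \<Rightarrow> bool" where
  "stable_subordinator M \<nu> A \<longleftrightarrow>
     (if \<nu> = 1 then \<forall>t\<ge>0. \<forall>\<omega>\<in>space M. A t \<omega> = t
      else levy_process M A \<and>
        (\<forall>\<omega>\<in>space M. mono_on {0..} (\<lambda>t. A t \<omega>)) \<and>
        (\<forall>t\<ge>0. \<forall>\<xi>>0. (\<integral>\<omega>. exp (- \<xi> * A t \<omega>) \<partial>M) = exp (- t * \<xi> powr \<nu>)))"

definition indep_processes3 ::
  "'a measure \<Rightarrow> (real \<Rightarrow> 'a \<Rightarrow> real) \<Rightarrow> (real \<Rightarrow> 'a \<Rightarrow> real) \<Rightarrow> (real \<Rightarrow> 'a \<Rightarrow> real) \<Rightarrow> bool" where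
  "indep_processes3 M Z0 Z1 Z2 \<longleftrightarrow>
     prob_space.indep_vars M (\<lambda>_. PiM {0..} (\<lambda>_. borel))
       (\<lambda>(i::nat) \<omega>. \<lambda>t\<in>{0..}. (if i = 0 then Z0 else if i = 1 then Z1 else Z2) t \<omega>) {0, 1, 2}"

text \<open>The first passage time above \<open>t\<close>. The set is almost surely nonempty; the value \<open>0\<close> on the
  exceptional null set is a convention that keeps the time in \<open>[0, \<infinity>)\<close>.\<close>

definition hitting_time ::
  "(real \<Rightarrow> 'a \<Rightarrow> nat) \<Rightarrow> (real \<Rightarrow> 'a \<Rightarrow> real) \<Rightarrow> real \<Rightarrow> (real \<Rightarrow> 'a \<Rightarrow> real) \<Rightarrow> real \<Rightarrow> 'a \<Rightarrow> real" where
  "hitting_time N A b B t \<omega> =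
     (let S = {s. 0 \<le> s \<and> real (N (A s \<omega>) \<omega>) + b * B s \<omega> > t}
      in if S = {} then 0 else Inf S)"

definition indep_time :: "'a measure \<Rightarrow> (real \<Rightarrow> 'a \<Rightarrow> real) \<Rightarrow> (real \<Rightarrow> 'a \<Rightarrow> real) \<Rightarrow> bool" where
  "indep_time M X T \<longleftrightarrow>
     prob_space.indep_var M
       (PiM {0..} (\<lambda>_. borel)) (\<lambda>\<omega>. \<lambda>t\<in>{0..}. X t \<omega>)
       (PiM {0<..} (\<lambda>_. borel)) (\<lambda>\<omega>. \<lambda>t\<in>{0<..}. T t \<omega>)"

definition time_changed_law ::
  "'a measure \<Rightarrow> (real \<Rightarrow> 'a \<Rightarrow> real) \<Rightarrow> (real \<Rightarrow> 'a \<Rightarrow> real) \<Rightarrow> real \<Rightarrow> real measure" where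
  "time_changed_law M X T t = distr M borel (\<lambda>\<omega>. X (T t \<omega>) \<omega>)"

definition heaviside :: "real \<Rightarrow> real" where
  "heaviside t = (if 0 \<le> t then 1 else 0)"

definition frac_integral :: "real \<Rightarrow> (real \<Rightarrow> real) \<Rightarrow> real \<Rightarrow> real" where
  "frac_integral \<beta> v t =
     1 / Gamma (1 - \<beta>) * (\<integral>s\<in>{0<..<t}. v s / (t - s) powr \<beta> \<partial>lborel)"

definition DC_deriv :: "real \<Rightarrow> (real \<Rightarrow> real) \<Rightarrow> real \<Rightarrow> real" where
  "DC_deriv \<beta> v t =
     (if \<beta> = 1 then deriv v t
      else deriv (frac_integral \<beta> v) t
           - Lim (at_right 0) v * (t powr (- \<beta>) / Gamma (1 - \<beta>)))"

text \<open>Every ingredient of \<open>DC_deriv \<beta> v t\<close> exists (none is a default value).\<close>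

definition DC_differentiable :: "real \<Rightarrow> (real \<Rightarrow> real) \<Rightarrow> real \<Rightarrow> bool" where
  "DC_differentiable \<beta> v t \<longleftrightarrow>
     (if \<beta> = 1 then v field_differentiable (at t)
      else (\<exists>l. (v \<longlongrightarrow> l) (at_right 0)) \<and>
           (\<forall>r>0. set_integrable lborel {0<..<r} (\<lambda>s. v s / (r - s) powr \<beta>)) \<and>
           frac_integral \<beta> v field_differentiable (at t))"

definition K1 :: "(real \<Rightarrow> real) \<Rightarrow> real \<Rightarrow> real" where
  "K1 v t = v (t - 1)"

definition frac_shift :: "real \<Rightarrow> (real \<Rightarrow> real) \<Rightarrow> real \<Rightarrow> real" where
  "frac_shift \<gamma> v t = (\<Sum>j. (-1) ^ j * (\<gamma> gchoose j) * (K1 ^^ j) v t)"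

definition boundary_datum :: "real \<Rightarrow> real \<Rightarrow> real \<Rightarrow> real" where
  "boundary_datum \<gamma> lam t =
     (if \<gamma> = 1 then lam * (heaviside t - heaviside (t - 1))
      else - (\<gamma> * lam powr \<gamma> / Gamma (1 - \<gamma>)) *
           (\<Sum>k. Gamma (real k - \<gamma>) / fact k * heaviside (t - real k)))"

definition test_function :: "(real \<Rightarrow> real) \<Rightarrow> bool" where
  "test_function \<phi> \<longleftrightarrow>
     (\<forall>k x. (deriv ^^ k) \<phi> field_differentiable (at x)) \<and> (\<exists>R. \<forall>x. \<bar>x\<bar> > R \<longrightarrow> \<phi> x = 0)"

text \<open>A family of measures \<open>u t\<close> tested against \<open>\<phi>\<close>, as a function of time vanishing for
  \<open>t < 0\<close>: the shift \<open>K1 = exp (- \<partial>\<^sub>t)\<close> acts on functions on the half line extended by \<open>0\<close>,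
  so that \<open>K1\<close> becomes multiplication by \<open>exp (- s)\<close> under the Laplace transform.\<close>

definition pairing :: "(real \<Rightarrow> real measure) \<Rightarrow> (real \<Rightarrow> real) \<Rightarrow> real \<Rightarrow> real" where
  "pairing u \<phi> t = (if t < 0 then 0 else (\<integral>x. \<phi> x \<partial>u t))"

text \<open>The equation
  \<open>b\<^sup>\<beta> D\<^sup>\<beta> u + lam\<^sup>\<gamma> (I - K1)\<^sup>\<gamma> u = \<A> u\<close>, \<open>t > 0\<close>, with boundary datum \<open>g(t)\<close> at \<open>x = 0\<close>,
  in the sense of distributions in \<open>x\<close> and pointwise in \<open>t\<close>. The solution is a law on the whole
  line and \<open>x = 0\<close> is its starting point, so the datum enters the weak form as the boundary term
  \<open>g(t) \<phi>(0)\<close>. For \<open>\<phi>\<close> vanishing at \<open>0\<close> this is the equation itself, tested against \<open>\<phi>\<close>.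
  For \<open>b = 0\<close> the equation contains no time derivative, so none is required to exist.\<close>

definition solves_governing_equation ::
  "real \<Rightarrow> real \<Rightarrow> real \<Rightarrow> real \<Rightarrow> (real \<Rightarrow> complex) \<Rightarrow> (real \<Rightarrow> real) \<Rightarrow> (real \<Rightarrow> real measure) \<Rightarrow> bool" where
  "solves_governing_equation b \<beta> \<gamma> lam \<Psi> g u \<longleftrightarrow>
     (\<forall>\<phi> t. test_function \<phi> \<and> 0 < t \<longrightarrow>
        (0 < b \<longrightarrow> DC_differentiable \<beta> (pairing u \<phi>) t) \<and>
        complex_of_real (b powr \<beta> * DC_deriv \<beta> (pairing u \<phi>) t
                         + lam powr \<gamma> * frac_shift \<gamma> (pairing u \<phi>) t)
        = (\<integral>x. generator (\<lambda>\<xi>. \<Psi> (- \<xi>)) (\<lambda>y. complex_of_real (\<phi> y)) x \<partial>u t)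
          + complex_of_real (g t * \<phi> 0))"

text \<open>The initial condition \<open>u(x, 0) = \<delta>(x)\<close>. If \<open>b > 0\<close> the Dirac measure is the law at time
  \<open>0\<close> and the limit of the laws as \<open>t\<close> decreases to \<open>0\<close>. If \<open>b = 0\<close> the clock has already jumped
  by time \<open>0\<close> (\<open>T 0\<close> is the first jump time of the compound Poisson process), and the initial
  law is attained at time \<open>0-\<close> only.\<close>

definition starts_at_delta :: "real \<Rightarrow> (real \<Rightarrow> real measure) \<Rightarrow> bool" where
  "starts_at_delta b u \<longleftrightarrow>
     (\<forall>t<0. u t = return borel 0) \<and>
     (0 < b \<longrightarrow> u 0 = return borel 0 \<and>
        (\<forall>\<phi>. test_function \<phi> \<longrightarrow> ((\<lambda>t. \<integral>x. \<phi> x \<partial>u t) \<longlongrightarrow> \<phi> 0) (at_right 0)))"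

end

theory Submission
  imports Defs
begin

text \<open>Put \<open>Y s = N (A s) + b B s\<close>. Independence gives \<open>E exp (- \<eta> Y s) = exp (- s \<Phi>(\<eta>))\<close> with
  \<open>\<Phi>(\<eta>) = b\<^sup>\<beta> \<eta>\<^sup>\<beta> + lam\<^sup>\<gamma> (1 - exp (- \<eta>))\<^sup>\<gamma>\<close>, which is the Laplace symbol of the operator acting
  in time. The first passage time \<open>T\<close> of \<open>Y\<close> at an independent exponential time of rate \<open>\<eta>\<close> is
  exponential of rate \<open>\<Phi>(\<eta>)\<close>. For a test function \<open>\<phi>\<close> let \<open>p s = E \<phi> (X s)\<close> and
  \<open>h s = E (\<A> \<phi>) (X s)\<close>, so that \<open>h = p'\<close>. By independence the pairings of \<open>\<phi>\<close> and \<open>\<A> \<phi>\<close> with the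
  law of \<open>X (T t)\<close> are \<open>v t = E p (T t)\<close> and \<open>k t = E h (T t)\<close>, and integration by parts against the
  exponential law of \<open>T\<close> shows that the Laplace transform of \<open>v - \<phi>(0) H\<close> times \<open>\<Phi>\<close> is that
  of \<open>k\<close>. Since Laplace transforms determine right-continuous functions, this is the equation
  integrated in time; for \<open>b > 0\<close> the paths of \<open>Y\<close> are strictly increasing, so \<open>T\<close>, \<open>v\<close>, \<open>k\<close> are
  continuous and it can be differentiated at every \<open>t > 0\<close>. The boundary datum is what the shift
  operator makes of \<open>\<phi>(0) H\<close>.\<close>

section \<open>Laplace transform on the half line\<close>

text \<open>Subtracting \<open>\<phi>(0) H\<close> does two jobs. For \<open>b > 0\<close> the
  difference \<open>Z\<close> starts at 0 and is continuous on the whole line; and the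
  Dzhrbashyan-Caputo correction, a multiple of \<open>t powr (- \<beta>)\<close>, is exactly the
  derivative of the fractional integral of the subtracted constant. A fractional derivative of
  \<open>Z\<close> is not known to exist beforehand, hence the detour over the integrated equation:
  the fractional integral \<open>J\<close> of \<open>Z\<close> is identified with a multiple of the
  primitive \<open>Q\<close> of a continuous function \<open>R\<close> and inherits
  differentiability from it. For \<open>b = 0\<close> the clock takes integer values and
  \<open>T\<close> jumps, but there no derivative is left and right continuity is enough to have the
  equation at every time rather than almost everywhere. The relation \<open>p' = h\<close> enters
  only through resolvents: by Fourier inversion \<open>p\<close> and \<open>h\<close> are integrals
  of \<open>exp (- s \<Psi>(- \<xi>))\<close> against integrable functions of \<open>\<xi>\<close>,
  and the relation becomes an identity between their integrands after the Laplace transform in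
  \<open>s\<close>.\<close>

abbreviation laplace_at :: "(real \<Rightarrow> real) \<Rightarrow> real \<Rightarrow> real \<Rightarrow> bool" where
  "laplace_at f \<eta> l \<equiv> has_bochner_integral lborel (\<lambda>t. exp (- (\<eta> * t)) * f t) l"

text \<open>Fubini and translation invariance. Joint integrability comes from the iterated integral
  of the absolute values, in which the inner integral does not depend on \<open>s\<close>.\<close>

lemma has_bochner_integral_convolution:
  fixes f g :: "real \<Rightarrow> real"
  assumes f: "integrable lborel f" and g: "integrable lborel g"
  shows "has_bochner_integral lborel (\<lambda>t. \<integral>s. f s * g (t - s) \<partial>lborel)
           ((\<integral>s. f s \<partial>lborel) * (\<integral>s. g s \<partial>lborel))"
proof -
  note [measurable] = borel_measurable_integrable[OF f] borel_measurable_integrable[OF g]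
  have shift: "(\<integral>t. h (t - s) \<partial>lborel) = (\<integral>t. h t \<partial>lborel)" for h :: "real \<Rightarrow> real" and s
    using lborel_integral_real_affine[of 1 h "- s"] by simp
  have gi: "integrable lborel (\<lambda>t. g (t - s))" for s
    using lborel_integrable_real_affine[OF g, of 1 "- s"] by simp
  have int: "integrable (lborel \<Otimes>\<^sub>M lborel) (\<lambda>(s, t). f s * g (t - s))"
  proof (rule lborel_pair.Fubini_integrable)
    show "integrable lborel (\<lambda>x. LINT y|lborel. norm (case (x, y) of (s, t) \<Rightarrow> f s * g (t - s)))"
      using f by (simp add: abs_mult shift[of "\<lambda>t. \<bar>g t\<bar>"] integrable_abs)
    show "AE x in lborel. integrable lborel (\<lambda>y. case (x, y) of (s, t) \<Rightarrow> f s * g (t - s))"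
      using gi by simp
  qed simp
  have "(\<integral>t. (\<integral>s. f s * g (t - s) \<partial>lborel) \<partial>lborel) = (\<integral>s. (\<integral>t. f s * g (t - s) \<partial>lborel) \<partial>lborel)"
    using lborel_pair.Fubini_integral[of "\<lambda>s t. f s * g (t - s)"] int by simp
  also have "\<dots> = (\<integral>s. f s \<partial>lborel) * (\<integral>s. g s \<partial>lborel)"
    by (simp add: shift)
  finally show ?thesis
    using lborel_pair.integrable_snd[OF int] by (simp add: has_bochner_integral_iff)
qed

text \<open>The weight is multiplicative,
  \<open>exp (- \<eta> s) exp (- \<eta> (t - s)) = exp (- \<eta> t)\<close>, so weighting both
  factors weights their convolution. All integrals run over the whole line; for functions vanishing
  on the negatives this is the usual convolution over \<open>[0, t]\<close>.\<close>

lemma laplace_convolution: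
  assumes f: "laplace_at f \<eta> l" and g: "laplace_at g \<eta> k"
  shows "laplace_at (\<lambda>t. \<integral>s. f s * g (t - s) \<partial>lborel) \<eta> (l * k)"
proof -
  have e: "exp (- (\<eta> * s)) * f s * (exp (- (\<eta> * (t - s))) * g (t - s))
      = exp (- (\<eta> * t)) * (f s * g (t - s))" for s t
  proof -
    have "exp (- (\<eta> * s)) * exp (- (\<eta> * (t - s))) = exp (- (\<eta> * t))"
      by (simp add: algebra_simps flip: exp_add)
    then show ?thesis by (metis mult.assoc mult.left_commute)
  qed
  show ?thesis
    using has_bochner_integral_convolution[of "\<lambda>t. exp (- (\<eta> * t)) * f t" "\<lambda>t. exp (- (\<eta> * t)) * g t"] f g
    unfolding e by (simp add: has_bochner_integral_iff)
qed

lemma laplace_shift: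
  assumes "laplace_at f \<eta> l"
  shows "laplace_at (\<lambda>t. f (t - a)) \<eta> (exp (- (\<eta> * a)) * l)"
proof -
  have "has_bochner_integral lborel (\<lambda>t. exp (- (\<eta> * (- a + 1 * t))) * f (- a + 1 * t)) (l /\<^sub>R \<bar>1\<bar>)"
    using assms by (subst lborel_has_bochner_integral_real_affine_iff[symmetric]) auto
  from has_bochner_integral_mult_right[OF this, of "exp (- (\<eta> * a))"]
  show ?thesis by (simp add: algebra_simps flip: exp_add mult.assoc)
qed

text \<open>Euler's integral for \<open>Gamma (1 - \<beta>)\<close> rescaled by
  \<open>\<eta>\<close>. Open and closed half line give the same integrand because
  \<open>0 powr a = 0\<close>.\<close>

lemma laplace_powr:
  assumes \<eta>: "0 < \<eta>" and \<beta>: "\<beta> < 1"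
  shows "laplace_at (\<lambda>t. indicator {0<..} t * t powr (- \<beta>)) \<eta> (Gamma (1 - \<beta>) * \<eta> powr (\<beta> - 1))"
proof -
  have G: "0 < Gamma (1 - \<beta>)" using \<beta> by (intro Gamma_real_pos) simp
  have "(\<integral>\<^sup>+ t. ennreal (indicator {0<..} t * (t powr (- \<beta>)) / exp t) \<partial>lborel)
      = (\<integral>\<^sup>+ t. ennreal (indicator {0..} t * (t powr (- \<beta>)) / exp t) \<partial>lborel)"
    by (intro nn_integral_cong) (auto split: split_indicator)
  also have "\<dots> = ennreal (Gamma (1 - \<beta>))"
    using Gamma_conv_nn_integral_real[of "1 - \<beta>"] \<beta> by simp
  finally have "has_bochner_integral lborel (\<lambda>t. indicator {0<..} t * (t powr (- \<beta>)) / exp t) (Gamma (1 - \<beta>))"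
    using G by (intro has_bochner_integral_nn_integral) auto
  then have "has_bochner_integral lborel (\<lambda>t. indicator {0<..} (0 + \<eta> * t) * ((0 + \<eta> * t) powr (- \<beta>)) / exp (0 + \<eta> * t))
      (Gamma (1 - \<beta>) /\<^sub>R \<bar>\<eta>\<bar>)"
    using \<eta> by (subst lborel_has_bochner_integral_real_affine_iff[symmetric]) auto
  from has_bochner_integral_mult_right[OF this, of "\<eta> powr \<beta>"]
  have "has_bochner_integral lborel (\<lambda>t. \<eta> powr \<beta> * (indicator {0<..} (\<eta> * t) * ((\<eta> * t) powr (- \<beta>)) / exp (\<eta> * t)))
      (Gamma (1 - \<beta>) * \<eta> powr (\<beta> - 1))"
    using \<eta> by (simp add: field_simps powr_diff)
  moreover have "\<eta> powr \<beta> * (indicator {0<..} (\<eta> * t) * ((\<eta> * t) powr (- \<beta>)) / exp (\<eta> * t))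
      = exp (- (\<eta> * t)) * (indicator {0<..} t * t powr (- \<beta>))" for t
    using \<eta> by (auto simp: indicator_def zero_less_mult_iff powr_mult powr_minus exp_minus field_simps)
  ultimately show ?thesis by simp
qed

text \<open>The case \<beta> = 0 of the power kernel. The two functions differ at 0, where
  \<open>0 powr 0 = 0\<close> but \<open>heaviside 0 = 1\<close>, which is a null set.\<close>

lemma laplace_heaviside:
  assumes "0 < \<eta>" shows "laplace_at heaviside \<eta> (1 / \<eta>)"
proof -
  have "laplace_at (\<lambda>t. indicator {0<..} t * t powr (- 0)) \<eta> (1 / \<eta>)"
    using laplace_powr[of \<eta> 0] assms by (simp add: powr_minus_divide)
  then show ?thesis
    by (rule has_bochner_integral_cong_AE[THEN iffD1, rotated -1])
      (use AE_lborel_singleton[of 0] in \<open>auto simp: heaviside_def[abs_def] split: split_indicator\<close>)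
qed

lemma laplace_bounded:
  fixes f :: "real \<Rightarrow> real"
  assumes [measurable]: "f \<in> borel_measurable borel"
    and C: "\<And>t. \<bar>f t\<bar> \<le> C" and neg: "\<And>t. t < 0 \<Longrightarrow> f t = 0" and \<eta>: "0 < \<eta>"
  shows "integrable lborel (\<lambda>t. exp (- (\<eta> * t)) * f t)"
    and "(\<integral>t. \<bar>exp (- (\<eta> * t)) * f t\<bar> \<partial>lborel) \<le> C / \<eta>"
proof -
  have D: "has_bochner_integral lborel (\<lambda>t::real. C * (exp (- (\<eta> * t)) * heaviside t)) (C / \<eta>)"
    using has_bochner_integral_mult_right[OF laplace_heaviside[OF \<eta>], of C] by simp
  have B: "\<bar>exp (- (\<eta> * t)) * f t\<bar> \<le> C * (exp (- (\<eta> * t)) * heaviside t)" for t :: real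
    using C[of t] neg[of t] by (auto simp: heaviside_def abs_mult mult.commute)
  show I: "integrable lborel (\<lambda>t. exp (- (\<eta> * t)) * f t)"
    by (rule Bochner_Integration.integrable_bound[of _ "\<lambda>t::real. C * (exp (- (\<eta> * t)) * heaviside t)"])
      (use D B in \<open>auto simp: has_bochner_integral_iff intro: order_trans[OF _ abs_ge_self]\<close>)
  show "(\<integral>t. \<bar>exp (- (\<eta> * t)) * f t\<bar> \<partial>lborel) \<le> C / \<eta>"
    using integral_mono[of lborel "\<lambda>t. \<bar>exp (- (\<eta> * t)) * f t\<bar>" "\<lambda>t::real. C * (exp (- (\<eta> * t)) * heaviside t)"] D B I
    by (simp add: has_bochner_integral_iff integrable_abs)
qed

text \<open>The substitution \<open>x = exp (- t)\<close> turns the values of the Laplace transform at the positive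
  integers into moments on \<open>[0, 1]\<close>; by Weierstrass approximation they determine the function.\<close>

lemma laplace_zero_moments:
  assumes L: "\<And>\<eta>. 0 < \<eta> \<Longrightarrow> laplace_at f \<eta> 0" and neg: "\<And>t. t < 0 \<Longrightarrow> f t = 0"
    and g: "continuous_on UNIV (g :: real \<Rightarrow> real)"
  shows "has_bochner_integral lborel (\<lambda>t. g (exp (- t)) * (exp (- t) * f t)) 0"
proof -
  define F where "F t = exp (- t) * f t" for t
  have F: "integrable lborel F"
    using L[of 1] by (simp add: F_def[abs_def] has_bochner_integral_iff)
  note [measurable] = borel_measurable_integrable[OF F] borel_measurable_continuous_onI[OF g]
  have mom: "has_bochner_integral lborel (\<lambda>t. exp (- t) ^ k * F t) 0" for k :: nat
  proof -
    \<comment> \<open>The factor \<open>exp (- t)\<close> inside \<open>F\<close> shifts the index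
      by one, so that even the moment of order 0 is a transform at a positive argument.\<close>
    have "exp (- t) ^ k * F t = exp (- ((real k + 1) * t)) * f t" for t
      by (simp add: F_def exp_of_nat_mult[symmetric] algebra_simps flip: exp_add mult.assoc)
    then show ?thesis using L[of "real k + 1"] by simp
  qed
  have poly: "has_bochner_integral lborel (\<lambda>t. Bernstein n k (exp (- t)) * F t) 0" for n k
  proof -
    \<comment> \<open>Expanding \<open>(1 - x) ^ (n - k)\<close> writes a Bernstein polynomial as a
      combination of monomials, to which the vanishing moments apply.\<close>
    have e: "Bernstein n k x = (\<Sum>i\<le>n-k. real (n choose k) * real ((n-k) choose i) * (- 1) ^ (n-k-i) * x ^ (k + (n-k-i)))" for x
      using binomial_ring[of 1 "-x" "n-k"]
      by (simp add: Bernstein_def sum_distrib_left power_minus[of x] power_add mult_ac)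
    have "has_bochner_integral lborel (\<lambda>t. \<Sum>i\<le>n-k. (real (n choose k) * real ((n-k) choose i) * (- 1) ^ (n-k-i))
        * (exp (- t) ^ (k + (n-k-i)) * F t)) (\<Sum>i\<le>n-k. (real (n choose k) * real ((n-k) choose i) * (- 1) ^ (n-k-i)) * 0)"
      by (intro has_bochner_integral_sum has_bochner_integral_mult_right mom)
    then show ?thesis unfolding e sum_distrib_right by (simp only: mult.assoc mult_zero_right sum.neutral_const)
  qed
  have gcont: "continuous_on {0..1} g" using g by (rule continuous_on_subset) simp
  have "bounded (g ` {0..1})"
    using compact_continuous_image[OF gcont] compact_imp_bounded by auto
  then obtain C where C: "\<And>x. x \<in> {0..1} \<Longrightarrow> \<bar>g x\<bar> \<le> C"
    unfolding bounded_iff by (metis image_eqI real_norm_def)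
  have bd: "\<bar>g (exp (- t)) * F t\<bar> \<le> C * \<bar>F t\<bar>" for t
    using C[of "exp (- t)"] neg[of t] by (cases "t < 0") (auto simp: abs_mult F_def intro!: mult_right_mono)
  have I: "integrable lborel (\<lambda>t. g (exp (- t)) * F t)"
    by (rule Bochner_Integration.integrable_bound[of _ "\<lambda>t. C * \<bar>F t\<bar>"])
      (use F bd in \<open>auto intro!: integrable_mult_right order_trans[OF _ abs_ge_self] simp: integrable_abs\<close>)
  have "\<bar>\<integral>t. g (exp (- t)) * F t \<partial>lborel\<bar> \<le> e * (\<integral>t. \<bar>F t\<bar> \<partial>lborel)" if "0 < e" for e
  proof -
    obtain n where n: "\<And>x. x \<in> {0..1} \<Longrightarrow> \<bar>g x - (\<Sum>k\<le>n. g (k/n) * Bernstein n k x)\<bar> < e"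
      using Bernstein_Weierstrass[OF gcont \<open>0 < e\<close>] by blast
    let ?P = "\<lambda>t. (\<Sum>k\<le>n. g (k/n) * (Bernstein n k (exp (- t)) * F t))"
    have P: "has_bochner_integral lborel ?P (\<Sum>k\<le>n. g (k/n) * 0)"
      by (intro has_bochner_integral_sum has_bochner_integral_mult_right poly)
    have "(\<integral>t. g (exp (- t)) * F t \<partial>lborel) = (\<integral>t. g (exp (- t)) * F t - ?P t \<partial>lborel)"
      using P I by (simp add: has_bochner_integral_iff)
    then have "\<bar>\<integral>t. g (exp (- t)) * F t \<partial>lborel\<bar> \<le> (\<integral>t. \<bar>g (exp (- t)) * F t - ?P t\<bar> \<partial>lborel)"
      by (simp only: integral_abs_bound)
    also have "\<dots> \<le> (\<integral>t. e * \<bar>F t\<bar> \<partial>lborel)"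
    proof (rule integral_mono)
      fix t :: real
      have "g (exp (- t)) * F t - ?P t = (g (exp (- t)) - (\<Sum>k\<le>n. g (k/n) * Bernstein n k (exp (- t)))) * F t"
        by (simp only: sum_distrib_right left_diff_distrib mult.assoc)
      then show "\<bar>g (exp (- t)) * F t - ?P t\<bar> \<le> e * \<bar>F t\<bar>"
        using n[of "exp (- t)"] neg[of t]
        by (cases "t < 0") (auto simp: abs_mult F_def intro!: mult_right_mono)
    qed (use P I F in \<open>auto simp: has_bochner_integral_iff integrable_abs\<close>)
    finally show ?thesis by simp
  qed
  note small = this
  have "\<bar>\<integral>t. g (exp (- t)) * F t \<partial>lborel\<bar> \<le> 0"
  proof (rule field_le_epsilon)
    fix e :: real assume "0 < e"
    define c where "c = (\<integral>t. \<bar>F t\<bar> \<partial>lborel)"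
    have c: "0 \<le> c" by (simp add: c_def)
    \<comment> \<open>Dividing by \<open>c + 1\<close> instead of \<open>c\<close> covers the case
      that \<open>F\<close> vanishes almost everywhere.\<close>
    then have "e / (c + 1) * c \<le> e" using \<open>0 < e\<close> by (simp add: field_simps)
    then show "\<bar>\<integral>t. g (exp (- t)) * F t \<partial>lborel\<bar> \<le> 0 + e"
      using small[of "e / (c + 1)"] \<open>0 < e\<close> c by (simp flip: c_def)
  qed
  then show ?thesis using I by (simp add: has_bochner_integral_iff F_def)
qed

text \<open>Continuous functions of \<open>exp (- r)\<close> approximate the indicator of
  \<open>r < s\<close>, so all integrals of \<open>F\<close> over intervals starting at
  \<open>t\<close> vanish. Their right derivative at \<open>t\<close> is \<open>F t\<close> by right
  continuity, which gives the value at every single point.\<close>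

lemma laplace_zero_imp_zero:
  assumes L: "\<And>\<eta>. 0 < \<eta> \<Longrightarrow> laplace_at f \<eta> 0" and neg: "\<And>t. t < 0 \<Longrightarrow> f t = 0"
    and rc: "\<And>t. 0 \<le> t \<Longrightarrow> continuous (at_right t) f"
  shows "f t = 0"
proof (cases "t < 0")
  case False
  define F where "F t = exp (- t) * f t" for t
  have F: "integrable lborel F"
    using L[of 1] by (simp add: F_def[abs_def] has_bochner_integral_iff)
  note [measurable] = borel_measurable_integrable[OF F]
  have zero: "(\<integral>r. indicator {..<s} r * F r \<partial>lborel) = 0" for s
  proof -
    \<comment> \<open>A ramp of slope \<open>n\<close> cut off to \<open>[0, 1]\<close>. It tends to
      the indicator of \<open>exp (- s) < x\<close>, which for \<open>x = exp (- r)\<close> says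
      \<open>r < s\<close>.\<close>
    define g where "g n x = max 0 (min 1 (real n * (x - exp (- s))))" for n x
    have "(\<lambda>n. \<integral>r. g n (exp (- r)) * F r \<partial>lborel) \<longlonglongrightarrow> (\<integral>r. indicator {..<s} r * F r \<partial>lborel)"
    proof (rule integral_dominated_convergence[where w="\<lambda>r. \<bar>F r\<bar>"])
      show "AE r in lborel. (\<lambda>n. g n (exp (- r)) * F r) \<longlonglongrightarrow> indicator {..<s} r * F r"
      proof (intro AE_I2 tendsto_mult tendsto_const)
        fix r :: real
        show "(\<lambda>n. g n (exp (- r))) \<longlonglongrightarrow> indicator {..<s} r"
        proof (cases "r < s")
          case True
          then have p: "0 < exp (- r) - exp (- s)" by simp
          obtain n0 where "1 / (exp (- r) - exp (- s)) < real n0" using reals_Archimedean2 by blast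
          then have "1 < real n0 * (exp (- r) - exp (- s))" using p by (simp add: field_simps)
          then have "g n (exp (- r)) = 1" if "n0 \<le> n" for n
            using that p order_trans[OF less_imp_le mult_right_mono[of "real n0" "real n" "exp (- r) - exp (- s)"]]
            by (simp add: g_def min_absorb1)
          then show ?thesis using True
            by (intro tendsto_eventually) (auto simp: eventually_sequentially)
        next
          case False
          then have "real n * (exp (- r) - exp (- s)) \<le> 0" for n
            by (intro mult_nonneg_nonpos) auto
          then have "g n (exp (- r)) = 0" for n
            unfolding g_def by (meson max_absorb1 min.coboundedI2)
          then show ?thesis using False by simp
        qed
      qed
      show "AE r in lborel. norm (g n (exp (- r)) * F r) \<le> \<bar>F r\<bar>" for n
        by (intro AE_I2) (auto simp: abs_mult g_def intro!: mult_left_le_one_le)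
    qed (use F in \<open>auto simp: g_def integrable_abs\<close>)
    moreover have "(\<integral>r. g n (exp (- r)) * F r \<partial>lborel) = 0" for n
    proof -
      have "continuous_on UNIV (g n)" unfolding g_def by (intro continuous_intros)
      from laplace_zero_moments[OF L neg this] show ?thesis
        by (simp add: has_bochner_integral_iff F_def)
    qed
    ultimately show ?thesis by (simp add: LIMSEQ_const_iff)
  qed
  have seg: "integral {t..s} F = 0" and intg: "F integrable_on {t..s}" if "t \<le> s" for s
  proof -
    have si: "set_integrable lborel {t..s} F"
      unfolding set_integrable_def using F by (intro integrable_mult_indicator) auto
    have ii: "integrable lborel (\<lambda>r. indicator {..<a} r * F r)" for a
      using integrable_mult_indicator[OF _ F, of "{..<a}"] by simp
    have "(\<integral>r\<in>{t..s}. F r \<partial>lborel) = (\<integral>r. indicator {..<s} r * F r - indicator {..<t} r * F r \<partial>lborel)"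
      unfolding set_lebesgue_integral_def
      by (rule integral_cong_AE)
        (use AE_lborel_singleton[of s] AE_lborel_singleton[of t] that in \<open>auto split: split_indicator\<close>)
    also have "\<dots> = 0" using zero ii by simp
    finally show "integral {t..s} F = 0" using set_borel_integral_eq_integral(2)[OF si] by simp
    show "F integrable_on {t..s}" by (rule set_borel_integral_eq_integral(1)[OF si])
  qed
  have "continuous (at t within {t..t+1}) F"
  proof -
    have "continuous (at_right t) f" using rc False by simp
    then have "continuous (at_right t) F" unfolding F_def by (intro continuous_intros)
    then show ?thesis by (simp add: continuous_within at_within_Icc_at_right)
  qed
  \<comment> \<open>Within \<open>{t..t+1}\<close> the derivative at \<open>t\<close> is one-sided,
    so right continuity suffices for the fundamental theorem.\<close>
  then have "((\<lambda>u. integral {t..u} F) has_vector_derivative F t) (at t within {t..t+1})"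
    using integral_has_vector_derivative_continuous_at[of F t "t+1" t "{}"] intg by simp
  then have "((\<lambda>u. 0) has_vector_derivative F t) (at t within {t..t+1})"
    by (rule has_vector_derivative_transform[rotated -1]) (auto simp: seg)
  then have "F t = 0"
    using vector_derivative_unique_within[of t "{t..t+1}" "\<lambda>u. 0" "F t" 0]
    by (simp add: at_within_Icc_at_right trivial_limit_at_right_real has_vector_derivative_const)
  then show ?thesis by (simp add: F_def)
qed (rule neg)

section \<open>The fractional shift and the fractional kernel\<close>

lemma filterlim_shift_at_right:
  fixes t a :: real
  shows "filterlim (\<lambda>s. s - a) (at_right (t - a)) (at_right t)"
  unfolding filterlim_at
  by (auto intro!: tendsto_intros eventually_mono[OF eventually_at_right_less[of t]])

lemma K1_power: "(K1 ^^ j) v t = v (t - real j)"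
  by (induction j arbitrary: t) (auto simp: K1_def algebra_simps)

text \<open>Shifts by more than \<open>t\<close> reach the negative half line, where
  \<open>v\<close> vanishes. Leaving \<open>n\<close> free lets one number serve all times near
  \<open>t\<close>, or two functions at once.\<close>

lemma frac_shift_finite:
  assumes "\<And>s. s < 0 \<Longrightarrow> v s = 0" and "t < real n"
  shows "frac_shift \<gamma> v t = (\<Sum>j<n. (-1) ^ j * (\<gamma> gchoose j) * v (t - real j))"
  unfolding frac_shift_def K1_power using assms by (intro suminf_finite) auto

lemma frac_shift_add_scaled:
  assumes "\<And>s. s < 0 \<Longrightarrow> v s = 0" and "\<And>s. s < 0 \<Longrightarrow> w s = 0"
  shows "frac_shift \<gamma> (\<lambda>s. v s + c * w s) t = frac_shift \<gamma> v t + c * frac_shift \<gamma> w t"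
proof -
  obtain n where n: "t < real n" using reals_Archimedean2 by blast
  show ?thesis
    using assms by (simp add: frac_shift_finite[OF _ n] sum.distrib sum_distrib_left algebra_simps)
qed

lemma continuous_frac_shift:
  assumes neg: "\<And>s. s < 0 \<Longrightarrow> v s = 0"
    and c: "\<And>j. continuous (at t within S) (\<lambda>s. v (s - real j))"
  shows "continuous (at t within S) (frac_shift \<gamma> v)"
proof -
  obtain n where n: "t < real n" using reals_Archimedean2 by blast
  let ?f = "\<lambda>s. (\<Sum>j<n. (-1) ^ j * (\<gamma> gchoose j) * v (s - real j))"
  have "\<forall>\<^sub>F s in at t within S. s < real n"
    using order_tendstoD(2)[OF tendsto_ident_at n] .
  then have ev: "\<forall>\<^sub>F s in at t within S. ?f s = frac_shift \<gamma> v s"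
    by eventually_elim (simp add: frac_shift_finite[of v, OF neg])
  have "continuous (at t within S) ?f"
    using c by (intro continuous_intros) auto
  then have "(?f \<longlongrightarrow> frac_shift \<gamma> v t) (at t within S)"
    using frac_shift_finite[of v t n \<gamma>, OF neg n] by (simp add: continuous_within)
  then show ?thesis
    unfolding continuous_within using ev by (rule Lim_transform_eventually)
qed

text \<open>Consecutive coefficients differ by the factor \<open>(\<gamma> - j) / (j + 1)\<close>,
  of modulus at most 1 for \<open>\<gamma>\<close> in \<open>[0, 1]\<close>. This crude bound is
  enough beside the geometric factor \<open>exp (- \<eta>) ^ j\<close> of the transformed
  shift.\<close>

lemma abs_gbinomial_le_1:
  fixes \<gamma> :: real
  assumes "0 \<le> \<gamma>" "\<gamma> \<le> 1"
  shows "\<bar>\<gamma> gchoose j\<bar> \<le> 1"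
proof (induction j)
  case (Suc j)
  have "(\<gamma> gchoose Suc j) = (\<gamma> - real j) / (real j + 1) * (\<gamma> gchoose j)"
    using gbinomial_mult_1[of \<gamma> j] by (simp add: field_simps)
  moreover have "\<bar>(\<gamma> - real j) / (real j + 1)\<bar> \<le> 1" using assms by (simp add: abs_le_iff)
  ultimately show ?case using Suc by (simp only: abs_mult) (intro mult_le_one, auto)
qed simp

text \<open>A shift by \<open>j\<close> multiplies the transform by
  \<open>exp (- \<eta>) ^ j\<close>. A geometric majorant permits summation under the integral, and
  the coefficients add up to the binomial series of \<open>(1 + x) powr \<gamma>\<close> at
  \<open>x = - exp (- \<eta>)\<close>.\<close>

lemma laplace_frac_shift:
  assumes Z: "laplace_at Z \<eta> l" and neg: "\<And>t. t < 0 \<Longrightarrow> Z t = 0"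
    and \<gamma>: "0 \<le> \<gamma>" "\<gamma> \<le> 1" and \<eta>: "0 < \<eta>"
  shows "laplace_at (frac_shift \<gamma> Z) \<eta> ((1 - exp (- \<eta>)) powr \<gamma> * l)"
proof -
  define a where "a j = (-1) ^ j * (\<gamma> gchoose j)" for j
  have a1: "\<bar>a j\<bar> \<le> 1" for j using abs_gbinomial_le_1[OF \<gamma>, of j] by (simp add: a_def abs_mult)
  define f where "f j t = a j * (exp (- (\<eta> * t)) * Z (t - real j))" for j t
  have e: "exp (- (\<eta> * real j)) = exp (- \<eta>) ^ j" for j
    by (simp add: exp_of_nat_mult[symmetric] mult.commute)
  have f: "has_bochner_integral lborel (f j) (a j * exp (- \<eta>) ^ j * l)" for j
    unfolding f_def mult.assoc e[symmetric] by (intro has_bochner_integral_mult_right laplace_shift Z)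
  have absZ: "laplace_at (\<lambda>t. \<bar>Z t\<bar>) \<eta> (\<integral>t. \<bar>exp (- (\<eta> * t)) * Z t\<bar> \<partial>lborel)"
    using integrable_abs[of lborel "\<lambda>t. exp (- (\<eta> * t)) * Z t"] Z
    by (simp add: has_bochner_integral_iff abs_mult)
  have nf: "(\<integral>t. norm (f j t) \<partial>lborel) = \<bar>a j\<bar> * (exp (- \<eta>) ^ j * (\<integral>t. \<bar>exp (- (\<eta> * t)) * Z t\<bar> \<partial>lborel))" for j
    using has_bochner_integral_mult_right[OF laplace_shift[OF absZ, of "real j"], of "\<bar>a j\<bar>"]
    by (simp add: f_def abs_mult e has_bochner_integral_iff)
  have fin: "f j t = 0" if "t < real j" for j t
    using neg that by (simp add: f_def)
  \<comment> \<open>At a fixed time all but finitely many terms are zero.\<close>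
  have summ: "AE t in lborel. summable (\<lambda>j. norm (f j t))"
  proof (intro AE_I2)
    fix t :: real
    obtain n where "t < real n" using reals_Archimedean2 by blast
    then show "summable (\<lambda>j. norm (f j t))"
      by (intro summable_finite[of "{..<n}"]) (auto intro: fin)
  qed
  have "summable (\<lambda>j. (\<integral>t. norm (f j t) \<partial>lborel))"
  proof (rule summable_comparison_test')
    show "summable (\<lambda>j. exp (- \<eta>) ^ j * (\<integral>t. \<bar>exp (- (\<eta> * t)) * Z t\<bar> \<partial>lborel))"
      using \<eta> by (intro summable_mult2 summable_geometric) simp
    show "norm (\<integral>t. norm (f j t) \<partial>lborel) \<le> exp (- \<eta>) ^ j * (\<integral>t. \<bar>exp (- (\<eta> * t)) * Z t\<bar> \<partial>lborel)" if "0 \<le> j" for j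
      unfolding nf using a1[of j] by (simp add: abs_mult mult_left_le_one_le)
  qed
  note S = integrable_suminf[OF _ summ this] sums_integral[OF _ summ this]
  have i: "integrable lborel (f j)" for j using f by (simp add: has_bochner_integral_iff)
  have sf: "(\<Sum>j. f j t) = exp (- (\<eta> * t)) * frac_shift \<gamma> Z t" for t
  proof -
    obtain n where n: "t < real n" using reals_Archimedean2 by blast
    have "(\<Sum>j. f j t) = (\<Sum>j<n. f j t)" using fin n by (intro suminf_finite) auto
    then show ?thesis using frac_shift_finite[of Z t n \<gamma>, OF neg n]
      by (simp add: f_def a_def sum_distrib_left mult_ac)
  qed
  have "(\<lambda>j. a j * exp (- \<eta>) ^ j * l) sums (\<integral>t. exp (- (\<eta> * t)) * frac_shift \<gamma> Z t \<partial>lborel)"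
    using S(2)[OF i] f by (simp add: has_bochner_integral_iff sf)
  moreover have "(\<lambda>j. a j * exp (- \<eta>) ^ j * l) sums ((1 - exp (- \<eta>)) powr \<gamma> * l)"
  proof -
    have "(\<lambda>j. (\<gamma> gchoose j) * (- exp (- \<eta>)) ^ j) sums (1 + - exp (- \<eta>)) powr \<gamma>"
      using \<eta> by (intro gen_binomial_real) simp
    moreover have "(\<gamma> gchoose j) * (- exp (- \<eta>)) ^ j = a j * exp (- \<eta>) ^ j" for j
      by (simp add: a_def power_minus[of "exp (- \<eta>)"])
    ultimately show ?thesis by (intro sums_mult2) simp
  qed
  ultimately show ?thesis using S(1)[OF i] by (simp add: has_bochner_integral_iff sf sums_iff)
qed

text \<open>The Gamma quotients are the binomial coefficients in disguise: \<open>(-1) ^ k (\<gamma>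
  gchoose k) = Gamma (k - \<gamma>) / (Gamma (- \<gamma>) k!)\<close> together with
  \<open>Gamma (1 - \<gamma>) = - \<gamma> Gamma (- \<gamma>)\<close>. For \<gamma> = 1 the Gamma
  function has a pole, while the shift \<open>I - K1\<close> has just two terms.\<close>

lemma boundary_datum_eq:
  assumes "0 < \<gamma>" "\<gamma> \<le> 1" "0 < lam"
  shows "boundary_datum \<gamma> lam t = lam powr \<gamma> * frac_shift \<gamma> heaviside t"
proof (cases "\<gamma> = 1")
  case True
  have "frac_shift 1 heaviside t = (\<Sum>j<2. (-1) ^ j * ((1::real) gchoose j) * heaviside (t - real j))"
    unfolding frac_shift_def K1_power
  proof (rule suminf_finite)
    fix j :: nat assume "j \<notin> {..<2}"
    then have "(1::real) gchoose j = 0"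
      using binomial_gbinomial[of 1 j, where 'a=real] by (simp add: binomial_eq_0)
    then show "(-1) ^ j * ((1::real) gchoose j) * heaviside (t - real j) = 0" by simp
  qed simp
  then show ?thesis using True assms by (simp add: boundary_datum_def eval_nat_numeral)
next
  case False
  then have \<gamma>: "0 < \<gamma>" "\<gamma> < 1" using assms by auto
  \<comment> \<open>Since \<open>- \<gamma>\<close> lies strictly between -1 and 0 it is no pole,
    and the Gamma recursion and the Pochhammer quotient are available there.\<close>
  have ni: "- \<gamma> \<notin> \<int>\<^sub>\<le>\<^sub>0"
  proof
    assume "- \<gamma> \<in> \<int>\<^sub>\<le>\<^sub>0"
    then obtain i where "- \<gamma> = of_int i" by (auto simp: nonpos_Ints_def)
    then have "0 < - i \<and> - i < 1" using \<gamma> by linarith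
    then show False by linarith
  qed
  have G: "Gamma (- \<gamma>) \<noteq> 0" using ni by (simp add: Gamma_eq_zero_iff)
  have G1: "Gamma (1 - \<gamma>) = - \<gamma> * Gamma (- \<gamma>)"
    using Gamma_plus1[of "- \<gamma>"] ni by auto
  have co: "- (\<gamma> / Gamma (1 - \<gamma>)) * (Gamma (real k - \<gamma>) / fact k) = (-1) ^ k * (\<gamma> gchoose k)" for k
    using pochhammer_Gamma[OF ni, of k] G \<gamma>
    by (simp add: gbinomial_pochhammer G1 field_simps flip: power_mult_distrib power_add)
  obtain n where n: "t < real n" using reals_Archimedean2 by blast
  have "(\<Sum>k. Gamma (real k - \<gamma>) / fact k * heaviside (t - real k))
      = (\<Sum>k<n. Gamma (real k - \<gamma>) / fact k * heaviside (t - real k))"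
    using n by (intro suminf_finite) (auto simp: heaviside_def)
  then have "boundary_datum \<gamma> lam t
      = lam powr \<gamma> * (\<Sum>k<n. - (\<gamma> / Gamma (1 - \<gamma>)) * (Gamma (real k - \<gamma>) / fact k) * heaviside (t - real k))"
    using False by (simp add: boundary_datum_def sum_distrib_left sum_negf mult_ac)
  also have "\<dots> = lam powr \<gamma> * frac_shift \<gamma> heaviside t"
    unfolding co using n by (subst frac_shift_finite[of _ _ n]) (auto simp: heaviside_def)
  finally show ?thesis .
qed

text \<open>Up to the factor \<open>1 / Gamma (1 - \<beta>)\<close>, the fractional integral of the
  constant 1. The reflection \<open>s \<mapsto> t - s\<close> moves the singularity to 0.\<close>

lemma has_bochner_integral_powr:
  fixes t \<beta> :: real
  assumes \<beta>: "\<beta> < 1" and t: "0 < t"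
  shows "has_bochner_integral lborel (\<lambda>s. indicator {0<..<t} s * (t - s) powr (- \<beta>)) (t powr (1 - \<beta>) / (1 - \<beta>))"
proof -
  have "((\<lambda>x. x powr (- \<beta>)) has_integral (t powr (- \<beta> + 1) / (- \<beta> + 1))) {0..t}"
    using has_integral_powr_from_0[of "- \<beta>" t] assms by simp
  then have "(\<integral>\<^sup>+ x. ennreal (indicator {0..t} x * x powr (- \<beta>)) \<partial>lborel) = ennreal (t powr (- \<beta> + 1) / (- \<beta> + 1))"
    using nn_integral_has_integral_lebesgue[of "{0..t}" "\<lambda>x. x powr (- \<beta>)"] by simp
  then have "has_bochner_integral lborel (\<lambda>x. indicator {0..t} x * x powr (- \<beta>)) (t powr (- \<beta> + 1) / (- \<beta> + 1))"
    using \<beta> by (intro has_bochner_integral_nn_integral) auto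
  then have "has_bochner_integral lborel (\<lambda>x. indicator {0<..<t} x * x powr (- \<beta>)) (t powr (- \<beta> + 1) / (- \<beta> + 1))"
    by (rule has_bochner_integral_cong_AE[THEN iffD1, rotated -1])
      (use AE_lborel_singleton[of t] in \<open>auto split: split_indicator\<close>)
  then have "has_bochner_integral lborel (\<lambda>x. indicator {0<..<t} (t + (-1) * x) * (t + (-1) * x) powr (- \<beta>))
      (t powr (- \<beta> + 1) / (- \<beta> + 1) /\<^sub>R \<bar>-1\<bar>)"
    by (subst lborel_has_bochner_integral_real_affine_iff[symmetric]) auto
  moreover have "indicator {0<..<t} (t - x) = (indicator {0<..<t} x :: real)" for x
    by (auto split: split_indicator)
  ultimately show ?thesis by (simp add: add.commute)
qed

text \<open>On \<open>s \<le> a\<close> one has \<open>1 \<le> exp a * exp (- s)\<close>, so the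
  integrand of the Laplace transform at 1, times \<open>exp a\<close>, is a majorant.\<close>

lemma integrable_powr_atMost:
  fixes a \<beta> :: real
  assumes "\<beta> < 1"
  shows "integrable lborel (\<lambda>s. indicator {..a} s * (indicator {0<..} s * s powr (- \<beta>)))"
proof (rule Bochner_Integration.integrable_bound)
  let ?h = "\<lambda>s. exp a * (exp (- (1 * s)) * (indicator {0<..} s * s powr (- \<beta>)))"
  show "integrable lborel ?h"
    using laplace_powr[of 1 \<beta>] assms by (intro integrable_mult_right) (simp add: has_bochner_integral_iff)
  have "x powr - \<beta> \<le> exp a * (exp (- x) * x powr - \<beta>)" if "x \<le> a" for x
    using mult_right_mono[of 1 "exp a * exp (- x)" "x powr - \<beta>"] that
    by (simp add: exp_diff exp_minus field_simps)
  then show "AE s in lborel. norm (indicator {..a} s * (indicator {0<..} s * s powr (- \<beta>))) \<le> norm (?h s)"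
    by (intro AE_I2) (auto split: split_indicator)
qed simp

text \<open>The reflection moves the variable \<open>t\<close> from the singular kernel to the
  bounded continuous \<open>Z\<close>, after which dominated convergence applies along any
  convergent sequence.\<close>

lemma isCont_convolution_powr:
  fixes Z :: "real \<Rightarrow> real" and \<beta> :: real
  assumes \<beta>: "\<beta> < 1" and Z: "\<And>s. isCont Z s" and C: "\<And>s. \<bar>Z s\<bar> \<le> C" and neg: "\<And>s. s < 0 \<Longrightarrow> Z s = 0"
  shows "isCont (\<lambda>t. \<integral>s. Z s * (indicator {0<..} (t - s) * (t - s) powr (- \<beta>)) \<partial>lborel) t"
proof -
  have [measurable]: "Z \<in> borel_measurable borel"
    using Z by (intro borel_measurable_continuous_onI continuous_at_imp_continuous_on) auto
  have flip: "(\<integral>s. Z s * (indicator {0<..} (t - s) * (t - s) powr (- \<beta>)) \<partial>lborel)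
      = (\<integral>s. Z (t - s) * (indicator {0<..} s * s powr (- \<beta>)) \<partial>lborel)" for t
    using lborel_integral_real_affine[of "-1" "\<lambda>s. Z s * (indicator {0<..} (t - s) * (t - s) powr (- \<beta>))" t] by simp
  show ?thesis unfolding flip continuous_at_sequentially comp_def
  proof (intro allI impI)
    fix x assume x: "x \<longlonglongrightarrow> t"
    then obtain a where a: "\<And>n. \<bar>x n\<bar> \<le> a"
      using convergent_imp_Bseq[of x] by (auto simp: Bseq_def convergent_def)
    show "(\<lambda>n. \<integral>s. Z (x n - s) * (indicator {0<..} s * s powr (- \<beta>)) \<partial>lborel)
        \<longlonglongrightarrow> (\<integral>s. Z (t - s) * (indicator {0<..} s * s powr (- \<beta>)) \<partial>lborel)"
    proof (rule integral_dominated_convergence)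
      let ?w = "\<lambda>s. C * (indicator {..a} s * (indicator {0<..} s * s powr (- \<beta>)))"
      show "integrable lborel ?w" by (intro integrable_mult_right integrable_powr_atMost \<beta>)
      show "AE s in lborel. (\<lambda>n. Z (x n - s) * (indicator {0<..} s * s powr (- \<beta>)))
          \<longlonglongrightarrow> Z (t - s) * (indicator {0<..} s * s powr (- \<beta>))"
        using x by (intro AE_I2 tendsto_mult tendsto_const isCont_tendsto_compose[OF Z] tendsto_diff)
      show "AE s in lborel. norm (Z (x n - s) * (indicator {0<..} s * s powr (- \<beta>))) \<le> ?w s" for n
      proof (intro AE_I2)
        fix s
        \<comment> \<open>Beyond the bound \<open>a\<close> of the sequence the argument is
          negative; this cuts the kernel off to the integrable piece
          \<open>s \<le> a\<close>.\<close>
        have "\<not> s \<le> a \<Longrightarrow> Z (x n - s) = 0" using a[of n] by (intro neg) linarith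
        then show "norm (Z (x n - s) * (indicator {0<..} s * s powr (- \<beta>))) \<le> ?w s"
          using C[of "x n - s"] by (auto simp: abs_mult intro!: mult_right_mono split: split_indicator)
      qed
    qed simp_all
  qed
qed

lemma eventually_zero_left:
  assumes "\<And>t. t < 0 \<Longrightarrow> Z t = (0::real)" "t < (0::real)"
  shows "\<forall>\<^sub>F s in nhds t. Z s = 0"
  using eventually_nhds_in_open[of "{..<0}" t] assms by (auto elim: eventually_mono)

lemma continuous_at_right_shifted:
  fixes Z :: "real \<Rightarrow> real"
  assumes negZ: "\<And>t. t < 0 \<Longrightarrow> Z t = 0" and rcZ: "\<And>t. 0 \<le> t \<Longrightarrow> continuous (at_right t) Z"
  shows "continuous (at_right t) (\<lambda>s. Z (s - a))"
proof -
  have "continuous (at_right (t - a)) Z"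
  proof (cases "t - a < 0")
    case True
    then have "isCont Z (t - a)"
      using eventually_zero_left[of Z "t - a", OF negZ] isCont_cong[of Z "\<lambda>_. 0" "t - a"] by simp
    then show ?thesis by (rule continuous_at_imp_continuous_within)
  qed (use rcZ in simp)
  then show ?thesis
    unfolding continuous_within by (rule filterlim_compose[OF _ filterlim_shift_at_right])
qed

section \<open>From the transformed to the time domain\<close>

text \<open>The analytic core, free of probability. In the application \<open>Z\<close> is the
  pairing minus its starting value times Heaviside, \<open>k\<close> the pairing with the transposed
  generator, and \<open>symbol\<close> the equation between their transforms. Two-sided continuity
  is asked for \<open>b > 0\<close> only, since the clock jumps for \<open>b = 0\<close>.\<close>

locale laplace_time_equation =
  fixes Z k lZ lk :: "real \<Rightarrow> real" and b \<beta> \<gamma> lam C :: real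
  assumes b: "0 \<le> b" and \<beta>: "0 < \<beta>" "\<beta> \<le> 1" and \<gamma>: "0 < \<gamma>" "\<gamma> \<le> 1" and lam: "0 < lam"
    and Z: "\<And>\<eta>. 0 < \<eta> \<Longrightarrow> laplace_at Z \<eta> (lZ \<eta>)"
    and k: "\<And>\<eta>. 0 < \<eta> \<Longrightarrow> laplace_at k \<eta> (lk \<eta>)"
    and negZ: "\<And>t. t < 0 \<Longrightarrow> Z t = 0" and negk: "\<And>t. t < 0 \<Longrightarrow> k t = 0"
    and C: "\<And>t. \<bar>Z t\<bar> \<le> C"
    and rcZ: "\<And>t. 0 \<le> t \<Longrightarrow> continuous (at_right t) Z"
    and rck: "\<And>t. 0 \<le> t \<Longrightarrow> continuous (at_right t) k"
    and Z0: "0 < b \<Longrightarrow> Z 0 = 0"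
    and contZ: "\<And>t. 0 < b \<Longrightarrow> 0 < t \<Longrightarrow> isCont Z t"
    and contk: "\<And>t. 0 < b \<Longrightarrow> 0 < t \<Longrightarrow> isCont k t"
    and symbol: "\<And>\<eta>. 0 < \<eta> \<Longrightarrow>
      (b powr \<beta> * \<eta> powr \<beta> + lam powr \<gamma> * (1 - exp (- \<eta>)) powr \<gamma>) * lZ \<eta> = lk \<eta>"
begin

text \<open>The equation without its time derivative: the aim is \<open>b powr \<beta>\<close> times
  the fractional derivative of \<open>Z\<close> equal to \<open>- R\<close>.\<close>

definition R :: "real \<Rightarrow> real" where
  "R t = lam powr \<gamma> * frac_shift \<gamma> Z t - k t"

lemma frac_shift_neg: "t < 0 \<Longrightarrow> frac_shift \<gamma> Z t = 0"
  using frac_shift_finite[of Z t 0, OF negZ] by simp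

lemma R_neg: "t < 0 \<Longrightarrow> R t = 0"
  by (simp add: R_def frac_shift_neg negk)

lemma laplace_R:
  assumes "0 < \<eta>" shows "laplace_at R \<eta> (- (b powr \<beta> * \<eta> powr \<beta> * lZ \<eta>))"
proof -
  have "has_bochner_integral lborel (\<lambda>t. lam powr \<gamma> * (exp (- (\<eta> * t)) * frac_shift \<gamma> Z t) - exp (- (\<eta> * t)) * k t)
     (lam powr \<gamma> * ((1 - exp (- \<eta>)) powr \<gamma> * lZ \<eta>) - lk \<eta>)"
    using assms \<gamma> by (intro has_bochner_integral_diff has_bochner_integral_mult_right laplace_frac_shift Z negZ k) auto
  moreover have "lam powr \<gamma> * ((1 - exp (- \<eta>)) powr \<gamma> * lZ \<eta>) - lk \<eta> = - (b powr \<beta> * \<eta> powr \<beta> * lZ \<eta>)"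
    by (simp add: symbol[OF assms, symmetric] algebra_simps)
  ultimately show ?thesis
    by (simp add: R_def[abs_def] right_diff_distrib mult_ac)
qed

lemma continuous_right_R: "0 \<le> t \<Longrightarrow> continuous (at_right t) R"
  unfolding R_def[abs_def]
  by (intro continuous_intros continuous_frac_shift negZ rck continuous_at_right_shifted rcZ)

text \<open>With \<open>0 powr \<beta> = 0\<close> the transform of \<open>R\<close> is zero, and
  \<open>R\<close> is right-continuous, so uniqueness applies to \<open>R\<close> itself and no
  integration in time is called for.\<close>

lemma equation_b_zero:
  assumes "b = 0" shows "lam powr \<gamma> * frac_shift \<gamma> Z t = k t"
  using laplace_zero_imp_zero[of R t] laplace_R R_neg continuous_right_R assms by (simp add: R_def)

text \<open>At 0 the left limit is 0 by extension, and it matches the right limit because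
  \<open>Z 0 = 0\<close>; this is the gain from removing the jump
  \<open>\<phi>(0) H\<close>.\<close>

lemma isCont_Z:
  assumes "0 < b" shows "isCont Z t"
proof (cases "t = 0")
  case True
  have "\<forall>\<^sub>F s in at_left 0. Z s = 0"
    using negZ by (auto simp: eventually_at_left_field intro: exI[of _ "-1"])
  then have "(Z \<longlongrightarrow> Z 0) (at_left 0)"
    using Z0[OF assms] by (simp add: tendsto_eventually)
  then show ?thesis
    using rcZ[of 0] True by (simp add: filterlim_at_split continuous_within)
next
  case False
  then consider "t < 0" | "0 < t" by linarith
  then show ?thesis
  proof cases
    case 1
    then show ?thesis
      using eventually_zero_left[of Z t, OF negZ] isCont_cong[of Z "\<lambda>_. 0" t] by simp
  qed (rule contZ[OF assms])
qed

lemma isCont_R: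
  assumes "0 < b" "0 < t" shows "isCont R t"
  unfolding R_def[abs_def]
  by (intro continuous_intros continuous_frac_shift negZ contk assms isCont_o2[OF _ isCont_Z])

lemma continuous_on_R:
  assumes "0 < b" shows "continuous_on {0..a} R"
  unfolding continuous_on_eq_continuous_within
proof
  fix t assume t: "t \<in> {0..a}"
  show "continuous (at t within {0..a}) R"
  proof (cases "t = 0")
    case True
    have "continuous (at_right 0) R" by (rule continuous_right_R) simp
    then show ?thesis unfolding True continuous_within
      by (rule tendsto_mono[rotated]) (auto intro: order_trans[OF at_le[of _ "{0..}"]] simp: at_within_Ici_at_right)
  qed (use t isCont_R assms in \<open>auto intro: continuous_at_imp_continuous_within\<close>)
qed

text \<open>The primitive of \<open>R\<close> from 0. Written as a convolution with the Heaviside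
  function, its transform is that of \<open>R\<close> divided by \<open>\<eta>\<close>.\<close>

definition Q :: "real \<Rightarrow> real" where
  "Q t = (\<integral>s. R s * heaviside (t - s) \<partial>lborel)"

lemma laplace_Q: "0 < \<eta> \<Longrightarrow> laplace_at Q \<eta> (- (b powr \<beta> * \<eta> powr (\<beta> - 1) * lZ \<eta>))"
  using laplace_convolution[OF laplace_R laplace_heaviside, of \<eta>]
  by (simp add: Q_def[abs_def] powr_diff)

lemma Q_eq:
  assumes "0 < b" "0 \<le> t" shows "Q t = integral {0..t} R"
proof -
  have "Q t = (\<integral>s\<in>{0..t}. R s \<partial>lborel)"
    unfolding Q_def set_lebesgue_integral_def
    using R_neg by (intro Bochner_Integration.integral_cong) (auto simp: heaviside_def not_le split: split_indicator)
  moreover have "set_integrable lborel {0..t} R"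
    by (rule borel_integrable_atLeastAtMost') (rule continuous_on_R[OF assms(1)])
  ultimately show ?thesis using set_borel_integral_eq_integral(2) by metis
qed

lemma Q_deriv_within:
  assumes "0 < b" "0 \<le> t"
  shows "(Q has_real_derivative R t) (at t within {0..t+1})"
proof -
  have "((\<lambda>x. integral {0..x} R) has_real_derivative R t) (at t within {0..t+1})"
    using assms by (intro integral_has_real_derivative continuous_on_R) auto
  then show ?thesis
    by (rule has_field_derivative_transform_within[of _ _ _ _ 1]) (use assms Q_eq in auto)
qed

lemma Q_neg: "t < 0 \<Longrightarrow> Q t = 0"
  unfolding Q_def using R_neg by (intro integral_eq_zero_AE AE_I2) (auto simp: heaviside_def not_le)

lemma Gamma_nonzero: "\<beta> \<noteq> 1 \<Longrightarrow> Gamma (1 - \<beta>) \<noteq> 0"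
  using \<beta> Gamma_real_pos[of "1 - \<beta>"] by linarith

text \<open>The Riemann-Liouville integral of \<open>Z\<close> of order \<open>1 - \<beta>\<close>,
  with order 0 (the identity) split off because \<open>Gamma\<close> has a pole at 0.\<close>

definition J :: "real \<Rightarrow> real" where
  "J t = (if \<beta> = 1 then Z t
     else (\<integral>s. Z s * (indicator {0<..} (t - s) * (t - s) powr (- \<beta>)) \<partial>lborel) / Gamma (1 - \<beta>))"

lemma J_eq_Z: "\<beta> = 1 \<Longrightarrow> J = Z"
  unfolding J_def fun_eq_iff by simp

lemma laplace_J:
  assumes \<eta>: "0 < \<eta>" shows "laplace_at J \<eta> (\<eta> powr (\<beta> - 1) * lZ \<eta>)"
proof (cases "\<beta> = 1")
  case False
  then have b1: "\<beta> < 1" using \<beta> by simp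
  then have G: "Gamma (1 - \<beta>) \<noteq> 0" using Gamma_nonzero False by blast
  have "laplace_at (\<lambda>t. \<integral>s. Z s * (indicator {0<..} (t - s) * (t - s) powr (- \<beta>)) \<partial>lborel) \<eta>
      (lZ \<eta> * (Gamma (1 - \<beta>) * \<eta> powr (\<beta> - 1)))"
    by (rule laplace_convolution[OF Z[OF \<eta>] laplace_powr[OF \<eta> b1]])
  from has_bochner_integral_mult_right[OF this, of "1 / Gamma (1 - \<beta>)"]
  show ?thesis using False G by (simp add: J_def[abs_def] mult_ac)
qed (use Z \<eta> J_eq_Z in simp)

lemma isCont_J:
  assumes "0 < b" shows "isCont J t"
proof (cases "\<beta> = 1")
  case False
  then have b1: "\<beta> < 1" using \<beta> by simp
  then have G: "Gamma (1 - \<beta>) \<noteq> 0" using Gamma_nonzero False by blast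
  show ?thesis using False G
    by (auto simp: J_def[abs_def] intro!: continuous_divide isCont_convolution_powr b1 isCont_Z assms C negZ)
qed (use isCont_Z assms J_eq_Z in simp)

lemma J_neg: "t < 0 \<Longrightarrow> J t = 0"
  unfolding J_def using negZ
  by (auto intro!: integral_eq_zero_AE AE_I2 split: split_indicator)

text \<open>The governing equation integrated once in time. Both sides have the transform
  \<open>b powr \<beta> * \<eta> powr (\<beta> - 1) * lZ \<eta>\<close>, and both are
  right-continuous, so they agree at every point.\<close>

lemma J_eq:
  assumes "0 < b" shows "b powr \<beta> * J t = - Q t"
proof -
  have "b powr \<beta> * J t + Q t = 0"
  proof (rule laplace_zero_imp_zero[of "\<lambda>t. b powr \<beta> * J t + Q t"])
    fix \<eta> :: real assume \<eta>: "0 < \<eta>"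
    show "laplace_at (\<lambda>t. b powr \<beta> * J t + Q t) \<eta> 0"
      using has_bochner_integral_add[OF has_bochner_integral_mult_right[OF laplace_J[OF \<eta>], of "b powr \<beta>"] laplace_Q[OF \<eta>]]
      by (simp add: algebra_simps)
  next
    fix t :: real assume t: "0 \<le> t"
    have "continuous (at t within {t..t+1}) Q"
      using Q_deriv_within[OF assms t] t by (intro continuous_within_subset[OF DERIV_continuous]) auto
    then have "continuous (at_right t) Q" by (simp add: at_within_Icc_at_right continuous_within)
    moreover have "continuous (at_right t) J"
      using isCont_J[OF assms] by (rule continuous_at_imp_continuous_within)
    ultimately show "continuous (at_right t) (\<lambda>t. b powr \<beta> * J t + Q t)"
      by (intro continuous_intros)
  qed (simp add: J_neg Q_neg)
  then show ?thesis by simp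
qed

text \<open>\<open>Q\<close> is differentiable because \<open>R\<close> is continuous, and
  \<open>J\<close> is a multiple of \<open>Q\<close>. Nothing is presupposed about derivatives of
  \<open>Z\<close>; for \<beta> = 1 this is where its differentiability comes from.\<close>

lemma J_deriv:
  assumes "0 < b" "0 < t"
  shows "(J has_real_derivative - R t / b powr \<beta>) (at t)"
proof -
  have "(Q has_real_derivative R t) (at t)"
    using Q_deriv_within[of t] assms at_within_Icc_at[of 0 t "t+1"] by simp
  then have "((\<lambda>t. - Q t / b powr \<beta>) has_real_derivative - R t / b powr \<beta>) (at t)"
    by (intro DERIV_cdivide DERIV_minus)
  moreover have "J = (\<lambda>t. - Q t / b powr \<beta>)"
    using J_eq assms by (auto simp: fun_eq_iff field_simps)
  ultimately show ?thesis by simp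
qed

text \<open>By linearity the constant contributes an explicit power of \<open>t\<close>, and what
  remains is \<open>J\<close>. The second fact supplies the integrability demanded by
  \<open>DC_differentiable\<close>.\<close>

lemma frac_integral_eq:
  assumes b: "0 < b" and "\<beta> < 1" and t: "0 < t"
  shows "frac_integral \<beta> (\<lambda>s. Z s + c * heaviside s) t
       = J t + c / Gamma (1 - \<beta>) * (t powr (1 - \<beta>) / (1 - \<beta>))"
    and "set_integrable lborel {0<..<t} (\<lambda>s. (Z s + c * heaviside s) / (t - s) powr \<beta>)"
proof -
  note \<open>\<beta> < 1\<close>
  have [measurable]: "Z \<in> borel_measurable borel"
    using isCont_Z[OF b] by (intro borel_measurable_continuous_onI continuous_at_imp_continuous_on) auto
  note P = has_bochner_integral_powr[OF \<open>\<beta> < 1\<close> t]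
  have iZ: "integrable lborel (\<lambda>s. Z s * (indicator {0<..<t} s * (t - s) powr (- \<beta>)))"
  proof (rule Bochner_Integration.integrable_bound)
    show "integrable lborel (\<lambda>s. C * (indicator {0<..<t} s * (t - s) powr (- \<beta>)))"
      using P by (intro integrable_mult_right) (simp add: has_bochner_integral_iff)
    show "AE s in lborel. norm (Z s * (indicator {0<..<t} s * (t - s) powr (- \<beta>)))
        \<le> norm (C * (indicator {0<..<t} s * (t - s) powr (- \<beta>)))"
      by (intro AE_I2) (use C in \<open>auto simp: abs_mult intro!: mult_right_mono intro: order_trans[OF _ abs_ge_self]\<close>)
  qed simp
  have ic: "integrable lborel (\<lambda>s. c * (indicator {0<..<t} s * (t - s) powr (- \<beta>)))"
    using P by (intro integrable_mult_right) (simp add: has_bochner_integral_iff)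
  have e: "indicator {0<..<t} s *\<^sub>R ((Z s + c * heaviside s) / (t - s) powr \<beta>)
      = Z s * (indicator {0<..<t} s * (t - s) powr (- \<beta>)) + c * (indicator {0<..<t} s * (t - s) powr (- \<beta>))" for s
    by (auto simp: heaviside_def powr_minus field_simps split: split_indicator)
  show "set_integrable lborel {0<..<t} (\<lambda>s. (Z s + c * heaviside s) / (t - s) powr \<beta>)"
    unfolding set_integrable_def e using iZ ic by (rule Bochner_Integration.integrable_add)
  have "(\<integral>s. Z s * (indicator {0<..<t} s * (t - s) powr (- \<beta>)) \<partial>lborel)
      = (\<integral>s. Z s * (indicator {0<..} (t - s) * (t - s) powr (- \<beta>)) \<partial>lborel)"
  proof (intro Bochner_Integration.integral_cong refl)
    fix s :: real
    show "Z s * (indicator {0<..<t} s * (t - s) powr (- \<beta>)) = Z s * (indicator {0<..} (t - s) * (t - s) powr (- \<beta>))"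
      \<comment> \<open>The whole-line integral behind \<open>J\<close> reduces to
        \<open>0 < s < t\<close>: the kernel vanishes for \<open>s \<ge> t\<close>, and
        \<open>Z\<close> for \<open>s \<le> 0\<close>, the point 0 included.\<close>
      using negZ[of s] Z0[OF b] by (cases "0 < s"; cases "s = 0") (auto simp: indicator_def)
  qed
  moreover have "(\<integral>s. c * (indicator {0<..<t} s * (t - s) powr (- \<beta>)) \<partial>lborel) = c * (t powr (1 - \<beta>) / (1 - \<beta>))"
    using P by (simp add: has_bochner_integral_iff)
  moreover have "\<beta> \<noteq> 1" using \<open>\<beta> < 1\<close> by simp
  ultimately show "frac_integral \<beta> (\<lambda>s. Z s + c * heaviside s) t
       = J t + c / Gamma (1 - \<beta>) * (t powr (1 - \<beta>) / (1 - \<beta>))"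
    unfolding frac_integral_def set_lebesgue_integral_def e Bochner_Integration.integral_add[OF iZ ic] J_def
    by (simp add: add_divide_distrib)
qed

text \<open>The derivative of the constant's fractional integral is
  \<open>c * t powr (- \<beta>) / Gamma (1 - \<beta>)\<close>. As the right limit at 0 of
  \<open>Z + c H\<close> is \<open>c\<close>, this is exactly what the Caputo correction subtracts,
  and only the derivative of \<open>J\<close> remains.\<close>

lemma DC_deriv_eq:
  assumes b: "0 < b" and t: "0 < t"
  shows "DC_differentiable \<beta> (\<lambda>s. Z s + c * heaviside s) t"
    and "b powr \<beta> * DC_deriv \<beta> (\<lambda>s. Z s + c * heaviside s) t = - R t"
proof -
  let ?v = "\<lambda>s. Z s + c * heaviside s"
  have nb: "\<forall>\<^sub>F s in nhds t. 0 < s" using eventually_nhds_in_open[of "{0<..}" t] t by simp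
  show "DC_differentiable \<beta> ?v t"
    and "b powr \<beta> * DC_deriv \<beta> ?v t = - R t"
  proof (atomize(full), cases "\<beta> = 1")
    case True
    have "((\<lambda>s. J s + c) has_real_derivative - R t / b powr \<beta> + 0) (at t)"
      by (intro DERIV_add J_deriv assms DERIV_const)
    moreover have "\<forall>\<^sub>F s in nhds t. J s + c = ?v s"
      using nb by eventually_elim (simp add: J_eq_Z[OF True] heaviside_def)
    ultimately have D: "(?v has_real_derivative - R t / b powr \<beta>) (at t)"
      using DERIV_cong_ev[of t t "\<lambda>s. J s + c" ?v] by simp
    then show "DC_differentiable \<beta> ?v t \<and> b powr \<beta> * DC_deriv \<beta> ?v t = - R t"
      using b True DERIV_imp_deriv[OF D]
      by (auto simp: DC_differentiable_def DC_deriv_def field_differentiable_def)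
  next
    case False
    then have b1: "\<beta> < 1" using \<beta> by simp
    have "((\<lambda>s. s powr (1 - \<beta>) / (1 - \<beta>)) has_real_derivative t powr (- \<beta>)) (at t)"
      using DERIV_cdivide[OF has_real_derivative_powr[OF t, of "1 - \<beta>"], of "1 - \<beta>"] b1 by simp
    then have "((\<lambda>s. J s + c / Gamma (1 - \<beta>) * (s powr (1 - \<beta>) / (1 - \<beta>)))
        has_real_derivative - R t / b powr \<beta> + c / Gamma (1 - \<beta>) * t powr (- \<beta>)) (at t)"
      by (intro DERIV_add J_deriv assms DERIV_cmult)
    moreover have "\<forall>\<^sub>F s in nhds t. J s + c / Gamma (1 - \<beta>) * (s powr (1 - \<beta>) / (1 - \<beta>)) = frac_integral \<beta> ?v s"
      using nb by eventually_elim (simp add: frac_integral_eq(1)[OF b b1])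
    ultimately have D: "(frac_integral \<beta> ?v has_real_derivative - R t / b powr \<beta> + c / Gamma (1 - \<beta>) * t powr (- \<beta>)) (at t)"
      by (rule DERIV_cong_ev[OF refl _ refl, THEN iffD1, rotated])
    have "((\<lambda>s. Z s + c) \<longlongrightarrow> Z 0 + c) (at_right 0)"
      using rcZ[of 0] by (intro tendsto_intros) (simp add: continuous_within)
    then have L: "(?v \<longlongrightarrow> c) (at_right 0)"
    proof (rule Lim_transform_eventually[of _ _ _ ?v, THEN tendsto_eq_rhs])
      show "\<forall>\<^sub>F s in at_right 0. Z s + c = ?v s"
        using eventually_at_right_less[of "0::real"] by eventually_elim (simp add: heaviside_def)
    qed (simp add: Z0[OF b])
    show "DC_differentiable \<beta> ?v t \<and> b powr \<beta> * DC_deriv \<beta> ?v t = - R t"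
      using b False L DERIV_imp_deriv[OF D] tendsto_Lim[OF _ L] frac_integral_eq(2)[OF b b1] D
      by (auto simp: DC_differentiable_def DC_deriv_def field_differentiable_def trivial_limit_at_right_real)
  qed
qed

text \<open>Inserting the definition of \<open>R\<close> gives the equation for \<open>Z\<close>.
  Adding back \<open>c H\<close> leaves the time derivative as computed and adds to the shift term
  \<open>lam powr \<gamma>\<close> times the fractional shift of \<open>c H\<close>, which is the
  boundary datum.\<close>

theorem time_equation:
  assumes v: "v = (\<lambda>s. Z s + c * heaviside s)" and t: "0 < t"
  shows "0 < b \<longrightarrow> DC_differentiable \<beta> v t"
    and "b powr \<beta> * DC_deriv \<beta> v t + lam powr \<gamma> * frac_shift \<gamma> v t = k t + boundary_datum \<gamma> lam t * c"
proof -
  show "0 < b \<longrightarrow> DC_differentiable \<beta> v t" using DC_deriv_eq(1) t v by simp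
  have "lam powr \<gamma> * frac_shift \<gamma> v t = lam powr \<gamma> * frac_shift \<gamma> Z t + boundary_datum \<gamma> lam t * c"
    unfolding v using frac_shift_add_scaled[of Z heaviside \<gamma> c t] negZ boundary_datum_eq[OF \<gamma> lam]
    by (simp add: heaviside_def algebra_simps)
  \<comment> \<open>For \<open>b = 0\<close> the first summand is 0 through
    \<open>0 powr \<beta>\<close>, whatever value \<open>DC_deriv\<close> takes.\<close>
  moreover have "b powr \<beta> * DC_deriv \<beta> v t + lam powr \<gamma> * frac_shift \<gamma> Z t = k t"
    using DC_deriv_eq(2)[OF _ t] equation_b_zero b v by (cases "b = 0") (auto simp: R_def)
  ultimately show "b powr \<beta> * DC_deriv \<beta> v t + lam powr \<gamma> * frac_shift \<gamma> v t = k t + boundary_datum \<gamma> lam t * c"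
    by simp
qed

end

section \<open>Fourier inversion for test functions\<close>

lemma test_function_deriv:
  assumes "test_function \<phi>" shows "test_function (deriv \<phi>)"
proof -
  from assms obtain R where d: "\<And>k x. (deriv ^^ k) \<phi> field_differentiable (at x)"
    and R: "\<And>x. \<bar>x\<bar> > R \<Longrightarrow> \<phi> x = 0" by (auto simp: test_function_def)
  have "deriv \<phi> x = 0" if "\<bar>x\<bar> > R" for x
  proof -
    have "open {y::real. R < \<bar>y\<bar>}" by (intro open_Collect_less continuous_intros)
    then have "\<forall>\<^sub>F y in nhds x. \<phi> y = 0"
      using eventually_nhds_in_open[of "{y. R < \<bar>y\<bar>}" x] that R by (auto elim: eventually_mono)
    then show ?thesis using deriv_cong_ev[of \<phi> "\<lambda>_. 0" x x] by simp
  qed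
  moreover have "(deriv ^^ k) (deriv \<phi>) field_differentiable (at x)" for k x
    using d[of "Suc k" x] by (simp add: funpow_Suc_right del: funpow.simps)
  ultimately show ?thesis unfolding test_function_def by blast
qed

section \<open>Elementary properties of a test function and its Fourier transform\<close>

context
  fixes \<phi> :: "real \<Rightarrow> real"
  assumes \<phi>: "test_function \<phi>"
begin

lemma test_function_DERIV: "(\<phi> has_real_derivative deriv \<phi> x) (at x)"
  using \<phi> field_differentiable_derivI[of \<phi> x] by (metis funpow_0 test_function_def)

lemma test_function_isCont: "isCont \<phi> x"
  using test_function_DERIV by (rule DERIV_isCont)

lemma test_function_continuous_on: "continuous_on S \<phi>"
  using test_function_isCont by (intro continuous_at_imp_continuous_on) auto

lemma test_function_measurable: "\<phi> \<in> borel_measurable borel"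
  using test_function_continuous_on by (rule borel_measurable_continuous_onI)

lemma test_function_support:
  obtains R where "0 < R" "\<And>x. R \<le> \<bar>x\<bar> \<Longrightarrow> \<phi> x = 0"
proof -
  obtain R where "\<And>x. \<bar>x\<bar> > R \<Longrightarrow> \<phi> x = 0" using \<phi> by (auto simp: test_function_def)
  then show thesis using that[of "\<bar>R\<bar> + 1"] by force
qed

lemma test_function_integrable: "integrable lborel \<phi>"
proof -
  obtain R where R: "0 < R" "\<And>x. R \<le> \<bar>x\<bar> \<Longrightarrow> \<phi> x = 0" using test_function_support by blast
  have "integrable lborel (\<lambda>x. indicator {-R..R} x *\<^sub>R \<phi> x)"
    using borel_integrable_atLeastAtMost'[OF test_function_continuous_on] by (simp add: set_integrable_def)
  moreover have "indicator {-R..R} x *\<^sub>R \<phi> x = \<phi> x" for x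
    using R(2)[of x] by (auto split: split_indicator)
  ultimately show ?thesis by (simp only:)
qed

lemma test_function_bounded: obtains C where "\<And>x. \<bar>\<phi> x\<bar> \<le> C"
proof -
  obtain R where R: "0 < R" "\<And>x. R \<le> \<bar>x\<bar> \<Longrightarrow> \<phi> x = 0" using test_function_support by blast
  have "bounded (\<phi> ` {-R..R})"
    using compact_continuous_image[OF test_function_continuous_on] compact_imp_bounded by blast
  then obtain C where C: "\<And>x. x \<in> {-R..R} \<Longrightarrow> \<bar>\<phi> x\<bar> \<le> C"
    unfolding bounded_iff by (metis image_eqI real_norm_def)
  have "\<bar>\<phi> x\<bar> \<le> C" for x
    using C[of x] C[of 0] R(1) R(2)[of x] by (cases "x \<in> {-R..R}") auto
  then show thesis by (rule that)
qed

lemma fourier_integrable: "integrable lborel (\<lambda>x. iexp (\<xi> * x) * complex_of_real (\<phi> x))"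
  using test_function_integrable
  by (rule Bochner_Integration.integrable_bound)
    (use borel_measurable_integrable[OF test_function_integrable] in \<open>auto simp: norm_mult\<close>)

lemma fourier_measurable:
  "fourier (\<lambda>x. complex_of_real (\<phi> x)) \<in> borel_measurable borel"
proof -
  note [measurable] = test_function_measurable
  show ?thesis unfolding fourier_def by measurable
qed

lemma norm_fourier_le: "norm (fourier (\<lambda>x. complex_of_real (\<phi> x)) \<xi>) \<le> (\<integral>x. \<bar>\<phi> x\<bar> \<partial>lborel)"
  unfolding fourier_def
  using integral_norm_bound[of lborel "\<lambda>x. iexp (\<xi> * x) * complex_of_real (\<phi> x)"] by (simp add: norm_mult)

lemma cnj_fourier: "cnj (fourier (\<lambda>x. complex_of_real (\<phi> x)) \<xi>) = fourier (\<lambda>x. complex_of_real (\<phi> x)) (- \<xi>)"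
  unfolding fourier_def by (subst Bochner_Integration.integral_cnj[symmetric]) (simp add: exp_cnj)

end

text \<open>The derivative of \<open>iexp (\<xi> * x) * \<phi> x\<close> integrates to zero over an
  interval containing both supports. The sign is negative because the transform is taken with
  \<open>exp (\<i> \<xi> x)\<close>.\<close>

lemma fourier_deriv:
  assumes \<phi>: "test_function \<phi>"
  shows "fourier (\<lambda>x. complex_of_real (deriv \<phi> x)) \<xi> = - (\<i> * \<xi>) * fourier (\<lambda>x. complex_of_real (\<phi> x)) \<xi>"
proof -
  note \<phi>' = test_function_deriv[OF \<phi>]
  obtain R where R: "0 < R" "\<And>x. R \<le> \<bar>x\<bar> \<Longrightarrow> \<phi> x = 0" using test_function_support[OF \<phi>] by blast
  obtain R' where R': "0 < R'" "\<And>x. R' \<le> \<bar>x\<bar> \<Longrightarrow> deriv \<phi> x = 0" using test_function_support[OF \<phi>'] by blast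
  define r where "r = max R R'"
  let ?F = "\<lambda>x. iexp (\<xi> * x) * complex_of_real (\<phi> x)"
  let ?f = "\<lambda>x. \<i> * \<xi> * (iexp (\<xi> * x) * complex_of_real (\<phi> x)) + iexp (\<xi> * x) * complex_of_real (deriv \<phi> x)"
  have D: "(?F has_vector_derivative ?f x) (at x within S)" for x S
  proof -
    have "((\<lambda>x. complex_of_real (\<phi> x)) has_vector_derivative complex_of_real (deriv \<phi> x)) (at x within S)"
      using has_vector_derivative_of_real has_vector_derivative_at_within test_function_DERIV[OF \<phi>]
      by (metis has_real_derivative_iff_has_vector_derivative)
    moreover have "((\<lambda>x. iexp (\<xi> * x)) has_vector_derivative \<i> * \<xi> * iexp (\<xi> * x)) (at x within S)"
      unfolding of_real_mult
      by (rule has_vector_derivative_real_field[of "\<lambda>z. exp (\<i> * (\<xi> * z))"])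
         (auto intro!: derivative_eq_intros)
    ultimately have "(?F has_vector_derivative
        iexp (\<xi> * x) * complex_of_real (deriv \<phi> x) + \<i> * \<xi> * iexp (\<xi> * x) * complex_of_real (\<phi> x)) (at x within S)"
      by (intro has_vector_derivative_mult)
    then show ?thesis by (simp only: add.commute mult.assoc)
  qed
  have cont: "continuous_on S ?f" for S
    by (intro continuous_intros test_function_continuous_on \<phi> \<phi>')
  have "has_bochner_integral lborel (\<lambda>x. indicator {-r..r} x *\<^sub>R ?f x) (?F r - ?F (- r))"
    using R(1) by (intro has_bochner_integral_FTC_Icc D cont) (auto simp: r_def)
  moreover have "indicator {-r..r} x *\<^sub>R ?f x = ?f x" for x
    using R(2)[of x] R'(2)[of x] by (auto simp: r_def split: split_indicator)
  moreover have "?F r = 0" "?F (- r) = 0" using R by (auto simp: r_def)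
  ultimately have "(\<integral>x. ?f x \<partial>lborel) = 0" by (simp add: has_bochner_integral_iff)
  then have "\<i> * \<xi> * fourier (\<lambda>x. complex_of_real (\<phi> x)) \<xi> + fourier (\<lambda>x. complex_of_real (deriv \<phi> x)) \<xi> = 0"
    unfolding fourier_def
    using Bochner_Integration.integral_add[OF integrable_mult_right[OF fourier_integrable[OF \<phi>]] fourier_integrable[OF \<phi>']]
    by (simp only: integral_mult_right_zero)
  then show ?thesis by (simp add: add_eq_0_iff)
qed

lemma integrable_poly_fourier:
  assumes \<phi>: "test_function \<phi>"
  shows "integrable lborel (\<lambda>\<xi>. (1 + \<xi>\<^sup>2) * norm (fourier (\<lambda>x. complex_of_real (\<phi> x)) \<xi>))"
proof -
  let ?F = "\<lambda>\<phi> \<xi>. fourier (\<lambda>x. complex_of_real (\<phi> x)) \<xi>"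
  note d = test_function_deriv
  let ?d = "deriv (deriv (deriv (deriv \<phi>)))"
  have 4: "?F ?d \<xi> = complex_of_real (\<xi> ^ 4) * ?F \<phi> \<xi>" for \<xi>
  proof -
    have "- (\<i> * z) * (- (\<i> * z) * w) = - (z * z) * w" for z w :: complex
      by (metis (no_types) complex_i_mult_minus minus_mult_minus mult.assoc mult.left_commute mult_minus_left)
    then show ?thesis
      by (simp only: fourier_deriv \<phi> d) (simp add: power4_eq_xxxx mult.assoc)
  qed
  define C where "C = (\<integral>x. \<bar>?d x\<bar> \<partial>lborel) + (\<integral>x. \<bar>\<phi> x\<bar> \<partial>lborel)"
  have C: "(1 + \<xi> ^ 4) * norm (?F \<phi> \<xi>) \<le> C" for \<xi>
    using norm_fourier_le[of ?d \<xi>] norm_fourier_le[of \<phi> \<xi>] \<phi> d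
    by (simp add: 4 norm_mult norm_power C_def algebra_simps)
  have bound: "(1 + \<xi>\<^sup>2) * norm (?F \<phi> \<xi>) \<le> 2 * C * inverse (1 + \<xi>\<^sup>2)" for \<xi>
  proof -
    \<comment> \<open>Source of the factor 2: the square expands to
      \<open>(1 + \<xi>^2)^2 \<le> 2 (1 + \<xi>^4)\<close>.\<close>
    have "0 \<le> (1 - \<xi>\<^sup>2)\<^sup>2" by simp
    then have "(1 + \<xi>\<^sup>2) * (1 + \<xi>\<^sup>2) \<le> 2 * (1 + \<xi> ^ 4)"
      by (simp add: power2_eq_square power4_eq_xxxx algebra_simps)
    from mult_right_mono[OF this norm_ge_zero[of "?F \<phi> \<xi>"]]
    have "(1 + \<xi>\<^sup>2) * (1 + \<xi>\<^sup>2) * norm (?F \<phi> \<xi>) \<le> 2 * C"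
      using C[of \<xi>] by (simp only: mult.assoc[of 2] norm_ge_zero simp_thms)
    moreover have "0 < 1 + \<xi>\<^sup>2" by (simp add: add_pos_nonneg)
    ultimately show ?thesis by (simp add: field_simps)
  qed
  note [measurable] = fourier_measurable[OF \<phi>]
  have "integrable lborel (\<lambda>\<xi>::real. 2 * C * inverse (1 + \<xi>\<^sup>2))"
    using integrable_inverse_1_plus_square by (simp add: set_integrable_def)
  then show ?thesis
    by (rule Bochner_Integration.integrable_bound) (auto intro!: AE_I2 order_trans[OF _ abs_ge_self] bound simp del: abs_mult)
qed

lemma integrable_multiplier_fourier:
  assumes \<phi>: "test_function \<phi>" and [measurable]: "p \<in> borel_measurable borel"
    and K: "\<And>\<xi>. norm (p \<xi> :: complex) \<le> K * (1 + \<xi>\<^sup>2)"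
  shows "integrable lborel (\<lambda>\<xi>. p \<xi> * fourier (\<lambda>x. complex_of_real (\<phi> x)) \<xi>)"
proof (rule Bochner_Integration.integrable_bound)
  note [measurable] = fourier_measurable[OF \<phi>]
  let ?g = "\<lambda>\<xi>. K * ((1 + \<xi>\<^sup>2) * norm (fourier (\<lambda>x. complex_of_real (\<phi> x)) \<xi>))"
  show "integrable lborel ?g"
    by (intro integrable_mult_right integrable_poly_fourier \<phi>)
  show "AE \<xi> in lborel. norm (p \<xi> * fourier (\<lambda>x. complex_of_real (\<phi> x)) \<xi>) \<le> norm (?g \<xi>)"
  proof (intro AE_I2)
    fix \<xi>
    have "norm (p \<xi> * fourier (\<lambda>x. complex_of_real (\<phi> x)) \<xi>) \<le> ?g \<xi>"
      unfolding norm_mult mult.assoc[symmetric] by (intro mult_right_mono K) simp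
    then show "norm (p \<xi> * fourier (\<lambda>x. complex_of_real (\<phi> x)) \<xi>) \<le> norm (?g \<xi>)" by simp
  qed
  show "(\<lambda>\<xi>. p \<xi> * fourier (\<lambda>x. complex_of_real (\<phi> x)) \<xi>) \<in> borel_measurable lborel" by measurable
qed

text \<open>Gaussian regularisation: against \<open>exp (- (\<epsilon> \<xi>)\<^sup>2 / 2)\<close> the inversion integral is the
  convolution of \<open>\<phi>\<close> with a centred normal law of standard deviation \<open>\<epsilon>\<close>.\<close>

lemma gaussian_fourier:
  assumes \<epsilon>: "0 < \<epsilon>"
  shows "integrable lborel (\<lambda>\<xi>::real. exp (- (\<epsilon> * \<xi>)\<^sup>2 / 2))"
    and "(\<integral>\<xi>. iexp (z * \<xi>) * exp (- (\<epsilon> * \<xi>)\<^sup>2 / 2) \<partial>lborel)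
      = complex_of_real (2 * pi / \<epsilon> * std_normal_density (z / \<epsilon>))"
proof -
  have snd: "sqrt (2 * pi) * std_normal_density x = exp (- x\<^sup>2 / 2)" for x
    by (simp add: std_normal_density_def)
  have "integrable lborel (\<lambda>x. sqrt (2 * pi) * std_normal_density x)"
    by (intro integrable_mult_right integrable_normal_density) simp
  then have "integrable lborel (\<lambda>x::real. exp (- x\<^sup>2 / 2))" by (simp only: snd)
  from lborel_integrable_real_affine[OF this, of \<epsilon> 0]
  show "integrable lborel (\<lambda>\<xi>::real. exp (- (\<epsilon> * \<xi>)\<^sup>2 / 2))" using \<epsilon> by simp
  have "(\<integral>x. iexp (z / \<epsilon> * x) * complex_of_real (std_normal_density x) \<partial>lborel) = char std_normal_distribution (z / \<epsilon>)"
    unfolding char_def by (subst integral_density) (auto simp: scaleR_conv_of_real mult.commute)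
  also have "\<dots> = complex_of_real (sqrt (2 * pi) * std_normal_density (z / \<epsilon>))"
    by (simp add: char_std_normal_distribution snd)
  finally have "complex_of_real (sqrt (2 * pi) * std_normal_density (z / \<epsilon>))
      = \<bar>\<epsilon>\<bar> *\<^sub>R (\<integral>x. iexp (z / \<epsilon> * (0 + \<epsilon> * x)) * complex_of_real (std_normal_density (0 + \<epsilon> * x)) \<partial>lborel)"
    using lborel_integral_real_affine[of \<epsilon> "\<lambda>x. iexp (z / \<epsilon> * x) * complex_of_real (std_normal_density x)" 0] \<epsilon> by simp
  also have "\<dots> = complex_of_real \<epsilon> * (\<integral>x. iexp (z * x) * complex_of_real (std_normal_density (\<epsilon> * x)) \<partial>lborel)"
    using \<epsilon> by (simp add: scaleR_conv_of_real)
  finally have "(\<integral>x. iexp (z * x) * complex_of_real (std_normal_density (\<epsilon> * x)) \<partial>lborel)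
     = complex_of_real (sqrt (2 * pi) / \<epsilon> * std_normal_density (z / \<epsilon>))"
    using \<epsilon> by (simp add: field_simps)
  then have "complex_of_real (sqrt (2 * pi)) * (\<integral>x. iexp (z * x) * complex_of_real (std_normal_density (\<epsilon> * x)) \<partial>lborel)
     = complex_of_real (sqrt (2 * pi) * sqrt (2 * pi) / \<epsilon> * std_normal_density (z / \<epsilon>))"
    by (simp only: of_real_mult[symmetric] times_divide_eq_left times_divide_eq_right mult.assoc)
  also have "complex_of_real (sqrt (2 * pi)) * (\<integral>x. iexp (z * x) * complex_of_real (std_normal_density (\<epsilon> * x)) \<partial>lborel)
     = (\<integral>x. iexp (z * x) * complex_of_real (sqrt (2 * pi) * std_normal_density (\<epsilon> * x)) \<partial>lborel)"
    by (subst integral_mult_right_zero[symmetric]) (simp add: mult_ac)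
  finally show "(\<integral>\<xi>. iexp (z * \<xi>) * exp (- (\<epsilon> * \<xi>)\<^sup>2 / 2) \<partial>lborel)
      = complex_of_real (2 * pi / \<epsilon> * std_normal_density (z / \<epsilon>))"
    by (simp add: snd del: of_real_mult)
qed

text \<open>Without a damping factor the double integral over \<open>y\<close> and
  \<open>\<xi>\<close> is not absolutely convergent. With it \<open>L n\<close> can be evaluated by
  Fubini as a Gaussian average of \<open>\<phi>\<close> around \<open>x\<close>, while dominated
  convergence sends \<open>L n\<close> to the undamped integral.\<close>

lemma fourier_inversion:
  assumes \<phi>: "test_function \<phi>"
  shows "complex_of_real (\<phi> x) = 1 / complex_of_real (2 * pi) *
     (\<integral>\<xi>. iexp (- (\<xi> * x)) * fourier (\<lambda>y. complex_of_real (\<phi> y)) \<xi> \<partial>lborel)"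
proof -
  let ?F = "fourier (\<lambda>y. complex_of_real (\<phi> y))"
  note [measurable] = fourier_measurable[OF \<phi>] test_function_measurable[OF \<phi>]
  have F: "integrable lborel ?F"
    using integrable_multiplier_fourier[OF \<phi>, of "\<lambda>_. 1" 1] by simp
  obtain C where C: "\<And>y. \<bar>\<phi> y\<bar> \<le> C" using test_function_bounded[OF \<phi>] by blast
  define \<epsilon> where "\<epsilon> n = 1 / real (Suc n)" for n
  have \<epsilon>: "0 < \<epsilon> n" for n by (simp add: \<epsilon>_def)
  have \<epsilon>0: "\<epsilon> \<longlonglongrightarrow> 0" unfolding \<epsilon>_def using LIMSEQ_Suc[OF lim_1_over_n] .
  define L where "L n = (\<integral>\<xi>. iexp (- (\<xi> * x)) * ?F \<xi> * exp (- (\<epsilon> n * \<xi>)\<^sup>2 / 2) \<partial>lborel)" for n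
  have "L \<longlonglongrightarrow> (\<integral>\<xi>. iexp (- (\<xi> * x)) * ?F \<xi> \<partial>lborel)"
    unfolding L_def
  proof (rule integral_dominated_convergence[where w="\<lambda>\<xi>. norm (?F \<xi>)"])
    show "AE \<xi> in lborel. (\<lambda>n. iexp (- (\<xi> * x)) * ?F \<xi> * exp (- (\<epsilon> n * \<xi>)\<^sup>2 / 2)) \<longlonglongrightarrow> iexp (- (\<xi> * x)) * ?F \<xi>"
    proof (intro AE_I2)
      fix \<xi> :: real
      have "(\<lambda>n. complex_of_real (exp (- (\<epsilon> n * \<xi>)\<^sup>2 / 2))) \<longlonglongrightarrow> complex_of_real (exp (- (0 * \<xi>)\<^sup>2 / 2))"
        by (intro tendsto_intros \<epsilon>0) auto
      from tendsto_mult[OF tendsto_const this, of "iexp (- (\<xi> * x)) * ?F \<xi>"]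
      show "(\<lambda>n. iexp (- (\<xi> * x)) * ?F \<xi> * exp (- (\<epsilon> n * \<xi>)\<^sup>2 / 2)) \<longlonglongrightarrow> iexp (- (\<xi> * x)) * ?F \<xi>"
        by simp
    qed
    show "AE \<xi> in lborel. norm (iexp (- (\<xi> * x)) * ?F \<xi> * exp (- (\<epsilon> n * \<xi>)\<^sup>2 / 2)) \<le> norm (?F \<xi>)" for n
      by (intro AE_I2) (simp add: norm_mult mult_left_le)
  qed (use F in simp_all)
  moreover have "L \<longlonglongrightarrow> complex_of_real (2 * pi * \<phi> x)"
  proof -
    have L: "L n = complex_of_real (2 * pi * (\<integral>z. \<phi> (x + \<epsilon> n * z) * std_normal_density z \<partial>lborel))" for n
    proof -
      let ?g = "\<lambda>y \<xi>. complex_of_real (\<phi> y) * (iexp ((y - x) * \<xi>) * exp (- (\<epsilon> n * \<xi>)\<^sup>2 / 2))"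
      note G = gaussian_fourier[OF \<epsilon>[of n]]
      have ng: "norm (?g y \<xi>) = \<bar>\<phi> y\<bar> * exp (- (\<epsilon> n * \<xi>)\<^sup>2 / 2)" for y \<xi>
        by (simp add: norm_mult)
      have gi: "integrable lborel (\<lambda>\<xi>. ?g y \<xi>)" for y
        by (rule Bochner_Integration.integrable_bound[OF integrable_mult_right[OF G(1), of "\<bar>\<phi> y\<bar>"]])
          (simp_all add: norm_mult)
      have int: "integrable (lborel \<Otimes>\<^sub>M lborel) (\<lambda>(y, \<xi>). ?g y \<xi>)"
      proof (rule lborel_pair.Fubini_integrable)
        show "integrable lborel (\<lambda>y. LINT \<xi>|lborel. norm (case (y, \<xi>) of (y, \<xi>) \<Rightarrow> ?g y \<xi>))"
          unfolding prod.case ng using test_function_integrable[OF \<phi>] by (simp add: integrable_abs)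
      qed (use gi in simp_all)
      have "L n = (\<integral>\<xi>. (\<integral>y. ?g y \<xi> \<partial>lborel) \<partial>lborel)"
        unfolding L_def fourier_def
      proof (intro Bochner_Integration.integral_cong refl)
        fix \<xi> :: real
        have "iexp (- (\<xi> * x)) * (\<integral>y. iexp (\<xi> * y) * \<phi> y \<partial>lborel) * exp (- (\<epsilon> n * \<xi>)\<^sup>2 / 2)
            = (\<integral>y. iexp (- (\<xi> * x)) * exp (- (\<epsilon> n * \<xi>)\<^sup>2 / 2) * (iexp (\<xi> * y) * \<phi> y) \<partial>lborel)"
          unfolding integral_mult_right_zero by (simp only: mult_ac)
        also have "\<dots> = (\<integral>y. ?g y \<xi> \<partial>lborel)"
        proof (intro Bochner_Integration.integral_cong refl)
          fix y :: real
          have e: "iexp (- (\<xi> * x)) * iexp (\<xi> * y) = iexp ((y - x) * \<xi>)"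
            by (simp add: algebra_simps flip: exp_add)
          show "iexp (- (\<xi> * x)) * exp (- (\<epsilon> n * \<xi>)\<^sup>2 / 2) * (iexp (\<xi> * y) * \<phi> y) = ?g y \<xi>"
            unfolding e[symmetric] by (simp only: mult_ac)
        qed
        finally show "iexp (- (\<xi> * x)) * (\<integral>y. iexp (\<xi> * y) * \<phi> y \<partial>lborel) * exp (- (\<epsilon> n * \<xi>)\<^sup>2 / 2) = (\<integral>y. ?g y \<xi> \<partial>lborel)" .
      qed
      also have "\<dots> = (\<integral>y. (\<integral>\<xi>. ?g y \<xi> \<partial>lborel) \<partial>lborel)"
        using lborel_pair.Fubini_integral[of ?g] int by simp
      also have "\<dots> = (\<integral>y. complex_of_real (\<phi> y * (2 * pi / \<epsilon> n * std_normal_density ((y - x) / \<epsilon> n))) \<partial>lborel)"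
        by (simp only: integral_mult_right_zero G(2) of_real_mult[symmetric])
      also have "\<dots> = \<bar>\<epsilon> n\<bar> *\<^sub>R (\<integral>z. complex_of_real (\<phi> (x + \<epsilon> n * z) * (2 * pi / \<epsilon> n * std_normal_density ((x + \<epsilon> n * z - x) / \<epsilon> n))) \<partial>lborel)"
        using \<epsilon>[of n] by (intro lborel_integral_real_affine) simp
      also have "\<dots> = (\<integral>z. complex_of_real (2 * pi * (\<phi> (x + \<epsilon> n * z) * std_normal_density z)) \<partial>lborel)"
        unfolding integral_scaleR_right[symmetric] using \<epsilon>[of n]
        by (intro Bochner_Integration.integral_cong refl) (simp add: scaleR_conv_of_real)
      finally show ?thesis by (simp only: integral_complex_of_real integral_mult_right_zero)
    qed
    have "(\<lambda>n. \<integral>z. \<phi> (x + \<epsilon> n * z) * std_normal_density z \<partial>lborel) \<longlonglongrightarrow> (\<integral>z. \<phi> x * std_normal_density z \<partial>lborel)"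
    proof (rule integral_dominated_convergence[where w="\<lambda>z. C * std_normal_density z"])
      show "AE z in lborel. (\<lambda>n. \<phi> (x + \<epsilon> n * z) * std_normal_density z) \<longlonglongrightarrow> \<phi> x * std_normal_density z"
      proof (intro AE_I2 tendsto_mult tendsto_const isCont_tendsto_compose[OF test_function_isCont[OF \<phi>]])
        fix z :: real
        have "(\<lambda>n. x + \<epsilon> n * z) \<longlonglongrightarrow> x + 0 * z" by (intro tendsto_intros \<epsilon>0)
        then show "(\<lambda>n. x + \<epsilon> n * z) \<longlonglongrightarrow> x" by simp
      qed
      show "AE z in lborel. norm (\<phi> (x + \<epsilon> n * z) * std_normal_density z) \<le> C * std_normal_density z" for n
        by (intro AE_I2) (simp add: abs_mult C mult_right_mono)
    qed simp_all
    then have "(\<lambda>n. \<integral>z. \<phi> (x + \<epsilon> n * z) * std_normal_density z \<partial>lborel) \<longlonglongrightarrow> \<phi> x" by simp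
    then show ?thesis unfolding L by (intro tendsto_intros)
  qed
  ultimately have "(\<integral>\<xi>. iexp (- (\<xi> * x)) * ?F \<xi> \<partial>lborel) = complex_of_real (2 * pi * \<phi> x)"
    by (rule LIMSEQ_unique)
  then show ?thesis by simp
qed

text \<open>Conjugation of the integral amounts to the substitution of \<open>- \<xi>\<close> for
  \<open>\<xi>\<close>, because the multiplier and the transform of a real function are both
  Hermitian.\<close>

lemma generator_real:
  assumes \<phi>: "test_function \<phi>" and cnj: "\<And>\<xi>. cnj (\<Psi> \<xi>) = \<Psi> (- \<xi>)"
  shows "generator \<Psi> (\<lambda>y. complex_of_real (\<phi> y)) x \<in> \<real>"
proof -
  let ?F = "fourier (\<lambda>y. complex_of_real (\<phi> y))"
  let ?I = "\<integral>\<xi>. iexp (- (\<xi> * x)) * \<Psi> \<xi> * ?F \<xi> \<partial>lborel"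
  have "cnj ?I = (\<integral>\<xi>. iexp (- (- \<xi> * x)) * \<Psi> (- \<xi>) * ?F (- \<xi>) \<partial>lborel)"
    by (subst Bochner_Integration.integral_cnj[symmetric]) (simp add: cnj cnj_fourier[OF \<phi>] exp_cnj)
  also have "\<dots> = ?I"
    using lborel_integral_real_affine[of "-1" "\<lambda>\<xi>. iexp (- (\<xi> * x)) * \<Psi> \<xi> * ?F \<xi>" 0] by simp
  finally have "?I \<in> \<real>" by (simp add: Reals_cnj_iff)
  then show ?thesis unfolding generator_def
    by (intro Reals_mult Reals_minus Reals_divide) auto
qed

section \<open>Measurability, independence, first passage\<close>

text \<open>The time argument is approximated strictly from the right by multiples of \<open>1 / (n + 1)\<close>.\<close>

lemma measurable_right_continuous_process:
  fixes f :: "real \<Rightarrow> 'a \<Rightarrow> real"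
  assumes f: "\<And>t. 0 < t \<Longrightarrow> f t \<in> borel_measurable M"
    and rc: "\<And>t \<omega>. 0 \<le> t \<Longrightarrow> \<omega> \<in> space M \<Longrightarrow> ((\<lambda>s. f s \<omega>) \<longlongrightarrow> f t \<omega>) (at_right t)"
  shows "(\<lambda>(t, \<omega>). f (max 0 t) \<omega>) \<in> borel_measurable (borel \<Otimes>\<^sub>M M)"
proof (rule borel_measurable_LIMSEQ_real)
  define d where "d n t = (real (nat \<lfloor>real (Suc n) * max 0 t\<rfloor>) + 1) / real (Suc n)" for n and t :: real
  let ?u = "\<lambda>n (t, \<omega>). f (d n t) \<omega>"
  show "?u n \<in> borel_measurable (borel \<Otimes>\<^sub>M M)" for n
  proof -
    have "(\<lambda>x. f ((real (nat \<lfloor>real (Suc n) * max 0 (fst x)\<rfloor>) + 1) / real (Suc n)) (snd x))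
        \<in> borel_measurable (borel \<Otimes>\<^sub>M M)"
    proof (rule measurable_compose_countable[of "\<lambda>k x. f ((real k + 1) / real (Suc n)) (snd x)"])
      show "(\<lambda>x. f ((real k + 1) / real (Suc n)) (snd x)) \<in> borel_measurable (borel \<Otimes>\<^sub>M M)" for k :: nat
        by (rule measurable_compose[OF measurable_snd f]) simp
    qed measurable
    then show ?thesis by (simp add: d_def case_prod_beta)
  qed
  fix x :: "real \<times> 'a" assume x: "x \<in> space (borel \<Otimes>\<^sub>M M)"
  obtain t \<omega> where [simp]: "x = (t, \<omega>)" by (cases x)
  let ?t = "max 0 t"
  have d1: "?t < d n t" and d2: "d n t \<le> ?t + 1 / real (Suc n)" for n
  proof -
    have fl: "of_int \<lfloor>real (Suc n) * ?t\<rfloor> \<le> real (Suc n) * ?t" "real (Suc n) * ?t < of_int \<lfloor>real (Suc n) * ?t\<rfloor> + 1"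
      by linarith+
    have "0 \<le> \<lfloor>real (Suc n) * ?t\<rfloor>" by simp
    then have e: "d n t = (of_int \<lfloor>real (Suc n) * ?t\<rfloor> + 1) / real (Suc n)" by (simp add: d_def)
    have "?t < (of_int \<lfloor>real (Suc n) * ?t\<rfloor> + 1) / real (Suc n)
        \<longleftrightarrow> ?t * real (Suc n) < of_int \<lfloor>real (Suc n) * ?t\<rfloor> + 1"
      by (rule pos_less_divide_eq) simp
    then show "?t < d n t" unfolding e using fl(2) by (simp only: mult.commute)
    have "(of_int \<lfloor>real (Suc n) * ?t\<rfloor> + 1) / real (Suc n) \<le> (real (Suc n) * ?t + 1) / real (Suc n)"
      using fl(1) by (intro divide_right_mono) linarith+
    then show "d n t \<le> ?t + 1 / real (Suc n)" unfolding e add_divide_distrib by (simp only: nonzero_mult_div_cancel_left of_nat_eq_0_iff nat.distinct simp_thms)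
  qed
  have "(\<lambda>n. ?t + 1 / real (Suc n)) \<longlonglongrightarrow> ?t + 0"
    by (intro tendsto_add tendsto_const LIMSEQ_Suc[OF lim_1_over_n])
  then have lim: "(\<lambda>n. ?t + 1 / real (Suc n)) \<longlonglongrightarrow> ?t" by simp
  have "(\<lambda>n. d n t) \<longlonglongrightarrow> ?t"
    by (rule tendsto_sandwich[OF always_eventually always_eventually tendsto_const lim])
      (use d1 d2 in \<open>simp_all only: less_imp_le simp_thms\<close>)
  then have "filterlim (\<lambda>n. d n t) (at_right ?t) sequentially"
    unfolding filterlim_at using d1 by (simp add: less_imp_neq[symmetric])
  then show "(\<lambda>n. ?u n x) \<longlonglongrightarrow> (case x of (t, \<omega>) \<Rightarrow> f (max 0 t) \<omega>)"
    using filterlim_compose[OF rc[of ?t \<omega>]] x by (simp add: space_pair_measure)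
qed

text \<open>Independence concerns only the generated \<sigma>-algebras. Pulling these back makes the
  outcome itself the random variable on each side.\<close>

lemma (in prob_space) indep_var_vimage_algebra:
  assumes "indep_var S X T Y"
  shows "indep_var (vimage_algebra (space M) X S) (\<lambda>\<omega>. \<omega>) (vimage_algebra (space M) Y T) (\<lambda>\<omega>. \<omega>)"
proof -
  have X: "X \<in> measurable M S" and Y: "Y \<in> measurable M T"
    using assms indep_var_rv1 indep_var_rv2 by blast+
  have s: "{(\<lambda>\<omega>. \<omega>) -` E \<inter> space M |E. E \<in> sets (vimage_algebra (space M) Z U)} = {Z -` E \<inter> space M |E. E \<in> sets U}"
    if "Z \<in> measurable M U" for Z and U :: "'z measure"
    using measurable_space[OF that] by (auto simp: sets_vimage_algebra2)
  show ?thesis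
    using assms unfolding indep_var_eq s[OF X] s[OF Y]
    using X Y by (auto intro!: measurable_vimage_algebra2)
qed

text \<open>Decoupling: the law of \<open>(\<omega>, \<omega>)\<close> on
  \<open>M1 \<Otimes>\<^sub>M M2\<close> is a product measure, so the outcome may be split into two
  independent copies. It is used to freeze a random time while the process evaluated at it is
  averaged.\<close>

lemma (in prob_space) integral_indep_subalgebras:
  fixes f :: "'a \<times> 'a \<Rightarrow> real"
  assumes ind: "indep_var M1 (\<lambda>\<omega>. \<omega>) M2 (\<lambda>\<omega>. \<omega>)"
    and f[measurable]: "f \<in> borel_measurable (M1 \<Otimes>\<^sub>M M2)" and bd: "\<And>x. \<bar>f x\<bar> \<le> C"
  shows "(\<integral>\<omega>. f (\<omega>, \<omega>) \<partial>M) = (\<integral>\<omega>2. (\<integral>\<omega>1. f (\<omega>1, \<omega>2) \<partial>M) \<partial>M)"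
proof -
  have m[measurable]: "(\<lambda>\<omega>. \<omega>) \<in> measurable M M1" "(\<lambda>\<omega>. \<omega>) \<in> measurable M M2"
    using indep_var_rv1[OF ind] indep_var_rv2[OF ind] by auto
  define P1 where "P1 = distr M M1 (\<lambda>\<omega>. \<omega>)"
  define P2 where "P2 = distr M M2 (\<lambda>\<omega>. \<omega>)"
  interpret P1: prob_space P1 unfolding P1_def by (rule prob_space_distr) (rule m)
  interpret P2: prob_space P2 unfolding P2_def by (rule prob_space_distr) (rule m)
  interpret P: pair_prob_space P1 P2 ..
  have [measurable_cong]: "sets P1 = sets M1" "sets P2 = sets M2" by (simp_all add: P1_def P2_def)
  have "(\<integral>\<omega>. f (\<omega>, \<omega>) \<partial>M) = (\<integral>x. f x \<partial>distr M (M1 \<Otimes>\<^sub>M M2) (\<lambda>\<omega>. (\<omega>, \<omega>)))"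
    by (subst integral_distr) measurable
  also have "\<dots> = (\<integral>x. f x \<partial>(P1 \<Otimes>\<^sub>M P2))"
    using ind unfolding indep_var_distribution_eq P1_def P2_def by simp
  also have "\<dots> = (\<integral>y. (\<integral>x. f (x, y) \<partial>P1) \<partial>P2)"
  proof -
    have "integrable (P1 \<Otimes>\<^sub>M P2) (case_prod (\<lambda>x y. f (x, y)))"
      using bd by (intro P.P.integrable_const_bound[of _ C]) auto
    from P.integral_snd[OF this] show ?thesis by simp
  qed
  also have "\<dots> = (\<integral>y. (\<integral>x. f (x, y) \<partial>P1) \<partial>M)"
    unfolding P2_def by (subst integral_distr) (auto intro!: P1.borel_measurable_lebesgue_integral)
  also have "\<dots> = (\<integral>y. (\<integral>x. f (x, y) \<partial>M) \<partial>M)"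
  proof (rule Bochner_Integration.integral_cong[OF refl])
    fix y assume "y \<in> space M"
    then have "y \<in> space M2" using measurable_space[OF m(2)] by auto
    then show "(\<integral>x. f (x, y) \<partial>P1) = (\<integral>x. f (x, y) \<partial>M)"
      unfolding P1_def by (subst integral_distr) auto
  qed
  finally show ?thesis .
qed

section \<open>First passage of a single deterministic path\<close>

definition first_passage :: "(real \<Rightarrow> real) \<Rightarrow> real \<Rightarrow> real" where
  "first_passage y t = (let S = {s. 0 \<le> s \<and> y s > t} in if S = {} then 0 else Inf S)"

lemma bdd_below_passage: "bdd_below {s. 0 \<le> s \<and> y s > (t::real)}" for y :: "real \<Rightarrow> real"
  by (rule bdd_belowI[of _ 0]) simp

lemma first_passage_nonneg: "0 \<le> first_passage y t"
  unfolding first_passage_def Let_def by (auto intro!: cInf_greatest)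

lemma first_passage_le: "0 \<le> s \<Longrightarrow> t < y s \<Longrightarrow> first_passage y t \<le> s"
  unfolding first_passage_def Let_def by (auto intro!: cInf_lower bdd_below_passage)

lemma first_passage_greatest:
  assumes "0 \<le> s" "t < y s" "\<And>s. 0 \<le> s \<Longrightarrow> t < y s \<Longrightarrow> r \<le> s"
  shows "r \<le> first_passage y t"
  unfolding first_passage_def Let_def using assms by (auto intro!: cInf_greatest)

lemma first_passage_witness:
  assumes "0 \<le> s" "t < y s" "first_passage y t < r"
  obtains s' where "0 \<le> s'" "t < y s'" "s' < r"
  using assms first_passage_greatest[of s t y r] by force

lemma first_passage_mono:
  assumes "t \<le> t'" "0 \<le> s" "t' < y s"
  shows "first_passage y t \<le> first_passage y t'"
  using assms by (intro first_passage_greatest[of s]) (auto intro!: first_passage_le)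

lemma le_if_less_first_passage: "0 \<le> r \<Longrightarrow> r < first_passage y t \<Longrightarrow> y r \<le> t"
  using first_passage_le[of r t y] by force

text \<open>By right continuity \<open>y\<close> stays below \<open>t\<close> a little beyond
  \<open>r\<close>, and by monotonicity it was below before. With
  \<open>le_if_less_first_passage\<close> this makes \<open>r < first_passage y t\<close> and
  \<open>y r < t\<close> equivalent except when \<open>y r = t\<close>. The point \<open>s\<close>
  rules out the default value 0.\<close>

lemma less_first_passage:
  assumes mono: "mono_on {0..} y" and rc: "(y \<longlongrightarrow> y r) (at_right r)"
    and r: "0 \<le> r" "y r < t" and s: "0 \<le> s" "t < y s"
  shows "r < first_passage y t"
proof -
  have "\<forall>\<^sub>F x in at_right r. y x < t" using order_tendstoD(2)[OF rc r(2)] .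
  then obtain c where c: "r < c" "\<And>x. r < x \<Longrightarrow> x < c \<Longrightarrow> y x < t"
    by (auto simp: eventually_at_right_field)
  have "(r + c) / 2 \<le> first_passage y t"
  proof (rule first_passage_greatest[of s t y, OF s])
    fix x assume x: "0 \<le> x" "t < y x"
    show "(r + c) / 2 \<le> x"
    proof (rule ccontr)
      assume "\<not> (r + c) / 2 \<le> x"
      then have "y x \<le> y ((r + c) / 2)" using x r c by (intro mono_onD[OF mono]) auto
      also have "\<dots> < t" using c by auto
      finally show False using x by simp
    qed
  qed
  then show ?thesis using c by simp
qed

text \<open>The set \<open>{s. t < y s}\<close> is the union of the sets
  \<open>{s. t' < y s}\<close> over \<open>t' > t\<close>, and the infima follow. If it is empty so
  are all later ones, and the default value 0 is constant.\<close>

lemma first_passage_right_continuous: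
  "(first_passage y \<longlongrightarrow> first_passage y t) (at_right t)"
proof (cases "\<exists>s\<ge>0. t < y s")
  case False
  then have z: "first_passage y t' = 0" if "t \<le> t'" for t'
    using that by (auto simp: first_passage_def not_less intro: order_trans)
  have "\<forall>\<^sub>F t' in at_right t. first_passage y t' = first_passage y t"
    using eventually_at_right_less[of t] by eventually_elim (simp add: z)
  then show ?thesis by (rule tendsto_eventually)
next
  case True
  then obtain s where s: "0 \<le> s" "t < y s" by blast
  show ?thesis
  proof (rule order_tendstoI)
    fix a assume "a < first_passage y t"
    then have "a < first_passage y t'" if "t < t'" "t' < y s" for t'
      using first_passage_mono[of t t' s y] that s by simp
    then show "\<forall>\<^sub>F t' in at_right t. a < first_passage y t'"
      using s(2) by (auto simp: eventually_at_right_field)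
  next
    fix a assume "first_passage y t < a"
    then obtain s' where s': "0 \<le> s'" "t < y s'" "s' < a" using first_passage_witness[of s t y a, OF s] by blast
    then have "\<And>t'. t < t' \<Longrightarrow> t' < y s' \<Longrightarrow> first_passage y t' < a"
      using first_passage_le[of s' _ y] by force
    then show "\<forall>\<^sub>F t' in at_right t. first_passage y t' < a"
      using s'(2) by (auto simp: eventually_at_right_field)
  qed
qed

text \<open>A jump of the inverse would be a flat stretch of \<open>y\<close>. For the left limit,
  \<open>r1 < r2\<close> below the passage time satisfy \<open>y r1 < y r2 \<le> t\<close>, so every
  level between \<open>y r1\<close> and \<open>t\<close> is passed no earlier than
  \<open>r1\<close>.\<close>

lemma first_passage_isCont:
  assumes sm: "strict_mono_on {0..} y" and unb: "\<And>t. \<exists>s\<ge>0. t < y s" and y0: "y 0 < t"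
  shows "isCont (first_passage y) t"
proof -
  obtain s where s: "0 \<le> s" "t < y s" using unb by blast
  have "(first_passage y \<longlongrightarrow> first_passage y t) (at_left t)"
  proof (rule order_tendstoI)
    fix a assume "first_passage y t < a"
    moreover have "first_passage y t' \<le> first_passage y t" if "t' < t" for t'
      using that s by (intro first_passage_mono) auto
    ultimately have "\<And>t'. t' < t \<Longrightarrow> first_passage y t' < a" by force
    then show "\<forall>\<^sub>F t' in at_left t. first_passage y t' < a"
      unfolding eventually_at_left_field by (intro exI[of _ "t - 1"]) simp
  next
    fix a assume a: "a < first_passage y t"
    show "\<forall>\<^sub>F t' in at_left t. a < first_passage y t'"
    proof (cases "a < 0")
      case True
      then show ?thesis using first_passage_nonneg by (intro always_eventually allI) (rule less_le_trans)
    next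
      case False
      obtain r1 where r1: "a < r1" "r1 < first_passage y t" using a dense by blast
      obtain r2 where r2: "r1 < r2" "r2 < first_passage y t" using r1 dense by blast
      have "y r1 < y r2" using r1 r2 False by (intro strict_mono_onD[OF sm]) auto
      also have "y r2 \<le> t" using r1 r2 False le_if_less_first_passage[of r2 y t] by simp
      finally have lt: "y r1 < t" .
      have "r1 \<le> first_passage y t'" if "y r1 < t'" "t' < t" for t'
      proof (rule first_passage_greatest[of s])
        fix x assume x: "0 \<le> x" "t' < y x"
        show "r1 \<le> x"
        proof (rule ccontr)
          assume "\<not> r1 \<le> x"
          then have "y x < y r1" using x False r1 by (intro strict_mono_onD[OF sm]) auto
          then show False using x that by simp
        qed
      qed (use s that in auto)
      then have "\<And>t'. y r1 < t' \<Longrightarrow> t' < t \<Longrightarrow> a < first_passage y t'" using r1(1) by force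
      then show ?thesis using lt by (auto simp: eventually_at_left_field)
    qed
  qed
  then show ?thesis
    using first_passage_right_continuous[of y t]
    unfolding isCont_def by (simp add: filterlim_at_split)
qed

lemma first_passage_start:
  assumes "strict_mono_on {0..} y"
  shows "first_passage y (y 0) = 0"
proof -
  have "first_passage y (y 0) \<le> 0 + e" if "0 < e" for e
    using that strict_mono_onD[OF assms, of 0 e] by (simp add: first_passage_le)
  then have "first_passage y (y 0) \<le> 0" by (rule field_le_epsilon)
  then show ?thesis using first_passage_nonneg[of y "y 0"] by simp
qed

section \<open>The subordinators\<close>

lemma levy_process_right_continuous:
  "levy_process M Z \<Longrightarrow> 0 \<le> t \<Longrightarrow> \<omega> \<in> space M \<Longrightarrow> ((\<lambda>s. Z s \<omega>) \<longlongrightarrow> Z t \<omega>) (at_right t)"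
  by (simp add: levy_process_def cadlag_def)

context prob_space
begin

lemma stable_subordinator_start: "stable_subordinator M \<nu> S \<Longrightarrow> \<omega> \<in> space M \<Longrightarrow> S 0 \<omega> = 0"
  by (auto simp: stable_subordinator_def levy_process_def split: if_splits)

lemma stable_subordinator_mono: "stable_subordinator M \<nu> S \<Longrightarrow> \<omega> \<in> space M \<Longrightarrow> mono_on {0..} (\<lambda>t. S t \<omega>)"
  by (auto simp: stable_subordinator_def mono_on_def split: if_splits)

lemma stable_subordinator_measurable: "stable_subordinator M \<nu> S \<Longrightarrow> 0 \<le> t \<Longrightarrow> S t \<in> borel_measurable M"
  by (auto simp: stable_subordinator_def levy_process_def split: if_splits cong: measurable_cong)

lemma stable_subordinator_right_continuous:
  assumes "stable_subordinator M \<nu> S" "0 \<le> t" "\<omega> \<in> space M"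
  shows "((\<lambda>s. S s \<omega>) \<longlongrightarrow> S t \<omega>) (at_right t)"
proof (cases "\<nu> = 1")
  case True
  have "\<forall>\<^sub>F s in at_right t. s = S s \<omega>"
    using eventually_at_right_less[of t]
    by eventually_elim (use assms True in \<open>simp add: stable_subordinator_def\<close>)
  then have "((\<lambda>s. S s \<omega>) \<longlongrightarrow> t) (at_right t)"
    by (rule Lim_transform_eventually[OF tendsto_ident_at])
  then show ?thesis using assms True by (simp add: stable_subordinator_def)
qed (use assms levy_process_right_continuous in \<open>auto simp: stable_subordinator_def\<close>)

lemma stable_subordinator_nonneg:
  assumes "stable_subordinator M \<nu> S" "\<omega> \<in> space M" "0 \<le> t" shows "0 \<le> S t \<omega>"
  using mono_onD[OF stable_subordinator_mono[OF assms(1,2)], of 0 t] stable_subordinator_start[OF assms(1,2)] assms(3)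
  by simp

lemma stable_subordinator_laplace:
  assumes "stable_subordinator M \<nu> S" "0 \<le> t" "0 < \<xi>"
  shows "(\<integral>\<omega>. exp (- \<xi> * S t \<omega>) \<partial>M) = exp (- t * \<xi> powr \<nu>)"
proof (cases "\<nu> = 1")
  case True
  have "(\<integral>\<omega>. exp (- \<xi> * S t \<omega>) \<partial>M) = (\<integral>\<omega>. exp (- \<xi> * t) \<partial>M)"
    using assms True by (intro Bochner_Integration.integral_cong) (auto simp: stable_subordinator_def)
  then show ?thesis using assms True by (simp add: prob_space mult.commute)
qed (use assms in \<open>simp add: stable_subordinator_def\<close>)

text \<open>The indicator of \<open>Z = 0\<close> lies below \<open>exp (- \<xi> * Z)\<close> for
  every positive \<open>\<xi>\<close>.\<close>

lemma prob_zero_if_laplace_vanishes: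
  fixes Z :: "'a \<Rightarrow> real"
  assumes [measurable]: "Z \<in> borel_measurable M" and nn: "\<And>\<omega>. \<omega> \<in> space M \<Longrightarrow> 0 \<le> Z \<omega>"
    and L: "((\<lambda>\<xi>. \<integral>\<omega>. exp (- \<xi> * Z \<omega>) \<partial>M) \<longlongrightarrow> 0) at_top"
  shows "prob {\<omega> \<in> space M. Z \<omega> = 0} = 0"
proof -
  have "prob {\<omega> \<in> space M. Z \<omega> = 0} \<le> (\<integral>\<omega>. exp (- \<xi> * Z \<omega>) \<partial>M)" if "0 < \<xi>" for \<xi>
  proof -
    have "prob {\<omega> \<in> space M. Z \<omega> = 0} = (\<integral>\<omega>. indicator {\<omega> \<in> space M. Z \<omega> = 0} \<omega> \<partial>M)"
      by simp
    also have "\<dots> \<le> (\<integral>\<omega>. exp (- \<xi> * Z \<omega>) \<partial>M)"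
    proof (rule integral_mono)
      show "integrable M (\<lambda>\<omega>. exp (- \<xi> * Z \<omega>))"
        using nn that by (intro integrable_const_bound[of _ 1]) auto
    qed (auto split: split_indicator simp: less_top[symmetric])
    finally show ?thesis .
  qed
  then have "\<forall>\<^sub>F \<xi> in at_top. prob {\<omega> \<in> space M. Z \<omega> = 0} \<le> (\<integral>\<omega>. exp (- \<xi> * Z \<omega>) \<partial>M)"
    by (intro eventually_mono[OF eventually_gt_at_top[of 0]])
  from tendsto_lowerbound[OF L this] have "prob {\<omega> \<in> space M. Z \<omega> = 0} \<le> 0" by simp
  then show ?thesis using measure_nonneg[of M] by (meson antisym)
qed

text \<open>Since \<open>exp (- r * \<xi> powr \<nu>)\<close> tends to 0, \<open>S r\<close> has no
  atom at 0, and by stationarity no increment vanishes with positive probability. Countably many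
  rational pairs give one almost sure event, and monotonicity passes to real times.\<close>

lemma stable_subordinator_strict_mono:
  assumes S: "stable_subordinator M \<nu> S" and \<nu>: "0 < \<nu>"
  shows "AE \<omega> in M. strict_mono_on {0..} (\<lambda>t. S t \<omega>)"
proof (cases "\<nu> = 1")
  case True
  then show ?thesis using S by (auto simp: stable_subordinator_def strict_mono_on_def)
next
  case False
  have zero: "prob {\<omega> \<in> space M. S r \<omega> = 0} = 0" if "0 < r" for r
  proof (rule prob_zero_if_laplace_vanishes)
    have "filterlim (\<lambda>\<xi>::real. r * exp (\<nu> * ln \<xi>)) at_top at_top"
      by (intro filterlim_tendsto_pos_mult_at_top[OF tendsto_const] filterlim_compose[OF exp_at_top] ln_at_top \<nu> that)
    then have "((\<lambda>\<xi>::real. exp (- (r * exp (\<nu> * ln \<xi>)))) \<longlongrightarrow> 0) at_top"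
      by (intro filterlim_compose[OF exp_at_bot]) (simp add: filterlim_uminus_at_bot)
    moreover have "\<forall>\<^sub>F \<xi> in at_top. exp (- (r * exp (\<nu> * ln \<xi>))) = (\<integral>\<omega>. exp (- \<xi> * S r \<omega>) \<partial>M)"
      using eventually_gt_at_top[of "0::real"]
    proof eventually_elim
      case (elim \<xi>)
      then show ?case using stable_subordinator_laplace[OF S, of r \<xi>] that by (simp add: powr_def)
    qed
    ultimately show "((\<lambda>\<xi>. \<integral>\<omega>. exp (- \<xi> * S r \<omega>) \<partial>M) \<longlongrightarrow> 0) at_top"
      by (rule Lim_transform_eventually)
  qed (use that stable_subordinator_nonneg[OF S] stable_subordinator_measurable[OF S] in auto)
  have ne: "AE \<omega> in M. S s \<omega> \<noteq> S (s + r) \<omega>" if "0 \<le> s" "0 < r" for s r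
  proof -
    note [measurable] = stable_subordinator_measurable[OF S that(1)]
      stable_subordinator_measurable[OF S, of "s + r"] stable_subordinator_measurable[OF S, of r]
    have rv: "(\<lambda>\<omega>. S (s + r) \<omega> - S s \<omega>) \<in> borel_measurable M" "S r \<in> borel_measurable M" using that by auto
    have "distr M borel (\<lambda>\<omega>. S (s + r) \<omega> - S s \<omega>) = distr M borel (S r)"
      using S False that by (auto simp: stable_subordinator_def levy_process_def)
    then have eq0: "measure (distr M borel (\<lambda>\<omega>. S (s + r) \<omega> - S s \<omega>)) {0} = measure (distr M borel (S r)) {0}" by simp
    have "prob {\<omega> \<in> space M. S (s + r) \<omega> - S s \<omega> = 0} = prob {\<omega> \<in> space M. S r \<omega> = 0}"
    proof -
      have "{\<omega> \<in> space M. Z \<omega> = 0} = Z -` {0} \<inter> space M" for Z :: "'a \<Rightarrow> real" by auto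
      then show ?thesis
        using eq0 measure_distr[OF rv(1), of "{0}"] measure_distr[OF rv(2), of "{0}"]
        by (simp only: borel_singleton simp_thms sets.empty_sets)
    qed
    also have "\<dots> = 0" using zero that by simp
    finally have z: "emeasure M {\<omega> \<in> space M. S (s + r) \<omega> - S s \<omega> = 0} = 0"
      by (simp add: emeasure_eq_measure)
    have "(\<lambda>\<omega>. S (s + r) \<omega> - S s \<omega>) -` {0} \<inter> space M \<in> sets M"
      by (rule measurable_sets[OF rv(1)]) simp
    moreover have "(\<lambda>\<omega>. S (s + r) \<omega> - S s \<omega>) -` {0} \<inter> space M = {\<omega> \<in> space M. S (s + r) \<omega> - S s \<omega> = 0}"
      by auto
    ultimately show ?thesis by (intro AE_I[OF _ z]) auto
  qed
  have "AE \<omega> in M. \<forall>q1 q2 :: rat. 0 \<le> q1 \<longrightarrow> q1 < q2 \<longrightarrow> S (of_rat q1) \<omega> \<noteq> S (of_rat q2) \<omega>"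
    unfolding AE_all_countable
  proof (intro allI)
    fix q1 q2 :: rat
    show "AE \<omega> in M. 0 \<le> q1 \<longrightarrow> q1 < q2 \<longrightarrow> S (of_rat q1) \<omega> \<noteq> S (of_rat q2) \<omega>"
      using ne[of "of_rat q1" "of_rat q2 - of_rat q1"] by (cases "0 \<le> q1 \<and> q1 < q2") (auto simp: of_rat_less)
  qed
  with AE_space show ?thesis
  proof eventually_elim
    case (elim \<omega>)
    show ?case
    proof (rule strict_mono_onI)
      fix x y :: real assume xy: "x \<in> {0..}" "x < y"
      \<comment> \<open>Two rationals strictly between \<open>x\<close> and \<open>y\<close> are
        required: the strict increase takes place between them.\<close>
      obtain q1 where q1: "x < of_rat q1" "of_rat q1 < y" using of_rat_dense[OF xy(2)] by blast
      obtain q2 where q2: "real_of_rat q1 < of_rat q2" "of_rat q2 < y" using of_rat_dense[OF q1(2)] by blast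
      have m: "S u \<omega> \<le> S v \<omega>" if "0 \<le> u" "u \<le> v" for u v
        using mono_onD[OF stable_subordinator_mono[OF S elim(1)], of u v] that by simp
      have x0: "0 \<le> x" using xy by simp
      have "0 \<le> real_of_rat q1"
        using q1(1) xy(1) unfolding atLeast_iff by (rule order_trans[rotated, OF less_imp_le])
      then have "0 \<le> q1" by (simp add: zero_le_of_rat_iff)
      moreover have "q1 < q2" using q2 by (simp add: of_rat_less)
      ultimately have "S (of_rat q1) \<omega> \<noteq> S (of_rat q2) \<omega>" using elim(2) by blast
      moreover have "S x \<omega> \<le> S (of_rat q1) \<omega>" "S (of_rat q1) \<omega> \<le> S (of_rat q2) \<omega>" "S (of_rat q2) \<omega> \<le> S y \<omega>"
        using m[of x "of_rat q1"] m[of "of_rat q1" "of_rat q2"] m[of "of_rat q2" y] q1 q2 x0 by linarith+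
      ultimately show "S x \<omega> < S y \<omega>" by simp
    qed
  qed
qed

lemma poisson_process_laplace:
  assumes N: "poisson_process M lam N" and lam: "0 < lam" and t: "0 \<le> t"
  shows "(\<integral>\<omega>. exp (- \<eta> * real (N t \<omega>)) \<partial>M) = exp (- (lam * (1 - exp (- \<eta>))) * t)"
proof (cases "t = 0")
  case True
  have "(\<integral>\<omega>. exp (- \<eta> * real (N t \<omega>)) \<partial>M) = (\<integral>\<omega>. 1 \<partial>M)"
    using N True by (intro Bochner_Integration.integral_cong) (auto simp: poisson_process_def levy_process_def)
  then show ?thesis using True by (simp add: prob_space)
next
  case False
  then have t: "0 < t" using t by simp
  have "(\<lambda>\<omega>. real (N t \<omega>)) \<in> borel_measurable M"
    using N t by (simp add: poisson_process_def levy_process_def)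
  \<comment> \<open>Only the real-valued version is measurable by assumption; the floor recovers the
    integer-valued one.\<close>
  then have "(\<lambda>\<omega>. nat \<lfloor>real (N t \<omega>)\<rfloor>) \<in> measurable M (count_space UNIV)" by measurable
  then have [measurable]: "N t \<in> measurable M (count_space UNIV)" by simp
  define r where "r = lam * t"
  have r: "0 < r" using lam t by (simp add: r_def)
  have "(\<integral>\<omega>. exp (- \<eta> * real (N t \<omega>)) \<partial>M) = (\<integral>n. exp (- \<eta> * real n) \<partial>distr M (count_space UNIV) (N t))"
    by (subst integral_distr) simp_all
  also have "\<dots> = (\<integral>n. exp (- \<eta> * real n) \<partial>measure_pmf (poisson_pmf r))"
    using N t by (simp add: poisson_process_def r_def)
  also have "\<dots> = (\<integral>n. pmf (poisson_pmf r) n * exp (- \<eta> * real n) \<partial>count_space UNIV)"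
    unfolding measure_pmf_eq_density by (subst integral_density) simp_all
  also have "\<dots> = exp (- (lam * (1 - exp (- \<eta>))) * t)"
  proof -
    let ?f = "\<lambda>n. pmf (poisson_pmf r) n * exp (- \<eta> * real n)"
    have f: "?f n = exp (- r) * ((r * exp (- \<eta>)) ^ n /\<^sub>R fact n)" for n
      using r by (simp add: pmf_poisson power_mult_distrib exp_of_nat_mult[symmetric] field_simps)
    have s: "?f sums (exp (- r) * exp (r * exp (- \<eta>)))"
      unfolding f by (intro sums_mult exp_converges)
    then have "summable (\<lambda>n. norm (?f n))" by (simp add: sums_iff)
    then have "?f sums (\<integral>n. ?f n \<partial>count_space UNIV)"
      by (intro sums_integral_count_space_nat) (simp only: integrable_count_space_nat_iff)
    then have "(\<integral>n. ?f n \<partial>count_space UNIV) = exp (- r) * exp (r * exp (- \<eta>))"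
      using s by (rule sums_unique2)
    then show ?thesis by (simp add: r_def algebra_simps flip: exp_add)
  qed
  finally show ?thesis .
qed

end

section \<open>The clock\<close>

locale clock = prob_space M
  for M :: "'a measure" +
  fixes N :: "real \<Rightarrow> 'a \<Rightarrow> nat" and A B :: "real \<Rightarrow> 'a \<Rightarrow> real" and b \<beta> \<gamma> lam :: real
  assumes b: "0 \<le> b" and \<beta>: "0 < \<beta>" "\<beta> \<le> 1" and \<gamma>: "0 < \<gamma>" "\<gamma> \<le> 1" and lam: "0 < lam"
    and N: "poisson_process M lam N" and A: "stable_subordinator M \<gamma> A" and B: "stable_subordinator M \<beta> B"
    and indep: "indep_processes3 M (\<lambda>t \<omega>. real (N t \<omega>)) A B"
begin

definition path :: "nat \<Rightarrow> 'a \<Rightarrow> real \<Rightarrow> real" where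
  "path = (\<lambda>i \<omega>. \<lambda>t\<in>{0..}. (if i = 0 then \<lambda>t \<omega>. real (N t \<omega>) else if i = 1 then A else B) t \<omega>)"

lemma path_eq [simp]:
  "0 \<le> t \<Longrightarrow> path 0 \<omega> t = real (N t \<omega>)" "0 \<le> t \<Longrightarrow> path (Suc 0) \<omega> t = A t \<omega>" "0 \<le> t \<Longrightarrow> path 2 \<omega> t = B t \<omega>"
  by (simp_all add: path_def)

text \<open>Independence is transported from path space to sub-\<open>\<sigma>\<close>-algebras of \<open>M\<close>, because evaluating
  a path at a random time is not measurable on the product space of all functions.\<close>

abbreviation subalg :: "nat set \<Rightarrow> 'a measure" where
  "subalg K \<equiv> vimage_algebra (space M) (\<lambda>\<omega>. restrict (\<lambda>i. path i \<omega>) K) (PiM K (\<lambda>_. PiM {0..} (\<lambda>_. borel)))"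

lemma indep_subalg:
  assumes "K \<inter> L = {}" "K \<subseteq> {0, 1, 2}" "L \<subseteq> {0, 1, 2}"
  shows "indep_var (subalg K) (\<lambda>\<omega>. \<omega>) (subalg L) (\<lambda>\<omega>. \<omega>)"
  using indep unfolding indep_processes3_def path_def[symmetric]
  by (intro indep_var_vimage_algebra indep_var_restrict[OF _ assms])

lemma path_measurable:
  assumes "i \<in> K" "0 \<le> t" shows "(\<lambda>\<omega>. path i \<omega> t) \<in> borel_measurable (subalg K)"
proof -
  have "(\<lambda>\<omega>. restrict (\<lambda>i. path i \<omega>) K) \<in> measurable (subalg K) (PiM K (\<lambda>_. PiM {0..} (\<lambda>_. borel)))"
    by (rule measurable_vimage_algebra1) (auto simp: space_PiM PiE_def path_def)
  from measurable_compose[OF this measurable_component_singleton[OF assms(1)]]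
  have "(\<lambda>\<omega>. path i \<omega>) \<in> measurable (subalg K) (PiM {0..} (\<lambda>_. borel))" using assms by simp
  from measurable_compose[OF this measurable_component_singleton[of t]] assms
  show ?thesis by simp
qed

text \<open>Independence from the empty block of paths contains the measurability of the identity
  from \<open>M\<close> to \<open>subalg K\<close>.\<close>

lemma subalg_measurable:
  assumes "K \<subseteq> {0, 1, 2}" "f \<in> measurable (subalg K) L"
  shows "f \<in> measurable M L"
  using measurable_compose[OF indep_var_rv1[OF indep_subalg[of K "{}"]] assms(2)] assms(1) by simp

lemma N_right_continuous: "0 \<le> t \<Longrightarrow> \<omega> \<in> space M \<Longrightarrow> ((\<lambda>s. real (N s \<omega>)) \<longlongrightarrow> real (N t \<omega>)) (at_right t)"
  using N levy_process_right_continuous[of M "\<lambda>t \<omega>. real (N t \<omega>)"] by (simp add: poisson_process_def)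

lemma N_mono: "\<omega> \<in> space M \<Longrightarrow> mono_on {0..} (\<lambda>t. N t \<omega>)"
  using N by (simp add: poisson_process_def)

lemma N_start: "\<omega> \<in> space M \<Longrightarrow> N 0 \<omega> = 0"
  using N by (simp add: poisson_process_def levy_process_def)

lemma N_joint_measurable:
  assumes "0 \<in> K"
  shows "(\<lambda>(t, \<omega>). real (N (max 0 t) \<omega>)) \<in> borel_measurable (borel \<Otimes>\<^sub>M subalg K)"
  using path_measurable[OF assms] N_right_continuous
  by (intro measurable_right_continuous_process[where f="\<lambda>t \<omega>. real (N t \<omega>)"]) (auto dest: less_imp_le)

definition Y :: "real \<Rightarrow> 'a \<Rightarrow> real" where
  "Y s \<omega> = real (N (A s \<omega>) \<omega>) + b * B s \<omega>"

lemma hitting_time_eq: "hitting_time N A b B t \<omega> = first_passage (\<lambda>s. Y s \<omega>) t"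
  by (simp add: hitting_time_def first_passage_def Y_def)

lemma A_nonneg: "\<omega> \<in> space M \<Longrightarrow> 0 \<le> t \<Longrightarrow> 0 \<le> A t \<omega>"
  using stable_subordinator_nonneg[OF A] by blast

lemma Y_start: "\<omega> \<in> space M \<Longrightarrow> Y 0 \<omega> = 0"
  by (simp add: Y_def N_start stable_subordinator_start[OF A] stable_subordinator_start[OF B])

lemma NA_mono:
  assumes "\<omega> \<in> space M" "0 \<le> s" "s \<le> t" shows "N (A s \<omega>) \<omega> \<le> N (A t \<omega>) \<omega>"
  using assms A_nonneg[OF assms(1)] mono_onD[OF stable_subordinator_mono[OF A assms(1)], of s t]
  by (intro mono_onD[OF N_mono]) auto

lemma Y_mono: "\<omega> \<in> space M \<Longrightarrow> mono_on {0..} (\<lambda>s. Y s \<omega>)"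
  unfolding Y_def using b NA_mono mono_onD[OF stable_subordinator_mono[OF B]]
  by (intro mono_onI add_mono mult_left_mono) auto

lemma Y_right_continuous:
  assumes t: "0 \<le> t" and \<omega>: "\<omega> \<in> space M"
  shows "((\<lambda>s. Y s \<omega>) \<longlongrightarrow> Y t \<omega>) (at_right t)"
proof -
  let ?n = "\<lambda>x. real (N x \<omega>)"
  have "((\<lambda>s. ?n (A s \<omega>)) \<longlongrightarrow> ?n (A t \<omega>)) (at_right t)"
  proof (rule order_tendstoI)
    fix a assume a: "a < ?n (A t \<omega>)"
    show "\<forall>\<^sub>F s in at_right t. a < ?n (A s \<omega>)"
      using eventually_at_right_less[of t]
    proof eventually_elim
      case (elim s)
      then show ?case using NA_mono[OF \<omega> t, of s] a by simp
    qed
  next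
    fix a assume a: "?n (A t \<omega>) < a"
    have "\<forall>\<^sub>F x in at_right (A t \<omega>). ?n x < a"
      using order_tendstoD(2)[OF N_right_continuous[OF A_nonneg[OF \<omega> t] \<omega>] a] .
    then obtain c where c: "A t \<omega> < c" "\<And>x. A t \<omega> < x \<Longrightarrow> x < c \<Longrightarrow> ?n x < a"
      by (auto simp: eventually_at_right_field)
    have "\<forall>\<^sub>F s in at_right t. A s \<omega> < c"
      using order_tendstoD(2)[OF stable_subordinator_right_continuous[OF A t \<omega>] c(1)] .
    then show "\<forall>\<^sub>F s in at_right t. ?n (A s \<omega>) < a"
      using eventually_at_right_less[of t]
    proof eventually_elim
      case (elim s)
      then have "A t \<omega> \<le> A s \<omega>"
        using t by (intro mono_onD[OF stable_subordinator_mono[OF A \<omega>]]) auto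
      \<comment> \<open>The subordinator may be constant to the right of \<open>t\<close>, so
        \<open>A s \<omega>\<close> can coincide with \<open>A t \<omega>\<close>, a point that the
        filter \<open>at_right\<close> leaves out.\<close>
      then show ?case using c(2)[of "A s \<omega>"] elim a by (cases "A t \<omega> = A s \<omega>") auto
    qed
  qed
  then show ?thesis unfolding Y_def
    by (intro tendsto_intros stable_subordinator_right_continuous[OF B t \<omega>])
qed

lemma NA_measurable:
  assumes "0 \<in> K" "1 \<in> K" "0 \<le> s"
  shows "(\<lambda>\<omega>. real (N (A s \<omega>) \<omega>)) \<in> borel_measurable (subalg K)"
proof -
  have [measurable]: "A s \<in> borel_measurable (subalg K)"
    using path_measurable[OF assms(2,3)] assms(3) by simp
  have "(\<lambda>\<omega>. (A s \<omega>, \<omega>)) \<in> measurable (subalg K) (borel \<Otimes>\<^sub>M subalg K)" by measurable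
  from measurable_compose[OF this N_joint_measurable[OF assms(1)]]
  have "(\<lambda>\<omega>. real (N (max 0 (A s \<omega>)) \<omega>)) \<in> borel_measurable (subalg K)" by simp
  then show ?thesis
    by (rule measurable_cong[THEN iffD1, rotated]) (use A_nonneg assms(3) in \<open>simp add: max_absorb2\<close>)
qed

lemma Y_measurable:
  assumes "0 \<le> s" shows "Y s \<in> borel_measurable M"
proof -
  have "(\<lambda>\<omega>. real (N (A s \<omega>) \<omega>)) \<in> borel_measurable M"
    by (rule subalg_measurable[of "{0, 1}"]) (auto intro!: NA_measurable assms)
  then show ?thesis unfolding Y_def[abs_def] using stable_subordinator_measurable[OF B assms] by measurable
qed

definition \<Phi> :: "real \<Rightarrow> real" where
  "\<Phi> \<eta> = b powr \<beta> * \<eta> powr \<beta> + lam powr \<gamma> * (1 - exp (- \<eta>)) powr \<gamma>"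

lemma \<Phi>_pos: "0 < \<eta> \<Longrightarrow> 0 < \<Phi> \<eta>"
  unfolding \<Phi>_def using lam by (intro add_nonneg_pos mult_pos_pos) auto

text \<open>Subordination: with \<open>A s\<close> frozen the Poisson transform is
  \<open>exp (- x * A s)\<close> for \<open>x = lam * (1 - exp (- \<eta>))\<close>, and the stable
  transform at this \<open>x\<close> yields \<open>x powr \<gamma>\<close>.\<close>

lemma NA_laplace:
  assumes s: "0 \<le> s" and \<eta>: "0 < \<eta>"
  shows "(\<integral>\<omega>. exp (- \<eta> * real (N (A s \<omega>) \<omega>)) \<partial>M) = exp (- s * (lam powr \<gamma> * (1 - exp (- \<eta>)) powr \<gamma>))"
proof -
  let ?f = "\<lambda>(\<omega>1, \<omega>2). exp (- \<eta> * real (N (max 0 (A s \<omega>2)) \<omega>1))"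
  have [measurable]: "A s \<in> borel_measurable (subalg {1})"
    using path_measurable[of 1 "{1}" s] s by simp
  have "(\<lambda>x. (A s (snd x), fst x)) \<in> measurable (subalg {0} \<Otimes>\<^sub>M subalg {1}) (borel \<Otimes>\<^sub>M subalg {0})" by measurable
  from measurable_compose[OF this N_joint_measurable]
  have [measurable]: "(\<lambda>x. real (N (max 0 (A s (snd x))) (fst x))) \<in> borel_measurable (subalg {0} \<Otimes>\<^sub>M subalg {1})" by simp
  have "(\<integral>\<omega>. exp (- \<eta> * real (N (A s \<omega>) \<omega>)) \<partial>M) = (\<integral>\<omega>. ?f (\<omega>, \<omega>) \<partial>M)"
    by (intro Bochner_Integration.integral_cong) (auto simp: A_nonneg s max_absorb2)
  also have "\<dots> = (\<integral>\<omega>2. (\<integral>\<omega>1. ?f (\<omega>1, \<omega>2) \<partial>M) \<partial>M)"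
  proof (rule integral_indep_subalgebras)
    show "indep_var (subalg {0}) (\<lambda>\<omega>. \<omega>) (subalg {1}) (\<lambda>\<omega>. \<omega>)" by (rule indep_subalg) auto
    show "?f \<in> borel_measurable (subalg {0} \<Otimes>\<^sub>M subalg {1})" unfolding case_prod_beta by measurable
    show "\<bar>?f x\<bar> \<le> 1" for x using \<eta> by (simp add: case_prod_beta)
  qed
  also have "\<dots> = (\<integral>\<omega>2. exp (- (lam * (1 - exp (- \<eta>))) * A s \<omega>2) \<partial>M)"
    using poisson_process_laplace[OF N lam, of _ \<eta>]
    by (intro Bochner_Integration.integral_cong) (auto simp: A_nonneg s max_absorb2)
  also have "\<dots> = exp (- s * (lam * (1 - exp (- \<eta>))) powr \<gamma>)"
    using lam \<eta> by (intro stable_subordinator_laplace[OF A s]) auto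
  finally show ?thesis using lam \<eta> by (simp add: powr_mult)
qed

lemma Y_laplace:
  assumes s: "0 \<le> s" and \<eta>: "0 < \<eta>"
  shows "(\<integral>\<omega>. exp (- \<eta> * Y s \<omega>) \<partial>M) = exp (- s * \<Phi> \<eta>)"
proof -
  \<comment> \<open>\<open>max 0\<close> makes the bound by 1 hold for all pairs, since
    \<open>B s\<close> is known to be nonnegative on \<open>space M\<close> only.\<close>
  let ?f = "\<lambda>(\<omega>1, \<omega>2). exp (- \<eta> * real (N (A s \<omega>1) \<omega>1)) * exp (- \<eta> * b * max 0 (B s \<omega>2))"
  have nn: "0 \<le> B s \<omega>" if "\<omega> \<in> space M" for \<omega> using stable_subordinator_nonneg[OF B that s] .
  have [measurable]: "B s \<in> borel_measurable (subalg {2})" "(\<lambda>\<omega>. real (N (A s \<omega>) \<omega>)) \<in> borel_measurable (subalg {0, 1})"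
    using path_measurable[of 2 "{2}" s] NA_measurable[of "{0, 1}" s] s by simp_all
  have "(\<integral>\<omega>. exp (- \<eta> * Y s \<omega>) \<partial>M) = (\<integral>\<omega>. ?f (\<omega>, \<omega>) \<partial>M)"
    by (intro Bochner_Integration.integral_cong)
      (auto simp: nn max_absorb2 Y_def algebra_simps simp flip: exp_add)
  also have "\<dots> = (\<integral>\<omega>2. (\<integral>\<omega>1. ?f (\<omega>1, \<omega>2) \<partial>M) \<partial>M)"
  proof (rule integral_indep_subalgebras)
    show "indep_var (subalg {0, 1}) (\<lambda>\<omega>. \<omega>) (subalg {2}) (\<lambda>\<omega>. \<omega>)" by (rule indep_subalg) auto
    show "?f \<in> borel_measurable (subalg {0, 1} \<Otimes>\<^sub>M subalg {2})" unfolding case_prod_beta by measurable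
    show "\<bar>?f x\<bar> \<le> 1" for x using \<eta> b by (auto simp: case_prod_beta abs_mult intro!: mult_le_one)
  qed
  also have "\<dots> = exp (- s * (lam powr \<gamma> * (1 - exp (- \<eta>)) powr \<gamma>)) * (\<integral>\<omega>2. exp (- \<eta> * b * max 0 (B s \<omega>2)) \<partial>M)"
    using NA_laplace[OF s \<eta>] by simp
  also have "(\<integral>\<omega>2. exp (- \<eta> * b * max 0 (B s \<omega>2)) \<partial>M) = (\<integral>\<omega>2. exp (- (\<eta> * b) * B s \<omega>2) \<partial>M)"
    by (intro Bochner_Integration.integral_cong) (auto simp: nn max_absorb2)
  also have "\<dots> = exp (- s * (b powr \<beta> * \<eta> powr \<beta>))"
  \<comment> \<open>The stable transform is given at positive arguments, and here the argument is
    \<open>\<eta> * b\<close>.\<close>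
  proof (cases "b = 0")
    case False
    then have "(\<integral>\<omega>2. exp (- (\<eta> * b) * B s \<omega>2) \<partial>M) = exp (- s * (\<eta> * b) powr \<beta>)"
      using b \<eta> by (intro stable_subordinator_laplace[OF B s]) auto
    then show ?thesis using b \<eta> by (simp add: powr_mult mult.commute)
  qed (simp add: prob_space)
  finally show ?thesis by (simp add: \<Phi>_def algebra_simps flip: exp_add)
qed

text \<open>Exponential Markov inequality: where \<open>Y n\<close> stays below \<open>k\<close>,
  \<open>1 \<le> exp (k - Y n)\<close>, with expectation
  \<open>exp k * exp (- n * \<Phi> 1)\<close>, which tends to 0 as \<open>n\<close> grows.\<close>

lemma Y_unbounded: "AE \<omega> in M. \<forall>t. \<exists>s\<ge>0. t < Y s \<omega>"
proof -
  have null: "prob {\<omega> \<in> space M. \<forall>n. Y (real n) \<omega> \<le> real k} = 0" for k :: nat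
  proof -
    note [measurable] = Y_measurable
    have le: "prob {\<omega> \<in> space M. \<forall>n. Y (real n) \<omega> \<le> real k} \<le> exp (real k) * exp (- real n * \<Phi> 1)" for n :: nat
    proof -
      let ?S = "{\<omega> \<in> space M. \<forall>n. Y (real n) \<omega> \<le> real k}"
      have [measurable]: "Y (real n) \<in> borel_measurable M" for n by (rule Y_measurable) simp
      have [measurable]: "?S \<in> sets M" by measurable
      have nn: "0 \<le> Y (real n) \<omega>" if "\<omega> \<in> space M" for \<omega>
        using mono_onD[OF Y_mono[OF that], of 0 "real n"] Y_start[OF that] by simp
      have "prob ?S = (\<integral>\<omega>. indicator ?S \<omega> \<partial>M)" by simp
      also have "\<dots> \<le> (\<integral>\<omega>. exp (real k) * exp (- 1 * Y (real n) \<omega>) \<partial>M)"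
      proof (rule integral_mono)
        show "integrable M (\<lambda>\<omega>. exp (real k) * exp (- 1 * Y (real n) \<omega>))"
          using nn by (intro integrable_mult_right integrable_const_bound[of _ 1]) auto
        show "indicator ?S \<omega> \<le> exp (real k) * exp (- 1 * Y (real n) \<omega>)" for \<omega>
          by (auto split: split_indicator simp flip: exp_add)
      qed (simp add: less_top[symmetric])
      also have "\<dots> = exp (real k) * exp (- real n * \<Phi> 1)" by (subst integral_mult_right_zero, subst Y_laplace) auto
      finally show ?thesis .
    qed
    have "filterlim (\<lambda>n. - (\<Phi> 1 * real n)) at_bot sequentially"
      using \<Phi>_pos[of 1] by (auto simp: filterlim_uminus_at_bot intro!: filterlim_tendsto_pos_mult_at_top[OF tendsto_const] filterlim_real_sequentially)
    from filterlim_compose[OF exp_at_bot this]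
    have "(\<lambda>n. exp (- real n * \<Phi> 1)) \<longlonglongrightarrow> 0" by (simp add: mult.commute)
    then have "(\<lambda>n. exp (real k) * exp (- real n * \<Phi> 1)) \<longlonglongrightarrow> exp (real k) * 0"
      by (intro tendsto_mult tendsto_const)
    from tendsto_lowerbound[OF this always_eventually] le
    have "prob {\<omega> \<in> space M. \<forall>n. Y (real n) \<omega> \<le> real k} \<le> 0" by simp
    then show ?thesis by (simp add: measure_le_0_iff)
  qed
  have "AE \<omega> in M. \<exists>n. real k < Y (real n) \<omega>" for k :: nat
  proof -
    have [measurable]: "Y (real n) \<in> borel_measurable M" for n by (rule Y_measurable) simp
    show ?thesis using null[of k]
      by (intro AE_I[of _ _ "{\<omega> \<in> space M. \<forall>n. Y (real n) \<omega> \<le> real k}"]) (auto simp: emeasure_eq_measure not_less)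
  qed
  then have "AE \<omega> in M. \<forall>k::nat. \<exists>n::nat. real k < Y (real n) \<omega>" by (simp add: AE_all_countable)
  then show ?thesis
  proof eventually_elim
    case (elim \<omega>)
    show ?case
    proof
      fix t :: real
      obtain k where "t < real k" using reals_Archimedean2 by blast
      moreover obtain n where "real k < Y (real n) \<omega>" using elim by blast
      ultimately show "\<exists>s\<ge>0. t < Y s \<omega>" by (intro exI[of _ "real n"]) simp
    qed
  qed
qed

lemma Y_strict_mono:
  assumes "0 < b" shows "AE \<omega> in M. strict_mono_on {0..} (\<lambda>s. Y s \<omega>)"
  using AE_space stable_subordinator_strict_mono[OF B \<beta>(1)]
proof eventually_elim
  case (elim \<omega>)
  show ?case unfolding Y_def
    using NA_mono[OF elim(1)] strict_mono_onD[OF elim(2)] assms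
    by (intro strict_mono_onI add_le_less_mono) auto
qed

end

section \<open>The law of the first passage time\<close>

lemma measure_exponential_greaterThan:
  assumes "0 < l" "0 \<le> a"
  shows "measure (density lborel (exponential_density l)) {a<..} = exp (- (l * a))"
proof -
  let ?D = "density lborel (exponential_density l)"
  interpret D: prob_space ?D by (rule prob_space_exponential_density) fact
  have "distributed ?D lborel (\<lambda>x. x) (exponential_density l)"
    unfolding distributed_def
  proof (intro conjI)
    show "distr ?D lborel (\<lambda>x. x) = ?D" by (rule distr_id2) simp
  qed simp_all
  from D.exponential_distributedD_gt[OF this assms(2,1)]
  show ?thesis by (simp add: greaterThan_def mult.commute)
qed

lemma exponential_density_eq: "exponential_density l x = l * (exp (- (l * x)) * heaviside x)"
  by (simp add: exponential_density_def heaviside_def mult.commute)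

text \<open>The measurability of the passage times is later read off from \<open>indep_time\<close>,
  whose random variables are measurable by definition; time 0 is reached through right
  continuity.\<close>

locale measurable_clock = clock +
  assumes T_measurable: "\<And>t. 0 < t \<Longrightarrow> hitting_time N A b B t \<in> borel_measurable M"
begin

abbreviation T :: "real \<Rightarrow> 'a \<Rightarrow> real" where
  "T \<equiv> hitting_time N A b B"

lemma T_nonneg: "0 \<le> T t \<omega>"
  by (simp add: hitting_time_eq first_passage_nonneg)

lemma T_right_continuous: "((\<lambda>s. T s \<omega>) \<longlongrightarrow> T t \<omega>) (at_right t)"
  unfolding hitting_time_eq by (rule first_passage_right_continuous)

lemma T_joint_measurable: "(\<lambda>(t, \<omega>). T (max 0 t) \<omega>) \<in> borel_measurable (borel \<Otimes>\<^sub>M M)"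
  by (intro measurable_right_continuous_process T_measurable T_right_continuous)

lemma T_measurable': "0 \<le> t \<Longrightarrow> T t \<in> borel_measurable M"
  using measurable_compose[OF measurable_Pair1'[of t borel M] T_joint_measurable] by (simp add: max_absorb2)

lemma T_isCont:
  assumes "0 < b" shows "AE \<omega> in M. \<forall>t>0. isCont (\<lambda>s. T s \<omega>) t"
  using AE_space Y_strict_mono[OF assms] Y_unbounded
proof eventually_elim
  case (elim \<omega>)
  then show ?case unfolding hitting_time_eq
    using first_passage_isCont[of "\<lambda>s. Y s \<omega>"] Y_start[of \<omega>] by simp
qed

lemma T_zero:
  assumes "0 < b" shows "AE \<omega> in M. T 0 \<omega> = 0"
  using AE_space Y_strict_mono[OF assms]
proof eventually_elim
  case (elim \<omega>)
  then show ?case unfolding hitting_time_eq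
    using first_passage_start[of "\<lambda>s. Y s \<omega>"] Y_start[of \<omega>] by simp
qed

lemma T_negative: "t < 0 \<Longrightarrow> \<omega> \<in> space M \<Longrightarrow> T t \<omega> = 0"
  using first_passage_le[of 0 t "\<lambda>s. Y s \<omega>"] Y_start[of \<omega>] T_nonneg[of t \<omega>] by (simp add: hitting_time_eq)

text \<open>At an independent exponential time of rate \<open>\<eta>\<close>, the passage time \<open>T\<close> exceeds \<open>r\<close> iff
  \<open>Y r\<close> is smaller than that time, which has probability \<open>exp (- r \<Phi>(\<eta>))\<close>.\<close>

lemma distr_T_exponential:
  assumes \<eta>: "0 < \<eta>"
  shows "distr (M \<Otimes>\<^sub>M density lborel (exponential_density \<eta>)) borel (\<lambda>(\<omega>, t). T (max 0 t) \<omega>)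
    = density lborel (exponential_density (\<Phi> \<eta>))"
proof -
  define D where "D = density lborel (exponential_density \<eta>)"
  interpret D: prob_space D unfolding D_def by (rule prob_space_exponential_density) fact
  interpret Q: pair_prob_space M D ..
  have D_sets[measurable_cong]: "sets D = sets borel" by (simp add: D_def)
  note \<Phi> = \<Phi>_pos[OF \<eta>]
  interpret E: prob_space "density lborel (exponential_density (\<Phi> \<eta>))"
    by (rule prob_space_exponential_density) fact
  let ?T = "\<lambda>(\<omega>, t). T (max 0 t) \<omega>"
  have Tm[measurable]: "?T \<in> borel_measurable (M \<Otimes>\<^sub>M D)"
  proof -
    have "(\<lambda>x. (snd x, fst x)) \<in> measurable (M \<Otimes>\<^sub>M D) (borel \<Otimes>\<^sub>M M)" by measurable
    from measurable_compose[OF this T_joint_measurable] show ?thesis by (simp add: case_prod_beta)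
  qed
  have "prob_space (distr (M \<Otimes>\<^sub>M D) borel ?T)" by (rule Q.P.prob_space_distr) (rule Tm)
  have tail: "Q.P.prob {x \<in> space (M \<Otimes>\<^sub>M D). r < ?T x} = exp (- (\<Phi> \<eta> * r))" if r: "0 \<le> r" for r
  proof -
    let ?S = "{x \<in> space (M \<Otimes>\<^sub>M D). r < ?T x}"
    have [measurable]: "?S \<in> sets (M \<Otimes>\<^sub>M D)" by measurable
    have "Q.P.prob ?S = (\<integral>x. indicator ?S x \<partial>(M \<Otimes>\<^sub>M D))" by simp
    also have "\<dots> = (\<integral>\<omega>. (\<integral>t. indicator ?S (\<omega>, t) \<partial>D) \<partial>M)"
      by (intro Q.integral_fst'[symmetric] integrable_real_indicator) (auto simp: less_top[symmetric])
    also have "\<dots> = (\<integral>\<omega>. exp (- \<eta> * Y r \<omega>) \<partial>M)"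
    proof (rule integral_cong_AE)
      show "AE \<omega> in M. (\<integral>t. indicator ?S (\<omega>, t) \<partial>D) = exp (- \<eta> * Y r \<omega>)"
        using AE_space Y_unbounded
      proof eventually_elim
        case (elim \<omega>)
        have Y0: "0 \<le> Y r \<omega>"
          using mono_onD[OF Y_mono[OF elim(1)], of 0 r] Y_start[OF elim(1)] r by simp
        \<comment> \<open>The exceptional level \<open>t = Y r \<omega>\<close>, at which the
          equivalence below may fail, has measure zero for the exponential law.\<close>
        have "AE t in D. 0 \<le> t \<and> t \<noteq> Y r \<omega>"
          unfolding D_def using AE_lborel_singleton[of "Y r \<omega>"]
          by (subst AE_density) (auto simp: exponential_density_def split: if_splits elim!: eventually_mono)
        then have "AE t in D. indicator ?S (\<omega>, t) = (indicator {Y r \<omega><..} t :: real)"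
        proof eventually_elim
          case (elim t)
          have "r < T t \<omega> \<longleftrightarrow> Y r \<omega> < t"
          proof
            assume "r < T t \<omega>"
            then show "Y r \<omega> < t"
              using le_if_less_first_passage[OF r, of "\<lambda>s. Y s \<omega>" t] elim by (simp add: hitting_time_eq)
          next
            assume lt: "Y r \<omega> < t"
            obtain s where "0 \<le> s" "t < Y s \<omega>" using \<open>\<forall>t. \<exists>s\<ge>0. t < Y s \<omega>\<close> by blast
            then show "r < T t \<omega>" unfolding hitting_time_eq
              using less_first_passage[OF Y_mono[OF \<open>\<omega> \<in> space M\<close>] Y_right_continuous[OF r \<open>\<omega> \<in> space M\<close>] r lt]
              by blast
          qed
          then show ?case using elim \<open>\<omega> \<in> space M\<close>
            by (simp add: indicator_def space_pair_measure D_def max_absorb2)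
        qed
        then have "(\<integral>t. indicator ?S (\<omega>, t) \<partial>D) = (\<integral>t. (indicator {Y r \<omega><..} t :: real) \<partial>D)"
        proof (rule integral_cong_AE[rotated -1])
          show "(\<lambda>t. indicator ?S (\<omega>, t) :: real) \<in> borel_measurable D"
            by (rule measurable_compose[OF measurable_Pair1'[OF elim(1)] borel_measurable_indicator]) fact
          show "(\<lambda>t. indicator {Y r \<omega><..} t :: real) \<in> borel_measurable D" by measurable
        qed
        also have "\<dots> = exp (- \<eta> * Y r \<omega>)"
          using measure_exponential_greaterThan[OF \<eta> Y0] by (simp add: D_def)
        finally show ?case .
      qed
      have "(\<lambda>(\<omega>, t). indicator ?S (\<omega>, t) :: real) \<in> borel_measurable (M \<Otimes>\<^sub>M D)"
        by (simp add: case_prod_beta)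
      then show "(\<lambda>\<omega>. \<integral>t. (indicator ?S (\<omega>, t) :: real) \<partial>D) \<in> borel_measurable M"
        by (rule D.borel_measurable_lebesgue_integral)
      show "(\<lambda>\<omega>. exp (- \<eta> * Y r \<omega>)) \<in> borel_measurable M" using Y_measurable[OF r] by measurable
    qed
    also have "\<dots> = exp (- (\<Phi> \<eta> * r))" using Y_laplace[OF r \<eta>] by (simp add: mult.commute)
    finally show ?thesis .
  qed
  have "distr (M \<Otimes>\<^sub>M D) borel ?T = density lborel (exponential_density (\<Phi> \<eta>))"
  proof (rule cdf_unique)
    show "real_distribution (distr (M \<Otimes>\<^sub>M D) borel ?T)"
      using \<open>prob_space (distr (M \<Otimes>\<^sub>M D) borel ?T)\<close>
      by (simp add: real_distribution_def real_distribution_axioms_def)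
    show "real_distribution (density lborel (exponential_density (\<Phi> \<eta>)))"
      using E.prob_space_axioms by (simp add: real_distribution_def real_distribution_axioms_def)
    show "cdf (distr (M \<Otimes>\<^sub>M D) borel ?T) = cdf (density lborel (exponential_density (\<Phi> \<eta>)))"
    proof
      fix r
      have 1: "cdf (distr (M \<Otimes>\<^sub>M D) borel ?T) r = 1 - Q.P.prob {x \<in> space (M \<Otimes>\<^sub>M D). r < ?T x}"
        unfolding cdf_def by (subst measure_distr, simp, simp, subst Q.P.prob_compl[symmetric])
          (auto intro!: arg_cong[where f="measure _"])
      have 2: "cdf (density lborel (exponential_density (\<Phi> \<eta>))) r
          = 1 - measure (density lborel (exponential_density (\<Phi> \<eta>))) {r<..}"
        unfolding cdf_def by (subst E.prob_compl[symmetric])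
          (auto intro!: arg_cong[where f="measure _"])
      show "cdf (distr (M \<Otimes>\<^sub>M D) borel ?T) r = cdf (density lborel (exponential_density (\<Phi> \<eta>))) r"
      proof (cases "0 \<le> r")
        case True
        then show ?thesis unfolding 1 2 using tail measure_exponential_greaterThan[OF \<Phi>] by simp
      next
        case False
        have "{x \<in> space (M \<Otimes>\<^sub>M D). r < ?T x} = space (M \<Otimes>\<^sub>M D)"
          using False less_le_trans[OF _ T_nonneg, of r] by auto
        moreover have "measure (density lborel (exponential_density (\<Phi> \<eta>))) {r<..} = 1"
        proof (rule antisym)
          have "1 = measure (density lborel (exponential_density (\<Phi> \<eta>))) {0<..}"
            using measure_exponential_greaterThan[OF \<Phi>, of 0] by simp
          also have "\<dots> \<le> measure (density lborel (exponential_density (\<Phi> \<eta>))) {r<..}"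
            using False by (intro E.finite_measure_mono) auto
          finally show "1 \<le> measure (density lborel (exponential_density (\<Phi> \<eta>))) {r<..}" .
        qed simp
        ultimately show ?thesis unfolding 1 2 by (simp add: Q.P.prob_space)
      qed
    qed
  qed
  then show ?thesis by (simp add: D_def)
qed

text \<open>Times \<open>\<eta>\<close>, the transform is the mean of \<open>h (T t)\<close> at an
  independent exponential time of rate \<open>\<eta>\<close>, that is, the mean of \<open>h\<close>
  under the exponential law of rate \<open>\<Phi> \<eta>\<close>. The two densities account for the
  quotient \<open>\<Phi> \<eta> / \<eta>\<close>.\<close>

lemma laplace_T:
  fixes h :: "real \<Rightarrow> real"
  assumes \<eta>: "0 < \<eta>" and hm[measurable]: "h \<in> borel_measurable borel" and C: "\<And>s. \<bar>h s\<bar> \<le> C"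
  shows "laplace_at (\<lambda>t. if t < 0 then 0 else (\<integral>\<omega>. h (T t \<omega>) \<partial>M)) \<eta>
    (\<Phi> \<eta> / \<eta> * (\<integral>s. exp (- (\<Phi> \<eta> * s)) * (heaviside s * h s) \<partial>lborel))"
proof -
  define D where "D = density lborel (exponential_density \<eta>)"
  interpret D: prob_space D unfolding D_def by (rule prob_space_exponential_density) fact
  interpret Q: pair_prob_space M D ..
  have D_sets[measurable_cong]: "sets D = sets borel" by (simp add: D_def)
  have Tm'[measurable]: "(\<lambda>x. T (max 0 (fst x)) (snd x)) \<in> borel_measurable (borel \<Otimes>\<^sub>M M)"
    using T_joint_measurable by (simp add: case_prod_beta)
  have Tm[measurable]: "(\<lambda>(\<omega>, t). T (max 0 t) \<omega>) \<in> borel_measurable (M \<Otimes>\<^sub>M D)"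
  proof -
    have "(\<lambda>x. (snd x, fst x)) \<in> measurable (M \<Otimes>\<^sub>M D) (borel \<Otimes>\<^sub>M M)" by measurable
    from measurable_compose[OF this T_joint_measurable] show ?thesis by (simp add: case_prod_beta)
  qed
  have Hm[measurable]: "(\<lambda>t. \<integral>\<omega>. h (T (max 0 t) \<omega>) \<partial>M) \<in> borel_measurable borel"
  proof -
    have "(\<lambda>(t, \<omega>). h (T (max 0 t) \<omega>)) \<in> borel_measurable (borel \<Otimes>\<^sub>M M)"
      using measurable_compose[OF T_joint_measurable hm] by (simp add: case_prod_beta)
    then show ?thesis by (rule borel_measurable_lebesgue_integral)
  qed
  let ?H = "\<lambda>t. if t < 0 then 0 else (\<integral>\<omega>. h (T t \<omega>) \<partial>M)"
  have HH: "?H t = heaviside t * (\<integral>\<omega>. h (T (max 0 t) \<omega>) \<partial>M)" for t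
    by (simp add: heaviside_def max_absorb2)
  have [measurable]: "heaviside \<in> borel_measurable borel"
    unfolding heaviside_def[abs_def] by measurable
  have "(\<integral>s. h s \<partial>density lborel (exponential_density (\<Phi> \<eta>))) = (\<integral>x. h (case x of (\<omega>, t) \<Rightarrow> T (max 0 t) \<omega>) \<partial>(M \<Otimes>\<^sub>M D))"
    unfolding distr_T_exponential[OF \<eta>, symmetric] D_def[symmetric] by (subst integral_distr) measurable
  also have "\<dots> = (\<integral>t. (\<integral>\<omega>. h (T (max 0 t) \<omega>) \<partial>M) \<partial>D)"
  proof -
    have "integrable (M \<Otimes>\<^sub>M D) (case_prod (\<lambda>\<omega> t. h (T (max 0 t) \<omega>)))"
    proof (rule Q.P.integrable_const_bound[of _ C])
      show "case_prod (\<lambda>\<omega> t. h (T (max 0 t) \<omega>)) \<in> borel_measurable (M \<Otimes>\<^sub>M D)"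
        using measurable_compose[OF Tm hm] by (simp add: case_prod_beta)
    qed (simp add: C case_prod_beta)
    moreover have "(\<lambda>x. h (case x of (\<omega>, t) \<Rightarrow> T (max 0 t) \<omega>)) = case_prod (\<lambda>\<omega> t. h (T (max 0 t) \<omega>))"
      by (auto simp: fun_eq_iff)
    ultimately show ?thesis using Q.integral_snd[of "\<lambda>\<omega> t. h (T (max 0 t) \<omega>)"] by simp
  qed
  also have "\<dots> = (\<integral>t. exponential_density \<eta> t * (\<integral>\<omega>. h (T (max 0 t) \<omega>) \<partial>M) \<partial>lborel)"
    unfolding D_def using \<eta> by (subst integral_density) (auto simp: erlang_density_nonneg)
  also have "\<dots> = (\<integral>t. \<eta> * (exp (- (\<eta> * t)) * ?H t) \<partial>lborel)"
    unfolding exponential_density_eq HH by (simp only: mult.assoc)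
  also have "\<dots> = \<eta> * (\<integral>t. exp (- (\<eta> * t)) * ?H t \<partial>lborel)"
    by (rule integral_mult_right_zero)
  finally have 1: "\<eta> * (\<integral>t. exp (- (\<eta> * t)) * ?H t \<partial>lborel) = (\<integral>s. h s \<partial>density lborel (exponential_density (\<Phi> \<eta>)))" ..
  have "(\<integral>s. h s \<partial>density lborel (exponential_density (\<Phi> \<eta>))) = (\<integral>s. exponential_density (\<Phi> \<eta>) s * h s \<partial>lborel)"
    using \<Phi>_pos[OF \<eta>] by (subst integral_density) (auto simp: erlang_density_nonneg)
  also have "\<dots> = (\<integral>s. \<Phi> \<eta> * (exp (- (\<Phi> \<eta> * s)) * (heaviside s * h s)) \<partial>lborel)"
    unfolding exponential_density_eq by (simp only: mult.assoc)
  also have "\<dots> = \<Phi> \<eta> * (\<integral>s. exp (- (\<Phi> \<eta> * s)) * (heaviside s * h s) \<partial>lborel)"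
    by (rule integral_mult_right_zero)
  finally have "(\<integral>t. exp (- (\<eta> * t)) * ?H t \<partial>lborel) = \<Phi> \<eta> / \<eta> * (\<integral>s. exp (- (\<Phi> \<eta> * s)) * (heaviside s * h s) \<partial>lborel)"
    using 1 \<eta> by (simp add: field_simps)
  moreover have "integrable lborel (\<lambda>t. exp (- (\<eta> * t)) * ?H t)"
  proof (rule laplace_bounded[of _ C])
    show "?H \<in> borel_measurable borel" unfolding HH by measurable
    have C0: "0 \<le> C" using C[of 0] by simp
    show "\<bar>?H t\<bar> \<le> C" for t
    proof (cases "t < 0")
      case False
      have "\<bar>\<integral>\<omega>. h (T t \<omega>) \<partial>M\<bar> \<le> (\<integral>\<omega>. \<bar>h (T t \<omega>)\<bar> \<partial>M)" by (rule integral_abs_bound)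
      also have "\<dots> \<le> C" using C C0 T_measurable'[of t] False
        by (intro integral_le_const integrable_abs integrable_const_bound[of _ C]) auto
      finally show ?thesis using False by simp
    qed (use C0 in simp)
  qed (use \<eta> in auto)
  ultimately show ?thesis by (simp add: has_bochner_integral_iff)
qed

lemma expectation_T_right_continuous:
  assumes h: "\<And>s. isCont h s" and C: "\<And>s. \<bar>h s\<bar> \<le> (C::real)" and t: "0 \<le> t"
  shows "((\<lambda>t. \<integral>\<omega>. h (T t \<omega>) \<partial>M) \<longlongrightarrow> (\<integral>\<omega>. h (T t \<omega>) \<partial>M)) (at_right t)"
  unfolding tendsto_at_iff_sequentially comp_def
proof (intro allI impI)
  have [measurable]: "h \<in> borel_measurable borel"
    using h by (intro borel_measurable_continuous_onI continuous_at_imp_continuous_on) auto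
  fix x assume x: "\<forall>i. x i \<in> {t<..} - {t}" "x \<longlonglongrightarrow> t"
  then have [measurable]: "T (x n) \<in> borel_measurable M" for n using t by (intro T_measurable) (auto intro: le_less_trans)
  have [measurable]: "T t \<in> borel_measurable M" by (rule T_measurable'[OF t])
  show "(\<lambda>n. \<integral>\<omega>. h (T (x n) \<omega>) \<partial>M) \<longlonglongrightarrow> (\<integral>\<omega>. h (T t \<omega>) \<partial>M)"
  proof (rule integral_dominated_convergence[where w="\<lambda>_. C"])
    show "AE \<omega> in M. (\<lambda>n. h (T (x n) \<omega>)) \<longlonglongrightarrow> h (T t \<omega>)"
    proof (intro AE_I2 isCont_tendsto_compose[OF h])
      fix \<omega>
      show "(\<lambda>n. T (x n) \<omega>) \<longlonglongrightarrow> T t \<omega>"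
        using T_right_continuous[of \<omega> t] x unfolding tendsto_at_iff_sequentially comp_def by blast
    qed
  qed (use C in auto)
qed

lemma expectation_T_isCont:
  assumes h: "\<And>s. isCont h s" and C: "\<And>s. \<bar>h s\<bar> \<le> (C::real)" and t: "0 < t" and b: "0 < b"
  shows "isCont (\<lambda>t. \<integral>\<omega>. h (T t \<omega>) \<partial>M) t"
proof -
  have [measurable]: "h \<in> borel_measurable borel"
    using h by (intro borel_measurable_continuous_onI continuous_at_imp_continuous_on) auto
  have [measurable]: "(\<lambda>\<omega>. T (max 0 s) \<omega>) \<in> borel_measurable M" for s by (rule T_measurable') simp
  \<comment> \<open>A sequence tending to \<open>t\<close> may begin with negative times;
    \<open>max 0\<close> keeps every term measurable and changes nothing near
    \<open>t\<close>.\<close>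
  have "isCont (\<lambda>t. \<integral>\<omega>. h (T (max 0 t) \<omega>) \<partial>M) t"
    unfolding continuous_at_sequentially comp_def
  proof (intro allI impI)
    fix x assume x: "x \<longlonglongrightarrow> t"
    then have "(\<lambda>n. max 0 (x n)) \<longlonglongrightarrow> max 0 t" by (intro tendsto_intros)
    then have x': "(\<lambda>n. max 0 (x n)) \<longlonglongrightarrow> t" using t by simp
    show "(\<lambda>n. \<integral>\<omega>. h (T (max 0 (x n)) \<omega>) \<partial>M) \<longlonglongrightarrow> (\<integral>\<omega>. h (T (max 0 t) \<omega>) \<partial>M)"
    proof (rule integral_dominated_convergence[where w="\<lambda>_. C"])
      show "AE \<omega> in M. (\<lambda>n. h (T (max 0 (x n)) \<omega>)) \<longlonglongrightarrow> h (T (max 0 t) \<omega>)"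
        using T_isCont[OF b]
      proof eventually_elim
        case (elim \<omega>)
        then have "(\<lambda>n. T (max 0 (x n)) \<omega>) \<longlonglongrightarrow> T t \<omega>"
          using t x' isCont_tendsto_compose[of t "\<lambda>s. T s \<omega>"] by blast
        then show ?case using t isCont_tendsto_compose[OF h] by simp
      qed
    qed (use C in auto)
  qed
  moreover have "\<forall>\<^sub>F s in nhds t. (\<integral>\<omega>. h (T (max 0 s) \<omega>) \<partial>M) = (\<integral>\<omega>. h (T s \<omega>) \<partial>M)"
    using eventually_nhds_in_open[of "{0<..}" t] t by (auto elim!: eventually_mono)
  ultimately show ?thesis by (rule isCont_cong[THEN iffD1, rotated])
qed

end

section \<open>The Levy process\<close>

lemma cnj_levy_symbol: "cnj (levy_symbol c m \<xi>) = levy_symbol c m (- \<xi>)"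
  unfolding levy_symbol_def
  by (simp add: Bochner_Integration.integral_cnj[symmetric] exp_cnj del: Bochner_Integration.integral_cnj)

text \<open>Small jumps: second-order Taylor remainder \<open>(\<xi> * y)^2 / 2\<close>. Large
  jumps: two unimodular terms, hence the constant 2.\<close>

lemma norm_iexp_diff_le:
  "norm (iexp (\<xi> * y) - 1 - \<i> * complex_of_real (\<xi> * y * indicator {-1..1} y)) \<le> (2 + \<xi>\<^sup>2) * min (y\<^sup>2) 1"
proof (cases "\<bar>y\<bar> \<le> 1")
  case True
  have "norm (iexp (\<xi> * y) - (\<Sum>k\<le>1. (\<i> * complex_of_real (\<xi> * y)) ^ k / fact k)) \<le> \<bar>\<xi> * y\<bar> ^ Suc 1 / fact (Suc 1)"
    by (rule iexp_approx1)
  then have "norm (iexp (\<xi> * y) - 1 - \<i> * complex_of_real (\<xi> * y)) \<le> (\<xi> * y)\<^sup>2 / 2"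
    by (simp add: diff_diff_eq numeral_2_eq_2)
  also have "\<dots> \<le> (2 + \<xi>\<^sup>2) * y\<^sup>2"
    by (simp add: power_mult_distrib algebra_simps add_nonneg_nonneg)
  finally show ?thesis using True by (simp add: abs_le_iff min_absorb1 abs_square_le_1 indicator_def)
next
  case False
  have "norm (iexp (\<xi> * y) - 1) \<le> norm (iexp (\<xi> * y)) + norm (1::complex)" by (rule norm_triangle_ineq4)
  also have "\<dots> \<le> 2 + \<xi>\<^sup>2" by simp
  finally have "norm (iexp (\<xi> * y) - 1) \<le> 2 + \<xi>\<^sup>2" .
  moreover have "min (y\<^sup>2) 1 = 1" using False abs_square_le_1[of y] by (simp add: min_def)
  moreover have "indicator {-1..1} y = (0::real)" using False by (auto simp: indicator_def)
  ultimately show ?thesis by simp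
qed

text \<open>Quadratic growth, which the decay of a test function's transform absorbs; it makes the
  multiplier integral of the generator absolutely convergent.\<close>

lemma levy_symbol_bound:
  assumes "is_levy_measure m"
  obtains K where "\<And>\<xi>. norm (levy_symbol c m \<xi>) \<le> K * (1 + \<xi>\<^sup>2)"
proof -
  have [measurable_cong]: "sets m = sets borel" using assms by (simp add: is_levy_measure_def)
  have i: "integrable m (\<lambda>y. min (y\<^sup>2) 1)"
    using assms by (intro integrableI_nonneg) (auto simp: is_levy_measure_def)
  define J where "J = (\<integral>y. min (y\<^sup>2) 1 \<partial>m)"
  have J: "0 \<le> J" by (simp add: J_def)
  have int: "norm (\<integral>y. (iexp (\<xi> * y) - 1 - \<i> * complex_of_real (\<xi> * y * indicator {-1..1} y)) \<partial>m) \<le> (2 + \<xi>\<^sup>2) * J" for \<xi>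
  proof -
    let ?f = "\<lambda>y. iexp (\<xi> * y) - 1 - \<i> * complex_of_real (\<xi> * y * indicator {-1..1} y)"
    have f: "integrable m ?f"
    proof (rule Bochner_Integration.integrable_bound[OF integrable_mult_right[OF i, of "2 + \<xi>\<^sup>2"]])
      show "AE y in m. norm (?f y) \<le> norm ((2 + \<xi>\<^sup>2) * min (y\<^sup>2) 1)"
        unfolding real_norm_def by (intro AE_I2 order_trans[OF norm_iexp_diff_le abs_ge_self])
    qed measurable
    have "norm (\<integral>y. ?f y \<partial>m) \<le> (\<integral>y. norm (?f y) \<partial>m)" by (rule integral_norm_bound)
    also have "\<dots> \<le> (\<integral>y. (2 + \<xi>\<^sup>2) * min (y\<^sup>2) 1 \<partial>m)"
      by (intro integral_mono integrable_norm f integrable_mult_right i norm_iexp_diff_le)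
    finally show ?thesis by (simp add: J_def)
  qed
  have "norm (levy_symbol c m \<xi>) \<le> (\<bar>c\<bar> + 1 + 2 * J) * (1 + \<xi>\<^sup>2)" for \<xi>
  proof -
    have x: "\<bar>\<xi>\<bar> \<le> 1 + \<xi>\<^sup>2"
    proof -
      have "0 \<le> (\<bar>\<xi>\<bar> - 1)\<^sup>2" by simp
      then show ?thesis by (simp add: power2_eq_square algebra_simps abs_mult_self_eq)
    qed
    have "norm (levy_symbol c m \<xi>) \<le> norm (\<i> * complex_of_real (c * \<xi>)) + norm (complex_of_real (\<xi>\<^sup>2 / 2)) + (2 + \<xi>\<^sup>2) * J"
      unfolding levy_symbol_def
      by (rule order_trans[OF norm_triangle_ineq4 add_mono[OF norm_triangle_ineq int]])
    also have "\<dots> = \<bar>c\<bar> * \<bar>\<xi>\<bar> + \<xi>\<^sup>2 / 2 + (2 + \<xi>\<^sup>2) * J"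
      by (simp add: norm_mult abs_mult norm_divide norm_power)
    also have "\<dots> \<le> \<bar>c\<bar> * (1 + \<xi>\<^sup>2) + (1 + \<xi>\<^sup>2) + (2 * (1 + \<xi>\<^sup>2)) * J"
      using x J by (intro add_mono mult_left_mono mult_right_mono) auto
    finally show ?thesis by (simp add: algebra_simps)
  qed
  then show thesis by (rule that)
qed

lemma has_bochner_integral_exp_complex:
  fixes z :: complex
  assumes z: "0 < Re z"
  shows "has_bochner_integral lborel (\<lambda>s. heaviside s *\<^sub>R exp (- (complex_of_real s * z))) (1 / z)"
proof -
  let ?f = "\<lambda>s. exp (- (complex_of_real s * z))"
  have nf: "norm (?f s) = exp (- (s * Re z))" for s by simp
  have z0: "z \<noteq> 0" using z by auto
  have si: "set_integrable lborel {0<..} ?f"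
    unfolding set_integrable_def
  proof (rule Bochner_Integration.integrable_bound)
    show "integrable lborel (\<lambda>x. indicator {0<..} x *\<^sub>R exp (- (x * Re z)))"
      using integrable_I0i_exp_mscale[OF z] by (simp add: set_integrable_def)
  qed (auto simp: nf)
  have "(LBINT s=0..\<infinity>. ?f s) = 0 - (- 1 / z)"
  proof (rule interval_integral_FTC_integrable[where F="\<lambda>s. - ?f s / z"])
    show "((\<lambda>s. - ?f s / z) has_vector_derivative ?f x) (at x)" for x
      using z0 by (intro has_vector_derivative_real_field[of "\<lambda>s. - exp (- (s * z)) / z"])
        (auto intro!: derivative_eq_intros)
    show "set_integrable lborel (einterval 0 \<infinity>) ?f"
      using si by (simp add: einterval_def greaterThan_def)
    show "(((\<lambda>s. - ?f s / z) \<circ> real_of_ereal) \<longlongrightarrow> - 1 / z) (at_right 0)"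
      using z0 unfolding zero_ereal_def ereal_tendsto_simps
      by (auto intro!: tendsto_eq_intros)
    have "((\<lambda>s. exp (- (s * Re z))) \<longlongrightarrow> 0) at_top"
      using z by (intro filterlim_compose[OF exp_at_bot])
        (auto simp: filterlim_uminus_at_bot intro!: filterlim_at_top_mult_tendsto_pos[OF tendsto_const] filterlim_ident)
    then have "(?f \<longlongrightarrow> 0) at_top" by (subst tendsto_norm_zero_iff[symmetric]) (simp add: nf)
    then have "((\<lambda>s. - ?f s / z) \<longlongrightarrow> - 0 / z) at_top" using z0 by (intro tendsto_intros) auto
    then show "(((\<lambda>s. - ?f s / z) \<circ> real_of_ereal) \<longlongrightarrow> 0) (at_left \<infinity>)"
      unfolding ereal_tendsto_simps by simp
  qed (auto intro!: continuous_intros)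
  then have "has_bochner_integral lborel (\<lambda>s. indicator {0<..} s *\<^sub>R ?f s) (1 / z)"
    using si by (simp add: has_bochner_integral_iff interval_lebesgue_integral_0_infty set_lebesgue_integral_def set_integrable_def)
  then show ?thesis
    by (rule has_bochner_integral_cong_AE[THEN iffD1, rotated -1])
      (use AE_lborel_singleton[of 0] in \<open>auto simp: heaviside_def[abs_def] split: split_indicator\<close>)
qed

locale levy_motion = prob_space M
  for M :: "'a measure" +
  fixes X :: "real \<Rightarrow> 'a \<Rightarrow> real" and m :: "real measure" and c :: real and \<Psi> :: "real \<Rightarrow> complex"
  assumes m: "is_levy_measure m" and \<Psi>: "\<Psi> = levy_symbol c m"
    and X: "levy_process M X"
    and char_X: "\<And>t \<mu>. 0 < t \<Longrightarrow> char (distr M borel (X t)) \<mu> = exp (- (complex_of_real t * \<Psi> \<mu>))"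
begin

lemma X_measurable: "0 \<le> t \<Longrightarrow> X t \<in> borel_measurable M"
  using X by (simp add: levy_process_def)

lemma X_start: "\<omega> \<in> space M \<Longrightarrow> X 0 \<omega> = 0"
  using X by (simp add: levy_process_def)

lemma expectation_iexp:
  assumes t: "0 \<le> t"
  shows "(\<integral>\<omega>. iexp (\<mu> * X t \<omega>) \<partial>M) = exp (- (complex_of_real t * \<Psi> \<mu>))"
proof (cases "t = 0")
  case True
  have "(\<integral>\<omega>. iexp (\<mu> * X t \<omega>) \<partial>M) = (\<integral>\<omega>. 1 \<partial>M)"
    using True by (intro Bochner_Integration.integral_cong) (auto simp: X_start)
  then show ?thesis using True by (simp add: prob_space)
next
  case False
  then show ?thesis using char_X[of t \<mu>] t X_measurable[OF t] unfolding char_def by (simp add: integral_distr)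
qed

text \<open>A characteristic function is bounded by 1, and \<open>exp (- \<Psi> \<mu>)\<close> has
  modulus \<open>exp (- Re (\<Psi> \<mu>))\<close>.\<close>

lemma Re_\<Psi>_nonneg: "0 \<le> Re (\<Psi> \<mu>)"
proof -
  have X1: "X 1 \<in> borel_measurable M" by (rule X_measurable) simp
  interpret X1: prob_space "distr M borel (X 1)" by (rule prob_space_distr) (rule X1)
  have "real_distribution (distr M borel (X 1))"
    using X1.prob_space_axioms by (simp add: real_distribution_def real_distribution_axioms_def)
  then have "norm (char (distr M borel (X 1)) \<mu>) \<le> 1" by (rule real_distribution.cmod_char_le_1)
  then show ?thesis using char_X[of 1 \<mu>] by simp
qed

text \<open>Measurability of a parameter integral against \<open>m\<close> would call for
  \<sigma>-finiteness. Instead \<open>\<Psi>\<close> is obtained as a limit of measurable functions,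
  from difference quotients at 0 of \<open>exp (- w * \<Psi> \<mu>)\<close>, that is, of the
  characteristic functions of \<open>X (1 / n)\<close>.\<close>

lemma \<Psi>_measurable [measurable]: "\<Psi> \<in> borel_measurable borel"
proof -
  let ?u = "\<lambda>n \<mu>. - (char (distr M borel (X (1 / real (Suc n)))) \<mu> - 1) * of_nat (Suc n)"
  have lim: "(\<lambda>n. ?u n \<mu>) \<longlonglongrightarrow> \<Psi> \<mu>" for \<mu>
  proof -
    have "((\<lambda>w. exp (- (w * \<Psi> \<mu>))) has_field_derivative - \<Psi> \<mu>) (at 0)"
      by (auto intro!: derivative_eq_intros)
    then have "((\<lambda>w. (exp (- (w * \<Psi> \<mu>)) - 1) / w) \<longlongrightarrow> - \<Psi> \<mu>) (at 0)"
      by (simp add: has_field_derivative_iff)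
    moreover have "filterlim (\<lambda>n. complex_of_real (1 / real (Suc n))) (at 0) sequentially"
      unfolding filterlim_at
      using tendsto_of_real[OF LIMSEQ_Suc[OF lim_1_over_n], where 'a=complex] by (simp del: of_nat_Suc)
    ultimately have "(\<lambda>n. (exp (- (complex_of_real (1 / real (Suc n)) * \<Psi> \<mu>)) - 1) / complex_of_real (1 / real (Suc n))) \<longlonglongrightarrow> - \<Psi> \<mu>"
      by (rule filterlim_compose)
    from tendsto_minus[OF this] show ?thesis using char_X[of "1 / real (Suc _)" \<mu>] by (simp add: field_simps)
  qed
  show ?thesis
  proof (rule borel_measurable_LIMSEQ_metric[OF _ lim])
    fix n
    have Xn: "X (1 / real (Suc n)) \<in> borel_measurable M" by (rule X_measurable) simp
    interpret Xn: prob_space "distr M borel (X (1 / real (Suc n)))" by (rule prob_space_distr) (rule Xn)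
    have [measurable]: "char (distr M borel (X (1 / real (Suc n)))) \<in> borel_measurable borel"
      unfolding char_def by measurable
    show "?u n \<in> borel_measurable borel" by measurable
  qed
qed

lemma \<Psi>_cnj: "cnj (\<Psi> \<xi>) = \<Psi> (- \<xi>)"
  unfolding \<Psi> by (rule cnj_levy_symbol)

lemma norm_exp_\<Psi>_le: "0 \<le> s \<Longrightarrow> norm (exp (- (complex_of_real s * \<Psi> \<mu>))) \<le> 1"
  using Re_\<Psi>_nonneg[of \<mu>] by simp

text \<open>Up to \<open>1 / (2 pi)\<close>, the mean at \<open>X s\<close> of the function with
  Fourier transform \<open>p\<close>. The argument is \<open>- \<xi>\<close> because the inversion
  kernel is \<open>exp (- \<i> \<xi> x)\<close>; \<open>max 0\<close> extends it by a constant to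
  negative times, so that it is continuous on the whole line.\<close>

definition semigroup_integral :: "(real \<Rightarrow> complex) \<Rightarrow> real \<Rightarrow> complex" where
  "semigroup_integral p s = (\<integral>\<xi>. p \<xi> * exp (- (complex_of_real (max 0 s) * \<Psi> (- \<xi>))) \<partial>lborel)"

lemma expectation_inverse_fourier:
  assumes p: "integrable lborel p" and s: "0 \<le> s"
  shows "(\<integral>\<omega>. (\<integral>\<xi>. iexp (- (\<xi> * X s \<omega>)) * p \<xi> \<partial>lborel) \<partial>M) = semigroup_integral p s"
proof -
  interpret P: pair_sigma_finite lborel M ..
  note [measurable] = borel_measurable_integrable[OF p] X_measurable[OF s]
  have "integrable (lborel \<Otimes>\<^sub>M M) (\<lambda>(\<xi>, \<omega>). iexp (- (\<xi> * X s \<omega>)) * p \<xi>)"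
  proof (rule P.Fubini_integrable)
    show "integrable lborel (\<lambda>\<xi>. \<integral>\<omega>. norm (case (\<xi>, \<omega>) of (\<xi>, \<omega>) \<Rightarrow> iexp (- (\<xi> * X s \<omega>)) * p \<xi>) \<partial>M)"
      using p by (simp add: norm_mult prob_space)
    show "AE \<xi> in lborel. integrable M (\<lambda>\<omega>. case (\<xi>, \<omega>) of (\<xi>, \<omega>) \<Rightarrow> iexp (- (\<xi> * X s \<omega>)) * p \<xi>)"
    proof (intro AE_I2)
      fix \<xi> :: real
      show "integrable M (\<lambda>\<omega>. case (\<xi>, \<omega>) of (\<xi>, \<omega>) \<Rightarrow> iexp (- (\<xi> * X s \<omega>)) * p \<xi>)"
        by (rule integrable_const_bound[of _ "norm (p \<xi>)"]) (auto simp: norm_mult)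
    qed
  qed measurable
  then have "(\<integral>\<omega>. (\<integral>\<xi>. iexp (- (\<xi> * X s \<omega>)) * p \<xi> \<partial>lborel) \<partial>M) = (\<integral>\<xi>. (\<integral>\<omega>. iexp (- (\<xi> * X s \<omega>)) * p \<xi> \<partial>M) \<partial>lborel)"
    using P.Fubini_integral[of "\<lambda>\<xi> \<omega>. iexp (- (\<xi> * X s \<omega>)) * p \<xi>"] by simp
  also have "\<dots> = (\<integral>\<xi>. (\<integral>\<omega>. iexp (- \<xi> * X s \<omega>) \<partial>M) * p \<xi> \<partial>lborel)"
    by simp
  also have "\<dots> = semigroup_integral p s"
    unfolding expectation_iexp[OF s] semigroup_integral_def using s by (simp add: max_absorb2 mult.commute)
  finally show ?thesis .
qed

lemma isCont_semigroup_integral: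
  assumes p: "integrable lborel p"
  shows "isCont (semigroup_integral p) s"
  unfolding continuous_at_sequentially comp_def
proof (intro allI impI)
  fix x assume x: "x \<longlonglongrightarrow> s"
  note [measurable] = borel_measurable_integrable[OF p]
  show "(\<lambda>n. semigroup_integral p (x n)) \<longlonglongrightarrow> semigroup_integral p s"
    unfolding semigroup_integral_def
  proof (rule integral_dominated_convergence[where w="\<lambda>\<xi>. norm (p \<xi>)"])
    show "AE \<xi> in lborel. (\<lambda>n. p \<xi> * exp (- (complex_of_real (max 0 (x n)) * \<Psi> (- \<xi>))))
        \<longlonglongrightarrow> p \<xi> * exp (- (complex_of_real (max 0 s) * \<Psi> (- \<xi>)))"
      using x by (intro AE_I2 tendsto_intros)
    show "AE \<xi> in lborel. norm (p \<xi> * exp (- (complex_of_real (max 0 (x n)) * \<Psi> (- \<xi>)))) \<le> norm (p \<xi>)" for n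
      unfolding norm_mult by (intro AE_I2 mult_left_le norm_exp_\<Psi>_le) auto
  qed (use p in simp_all)
qed

text \<open>Fubini, and the elementary integral of
  \<open>exp (- s (\<theta> + \<Psi>(- \<xi>)))\<close>, whose exponent is damped because
  \<open>\<Psi>\<close> has nonnegative real part.\<close>

lemma laplace_semigroup_integral:
  assumes p: "integrable lborel p" and \<theta>: "0 < \<theta>"
  shows "(\<integral>s. complex_of_real (exp (- (\<theta> * s)) * heaviside s) * semigroup_integral p s \<partial>lborel)
    = (\<integral>\<xi>. p \<xi> / (\<theta> + \<Psi> (- \<xi>)) \<partial>lborel)"
proof -
  note [measurable] = borel_measurable_integrable[OF p]
  have [measurable]: "heaviside \<in> borel_measurable borel"
    unfolding heaviside_def[abs_def] by measurable
  let ?f = "\<lambda>s \<xi>. complex_of_real (exp (- (\<theta> * s)) * heaviside s) * (p \<xi> * exp (- (complex_of_real (max 0 s) * \<Psi> (- \<xi>))))"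
  have hi: "integrable lborel (\<lambda>s. exp (- (\<theta> * s)) * heaviside s)"
    using laplace_heaviside[OF \<theta>] by (simp add: has_bochner_integral_iff)
  have bound: "norm (?f s \<xi>) \<le> exp (- (\<theta> * s)) * heaviside s * norm (p \<xi>)" for s \<xi>
    using norm_exp_\<Psi>_le[of "max 0 s" "- \<xi>"]
    by (auto simp: norm_mult heaviside_def intro!: mult_left_le)
  have "integrable (lborel \<Otimes>\<^sub>M lborel) (\<lambda>(s, \<xi>). ?f s \<xi>)"
  proof (rule Bochner_Integration.integrable_bound)
    show "integrable (lborel \<Otimes>\<^sub>M lborel) (\<lambda>(s, \<xi>). exp (- (\<theta> * s)) * heaviside s * norm (p \<xi>))"
    proof (rule lborel_pair.Fubini_integrable)
      show "integrable lborel (\<lambda>s. \<integral>\<xi>. norm (case (s, \<xi>) of (s, \<xi>) \<Rightarrow> exp (- (\<theta> * s)) * heaviside s * norm (p \<xi>)) \<partial>lborel)"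
        using integrable_norm[OF hi] by (simp add: abs_mult)
      show "AE s in lborel. integrable lborel (\<lambda>\<xi>. case (s, \<xi>) of (s, \<xi>) \<Rightarrow> exp (- (\<theta> * s)) * heaviside s * norm (p \<xi>))"
        using p by simp
    qed measurable
    show "AE x in lborel \<Otimes>\<^sub>M lborel. norm (case x of (s, \<xi>) \<Rightarrow> ?f s \<xi>)
        \<le> norm (case x of (s, \<xi>) \<Rightarrow> exp (- (\<theta> * s)) * heaviside s * norm (p \<xi>))"
      by (intro AE_I2) (clarsimp simp only: split_paired_all prod.case intro!: order_trans[OF bound], simp)
  qed measurable
  then have "(\<integral>s. (\<integral>\<xi>. ?f s \<xi> \<partial>lborel) \<partial>lborel) = (\<integral>\<xi>. (\<integral>s. ?f s \<xi> \<partial>lborel) \<partial>lborel)"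
    using lborel_pair.Fubini_integral[of ?f] by simp
  moreover have "(\<integral>s. ?f s \<xi> \<partial>lborel) = p \<xi> / (\<theta> + \<Psi> (- \<xi>))" for \<xi>
  proof -
    have "?f s \<xi> = p \<xi> * (heaviside s *\<^sub>R exp (- (complex_of_real s * (\<theta> + \<Psi> (- \<xi>)))))" for s
      by (simp add: heaviside_def scaleR_conv_of_real max_absorb2 exp_of_real[symmetric] algebra_simps flip: exp_add)
    moreover have "has_bochner_integral lborel (\<lambda>s. heaviside s *\<^sub>R exp (- (complex_of_real s * (\<theta> + \<Psi> (- \<xi>))))) (1 / (\<theta> + \<Psi> (- \<xi>)))"
      using \<theta> Re_\<Psi>_nonneg[of "- \<xi>"] by (intro has_bochner_integral_exp_complex) simp
    from has_bochner_integral_mult_right[OF this, of "p \<xi>"]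
    have "has_bochner_integral lborel (\<lambda>s. p \<xi> * (heaviside s *\<^sub>R exp (- (complex_of_real s * (\<theta> + \<Psi> (- \<xi>)))))) (p \<xi> / (\<theta> + \<Psi> (- \<xi>)))"
      by simp
    ultimately show ?thesis by (simp add: has_bochner_integral_iff)
  qed
  ultimately show ?thesis unfolding semigroup_integral_def by simp
qed

end

section \<open>The time-changed process\<close>

locale time_changed_levy =
  clock M N A B b \<beta> \<gamma> lam + levy_motion M X m c \<Psi>
  for M :: "'a measure" and N A B b \<beta> \<gamma> lam X m c \<Psi> +
  assumes indep_T: "indep_time M X (hitting_time N A b B)"
begin

abbreviation subalg_X :: "'a measure" where
  "subalg_X \<equiv> vimage_algebra (space M) (\<lambda>\<omega>. \<lambda>t\<in>{0..}. X t \<omega>) (PiM {0..} (\<lambda>_. borel))"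

abbreviation subalg_T :: "'a measure" where
  "subalg_T \<equiv> vimage_algebra (space M) (\<lambda>\<omega>. \<lambda>t\<in>{0<..}. hitting_time N A b B t \<omega>) (PiM {0<..} (\<lambda>_. borel))"

lemma indep_X_T: "indep_var subalg_X (\<lambda>\<omega>. \<omega>) subalg_T (\<lambda>\<omega>. \<omega>)"
  using indep_T unfolding indep_time_def by (rule indep_var_vimage_algebra)

lemma X_subalg: "0 \<le> t \<Longrightarrow> X t \<in> borel_measurable subalg_X"
proof -
  assume t: "0 \<le> t"
  have "(\<lambda>\<omega>. \<lambda>t\<in>{0..}. X t \<omega>) \<in> measurable subalg_X (PiM {0..} (\<lambda>_. borel))"
    by (rule measurable_vimage_algebra1) (auto simp: space_PiM PiE_def)
  from measurable_compose[OF this measurable_component_singleton[of t]] t show ?thesis by simp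
qed

lemma T_subalg_pos: "0 < t \<Longrightarrow> hitting_time N A b B t \<in> borel_measurable subalg_T"
proof -
  assume t: "0 < t"
  have "(\<lambda>\<omega>. \<lambda>t\<in>{0<..}. hitting_time N A b B t \<omega>) \<in> measurable subalg_T (PiM {0<..} (\<lambda>_. borel))"
    by (rule measurable_vimage_algebra1) (auto simp: space_PiM PiE_def)
  from measurable_compose[OF this measurable_component_singleton[of t]] t show ?thesis by simp
qed

sublocale measurable_clock M N A B b \<beta> \<gamma> lam
proof
  show "hitting_time N A b B t \<in> borel_measurable M" if "0 < t" for t
    using measurable_compose[OF indep_var_rv2[OF indep_X_T] T_subalg_pos[OF that]] by simp
qed

text \<open>Independence is stated for positive times only; time 0 joins the same \<sigma>-algebra
  as a right limit.\<close>

lemma T_subalg: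
  assumes "0 \<le> t" shows "T t \<in> borel_measurable subalg_T"
proof -
  have "(\<lambda>(t, \<omega>). T (max 0 t) \<omega>) \<in> borel_measurable (borel \<Otimes>\<^sub>M subalg_T)"
    by (intro measurable_right_continuous_process T_subalg_pos T_right_continuous)
  from measurable_compose[OF measurable_Pair1'[of t borel subalg_T] this] assms
  show ?thesis by (simp add: max_absorb2)
qed

lemma X_joint: "(\<lambda>(t, \<omega>). X (max 0 t) \<omega>) \<in> borel_measurable (borel \<Otimes>\<^sub>M subalg_X)"
  by (intro measurable_right_continuous_process X_subalg levy_process_right_continuous[OF X]) auto

lemma X_joint_M: "(\<lambda>(t, \<omega>). X (max 0 t) \<omega>) \<in> borel_measurable (borel \<Otimes>\<^sub>M M)"
  by (intro measurable_right_continuous_process X_measurable levy_process_right_continuous[OF X]) auto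

lemma XT_measurable:
  assumes "0 \<le> t" shows "(\<lambda>\<omega>. X (T t \<omega>) \<omega>) \<in> borel_measurable M"
proof -
  have [measurable]: "T t \<in> borel_measurable M" by (rule T_measurable'[OF assms])
  have "(\<lambda>\<omega>. (T t \<omega>, \<omega>)) \<in> measurable M (borel \<Otimes>\<^sub>M M)" by measurable
  from measurable_compose[OF this X_joint_M] show ?thesis by (simp add: max_absorb2 T_nonneg)
qed

text \<open>Conditioning on the clock: \<open>T t\<close> is held fixed in one copy of the
  probability space while \<open>X\<close> is averaged over the other.\<close>

lemma expectation_XT:
  fixes h :: "real \<Rightarrow> real"
  assumes t: "0 \<le> t" and hm[measurable]: "h \<in> borel_measurable borel" and C: "\<And>s. \<bar>h s\<bar> \<le> C"
  shows "(\<integral>\<omega>. h (X (T t \<omega>) \<omega>) \<partial>M) = (\<integral>\<omega>. (\<integral>\<omega>'. h (X (max 0 (T t \<omega>)) \<omega>') \<partial>M) \<partial>M)"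
proof -
  let ?f = "\<lambda>(\<omega>1, \<omega>2). h (X (max 0 (T t \<omega>2)) \<omega>1)"
  have [measurable]: "T t \<in> borel_measurable subalg_T" by (rule T_subalg[OF t])
  have "(\<lambda>x. (T t (snd x), fst x)) \<in> measurable (subalg_X \<Otimes>\<^sub>M subalg_T) (borel \<Otimes>\<^sub>M subalg_X)" by measurable
  from measurable_compose[OF this X_joint]
  have [measurable]: "(\<lambda>x. X (max 0 (T t (snd x))) (fst x)) \<in> borel_measurable (subalg_X \<Otimes>\<^sub>M subalg_T)" by simp
  have "(\<integral>\<omega>. h (X (T t \<omega>) \<omega>) \<partial>M) = (\<integral>\<omega>. ?f (\<omega>, \<omega>) \<partial>M)"
    by (simp add: max_absorb2 T_nonneg)
  also have "\<dots> = (\<integral>\<omega>2. (\<integral>\<omega>1. ?f (\<omega>1, \<omega>2) \<partial>M) \<partial>M)"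
  proof (rule integral_indep_subalgebras[OF indep_X_T])
    show "?f \<in> borel_measurable (subalg_X \<Otimes>\<^sub>M subalg_T)" unfolding case_prod_beta by measurable
    show "\<bar>?f x\<bar> \<le> C" for x by (simp add: case_prod_beta C)
  qed
  finally show ?thesis by simp
qed

abbreviation u :: "real \<Rightarrow> real measure" where
  "u \<equiv> time_changed_law M X T"

lemma integral_u:
  fixes h :: "real \<Rightarrow> real"
  assumes "0 \<le> t" "h \<in> borel_measurable borel" "\<And>s. \<bar>h s\<bar> \<le> C"
  shows "(\<integral>x. h x \<partial>u t) = (\<integral>\<omega>. (\<integral>\<omega>'. h (X (max 0 (T t \<omega>)) \<omega>') \<partial>M) \<partial>M)"
  unfolding time_changed_law_def
  using integral_distr[OF XT_measurable[OF assms(1)], of h] expectation_XT[OF assms] assms(2) by simp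

lemma u_eq_delta:
  assumes "(\<lambda>\<omega>. X (T t \<omega>) \<omega>) \<in> borel_measurable M" "AE \<omega> in M. T t \<omega> = 0"
  shows "u t = return borel 0"
proof -
  have "u t = distr M borel (\<lambda>_. 0)"
    unfolding time_changed_law_def using assms(2) AE_space
    by (intro distr_cong_AE assms(1) refl) (auto simp: X_start elim: eventually_elim2)
  also have "\<dots> = return borel 0"
    by (rule measure_eqI) (auto simp: emeasure_distr emeasure_space_1 indicator_def)
  finally show ?thesis .
qed

section \<open>The weak equation for a fixed test function\<close>

context
  fixes \<phi> :: "real \<Rightarrow> real"
  assumes \<phi>: "test_function \<phi>"
begin

definition fhat :: "real \<Rightarrow> complex" where "fhat = fourier (\<lambda>x. complex_of_real (\<phi> x))"
text \<open>The Fourier side of the transposed generator applied to \<open>\<phi>\<close>, hence the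
  reflected symbol.\<close>

definition ghat :: "real \<Rightarrow> complex" where "ghat \<xi> = - (\<Psi> (- \<xi>) * fhat \<xi>)"
definition g :: "real \<Rightarrow> real" where "g x = Re (generator (\<lambda>\<xi>. \<Psi> (- \<xi>)) (\<lambda>y. complex_of_real (\<phi> y)) x)"
definition p :: "real \<Rightarrow> real" where "p s = (\<integral>\<omega>. \<phi> (X (max 0 s) \<omega>) \<partial>M)"
definition h :: "real \<Rightarrow> real" where "h s = (\<integral>\<omega>. g (X (max 0 s) \<omega>) \<partial>M)"

lemma integrable_fhat: "integrable lborel fhat"
  using integrable_multiplier_fourier[OF \<phi>, of "\<lambda>_. 1" 1] by (simp add: fhat_def)

lemma integrable_ghat: "integrable lborel ghat"
proof -
  obtain K where K: "\<And>\<xi>. norm (\<Psi> \<xi>) \<le> K * (1 + \<xi>\<^sup>2)"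
    using levy_symbol_bound[OF m, of c] unfolding \<Psi> by blast
  have "integrable lborel (\<lambda>\<xi>. \<Psi> (- \<xi>) * fhat \<xi>)"
    unfolding fhat_def by (rule integrable_multiplier_fourier[OF \<phi>, of _ K]) (use K[of "- _"] in auto)
  then show ?thesis unfolding ghat_def[abs_def] by (rule Bochner_Integration.integrable_minus)
qed

lemma phi_inverse: "complex_of_real (\<phi> x) = 1 / complex_of_real (2 * pi) * (\<integral>\<xi>. iexp (- (\<xi> * x)) * fhat \<xi> \<partial>lborel)"
  unfolding fhat_def by (rule fourier_inversion[OF \<phi>])

lemma generator_eq_g: "generator (\<lambda>\<xi>. \<Psi> (- \<xi>)) (\<lambda>y. complex_of_real (\<phi> y)) x = complex_of_real (g x)"
  using generator_real[OF \<phi>, of "\<lambda>\<xi>. \<Psi> (- \<xi>)" x] \<Psi>_cnj by (simp add: g_def)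

lemma g_inverse: "complex_of_real (g x) = 1 / complex_of_real (2 * pi) * (\<integral>\<xi>. iexp (- (\<xi> * x)) * ghat \<xi> \<partial>lborel)"
  unfolding generator_eq_g[symmetric] generator_def ghat_def fhat_def by (simp add: mult.assoc)

lemma inverse_fourier_bound:
  assumes q: "integrable lborel q"
    and f: "\<And>x. complex_of_real (f x) = 1 / complex_of_real (2 * pi) * (\<integral>\<xi>. iexp (- (\<xi> * x)) * q \<xi> \<partial>lborel)"
  shows "f \<in> borel_measurable borel" and "\<bar>f x\<bar> \<le> (\<integral>\<xi>. norm (q \<xi>) \<partial>lborel)"
proof -
  note [measurable] = borel_measurable_integrable[OF q]
  have "(\<lambda>x. Re (complex_of_real (f x))) \<in> borel_measurable borel"
    unfolding f by measurable
  then show "f \<in> borel_measurable borel" by simp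
  have "norm (\<integral>\<xi>. iexp (- (\<xi> * x)) * q \<xi> \<partial>lborel) \<le> (\<integral>\<xi>. norm (q \<xi>) \<partial>lborel)"
    using integral_norm_bound[of lborel "\<lambda>\<xi>. iexp (- (\<xi> * x)) * q \<xi>"] by (simp add: norm_mult)
  moreover have "\<bar>f x\<bar> = norm (\<integral>\<xi>. iexp (- (\<xi> * x)) * q \<xi> \<partial>lborel) / (2 * pi)"
    using arg_cong[OF f[of x], of norm] by (simp add: norm_mult norm_divide)
  moreover have "a / (2 * pi) \<le> a" if "0 \<le> a" for a :: real
    using that pi_ge_two by (intro divide_le_eq_1[THEN iffD2] mult_imp_div_pos_le) (auto intro: mult_left_mono[of 1 "2 * pi" a, simplified])
  ultimately show "\<bar>f x\<bar> \<le> (\<integral>\<xi>. norm (q \<xi>) \<partial>lborel)"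
    by (metis norm_ge_zero order_trans)
qed

lemma inverse_fourier_semigroup:
  assumes q: "integrable lborel q"
    and f: "\<And>x. complex_of_real (f x) = 1 / complex_of_real (2 * pi) * (\<integral>\<xi>. iexp (- (\<xi> * x)) * q \<xi> \<partial>lborel)"
  shows "complex_of_real (\<integral>\<omega>. f (X (max 0 s) \<omega>) \<partial>M) = 1 / complex_of_real (2 * pi) * semigroup_integral q s"
proof -
  have "complex_of_real (\<integral>\<omega>. f (X (max 0 s) \<omega>) \<partial>M)
      = (\<integral>\<omega>. 1 / complex_of_real (2 * pi) * (\<integral>\<xi>. iexp (- (\<xi> * X (max 0 s) \<omega>)) * q \<xi> \<partial>lborel) \<partial>M)"
    unfolding integral_complex_of_real[symmetric] f ..
  also have "\<dots> = 1 / complex_of_real (2 * pi) * semigroup_integral q (max 0 s)"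
    unfolding integral_mult_right_zero by (subst expectation_inverse_fourier[OF q]) simp_all
  finally show ?thesis by (simp add: semigroup_integral_def)
qed

lemmas p_eq = inverse_fourier_semigroup[OF integrable_fhat phi_inverse, folded p_def]
lemmas h_eq = inverse_fourier_semigroup[OF integrable_ghat g_inverse, folded h_def]
lemmas g_measurable = inverse_fourier_bound(1)[OF integrable_ghat g_inverse]
lemmas g_bound = inverse_fourier_bound(2)[OF integrable_ghat g_inverse]
lemmas phi_measurable = inverse_fourier_bound(1)[OF integrable_fhat phi_inverse]
lemmas phi_bound = inverse_fourier_bound(2)[OF integrable_fhat phi_inverse]

lemma isCont_of_semigroup:
  assumes "\<And>s. complex_of_real (f s) = 1 / complex_of_real (2 * pi) * semigroup_integral q s" "integrable lborel q"
  shows "isCont f s"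
proof -
  have "isCont (\<lambda>s. Re (1 / complex_of_real (2 * pi) * semigroup_integral q s)) s"
    using isCont_semigroup_integral[OF assms(2), of s]
    by (intro isCont_Re continuous_mult continuous_const)
  then show ?thesis unfolding assms(1)[symmetric] by simp
qed

lemmas p_isCont = isCont_of_semigroup[OF p_eq integrable_fhat]
lemmas h_isCont = isCont_of_semigroup[OF h_eq integrable_ghat]

lemma expectation_bound:
  fixes f :: "real \<Rightarrow> real"
  assumes "f \<in> borel_measurable borel" "\<And>x. \<bar>f x\<bar> \<le> C"
  shows "\<bar>\<integral>\<omega>. f (X (max 0 s) \<omega>) \<partial>M\<bar> \<le> C"
proof -
  have [measurable]: "X (max 0 s) \<in> borel_measurable M" by (rule X_measurable) simp
  note [measurable] = assms(1)
  have "\<bar>\<integral>\<omega>. f (X (max 0 s) \<omega>) \<partial>M\<bar> \<le> (\<integral>\<omega>. \<bar>f (X (max 0 s) \<omega>)\<bar> \<partial>M)" by (rule integral_abs_bound)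
  also have "\<dots> \<le> C"
    using assms(2) by (intro integral_le_const integrable_abs integrable_const_bound[of _ C]) auto
  finally show ?thesis .
qed

lemmas p_bound = expectation_bound[OF phi_measurable phi_bound, folded p_def]
lemmas h_bound = expectation_bound[OF g_measurable g_bound, folded h_def]

lemma p_zero: "p 0 = \<phi> 0"
proof -
  have "p 0 = (\<integral>\<omega>. \<phi> 0 \<partial>M)"
    unfolding p_def by (intro Bochner_Integration.integral_cong) (auto simp: X_start)
  then show ?thesis by (simp add: prob_space)
qed

text \<open>The resolvent form of \<open>p' = h\<close>: \<open>\<theta> / (\<theta> + \<Psi>) - 1 = - \<Psi> / (\<theta> + \<Psi>)\<close> under the inverse
  Fourier integral.\<close>

lemma resolvent:
  assumes \<theta>: "0 < \<theta>"
  shows "\<theta> * (\<integral>s. exp (- (\<theta> * s)) * (heaviside s * p s) \<partial>lborel) - \<phi> 0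
    = (\<integral>s. exp (- (\<theta> * s)) * (heaviside s * h s) \<partial>lborel)"
proof -
  have L: "complex_of_real (\<integral>s. exp (- (\<theta> * s)) * (heaviside s * f s) \<partial>lborel)
      = 1 / complex_of_real (2 * pi) * (\<integral>\<xi>. q \<xi> / (\<theta> + \<Psi> (- \<xi>)) \<partial>lborel)"
    if "\<And>s. complex_of_real (f s) = 1 / complex_of_real (2 * pi) * semigroup_integral q s" "integrable lborel q" for f q
  proof -
    have "complex_of_real (\<integral>s. exp (- (\<theta> * s)) * (heaviside s * f s) \<partial>lborel)
        = (\<integral>s. complex_of_real (exp (- (\<theta> * s)) * heaviside s) * complex_of_real (f s) \<partial>lborel)"
      unfolding integral_complex_of_real[symmetric] by (simp add: mult.assoc)
    also have "\<dots> = (\<integral>s. 1 / complex_of_real (2 * pi) * (complex_of_real (exp (- (\<theta> * s)) * heaviside s) * semigroup_integral q s) \<partial>lborel)"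
      unfolding that(1) by (simp only: mult_ac)
    also have "\<dots> = 1 / complex_of_real (2 * pi) * (\<integral>\<xi>. q \<xi> / (\<theta> + \<Psi> (- \<xi>)) \<partial>lborel)"
      unfolding integral_mult_right_zero laplace_semigroup_integral[OF that(2) \<theta>] ..
    finally show ?thesis .
  qed
  have nz: "complex_of_real \<theta> + \<Psi> \<xi> \<noteq> 0" for \<xi>
    using Re_\<Psi>_nonneg[of \<xi>] \<theta> by (auto simp: complex_eq_iff)
  have quot: "integrable lborel (\<lambda>\<xi>. q \<xi> / (\<theta> + \<Psi> (- \<xi>)))" if q: "integrable lborel q" for q :: "real \<Rightarrow> complex"
  proof (rule Bochner_Integration.integrable_bound)
    note [measurable] = borel_measurable_integrable[OF q]
    show "integrable lborel (\<lambda>\<xi>. norm (q \<xi>) / \<theta>)" using q by simp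
    show "(\<lambda>\<xi>. q \<xi> / (\<theta> + \<Psi> (- \<xi>))) \<in> borel_measurable lborel" by measurable
    show "AE \<xi> in lborel. norm (q \<xi> / (\<theta> + \<Psi> (- \<xi>))) \<le> norm (norm (q \<xi>) / \<theta>)"
    proof (intro AE_I2)
      fix \<xi>
      have "\<theta> \<le> Re (\<theta> + \<Psi> (- \<xi>))" using Re_\<Psi>_nonneg[of "- \<xi>"] by simp
      also have "\<dots> \<le> norm (\<theta> + \<Psi> (- \<xi>))" by (rule complex_Re_le_cmod)
      finally show "norm (q \<xi> / (\<theta> + \<Psi> (- \<xi>))) \<le> norm (norm (q \<xi>) / \<theta>)"
        using \<theta> frac_le[of "norm (q \<xi>)" "norm (q \<xi>)" \<theta>] by (simp add: norm_divide)
    qed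
  qed
  have diff: "(\<integral>\<xi>. \<theta> * (fhat \<xi> / (\<theta> + \<Psi> (- \<xi>))) - fhat \<xi> \<partial>lborel)
      = \<theta> * (\<integral>\<xi>. fhat \<xi> / (\<theta> + \<Psi> (- \<xi>)) \<partial>lborel) - (\<integral>\<xi>. fhat \<xi> \<partial>lborel)"
    unfolding integral_mult_right_zero[symmetric]
    by (rule Bochner_Integration.integral_diff[OF integrable_mult_right[OF quot[OF integrable_fhat]] integrable_fhat])
  have "complex_of_real (\<theta> * (\<integral>s. exp (- (\<theta> * s)) * (heaviside s * p s) \<partial>lborel) - \<phi> 0)
      = 1 / complex_of_real (2 * pi) * (\<integral>\<xi>. \<theta> * (fhat \<xi> / (\<theta> + \<Psi> (- \<xi>))) - fhat \<xi> \<partial>lborel)"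
    unfolding of_real_diff of_real_mult L[OF p_eq integrable_fhat] phi_inverse[of 0] diff
    by (simp add: right_diff_distrib mult.left_commute)
  also have "(\<lambda>\<xi>. \<theta> * (fhat \<xi> / (\<theta> + \<Psi> (- \<xi>))) - fhat \<xi>) = (\<lambda>\<xi>. ghat \<xi> / (\<theta> + \<Psi> (- \<xi>)))"
    using nz by (auto simp: ghat_def fun_eq_iff field_simps)
  also have "1 / complex_of_real (2 * pi) * (\<integral>\<xi>. ghat \<xi> / (\<theta> + \<Psi> (- \<xi>)) \<partial>lborel)
      = complex_of_real (\<integral>s. exp (- (\<theta> * s)) * (heaviside s * h s) \<partial>lborel)"
    by (rule L[OF h_eq integrable_ghat, symmetric])
  finally show ?thesis by (simp only: of_real_eq_iff)
qed

lemma expectation_phi: "0 \<le> t \<Longrightarrow> (\<integral>x. \<phi> x \<partial>u t) = (\<integral>\<omega>. p (T t \<omega>) \<partial>M)"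
  unfolding p_def by (rule integral_u[OF _ phi_measurable phi_bound])

lemma expectation_g: "0 \<le> t \<Longrightarrow> (\<integral>x. g x \<partial>u t) = (\<integral>\<omega>. h (T t \<omega>) \<partial>M)"
  unfolding h_def by (rule integral_u[OF _ g_measurable g_bound])

lemma continuous_measurable: "(\<And>s. isCont f s) \<Longrightarrow> f \<in> borel_measurable borel" for f :: "real \<Rightarrow> real"
  by (intro borel_measurable_continuous_onI continuous_at_imp_continuous_on) auto

definition E\<phi> :: "real \<Rightarrow> real" where "E\<phi> t = (if t < 0 then 0 else (\<integral>\<omega>. p (T t \<omega>) \<partial>M))"
definition Eg :: "real \<Rightarrow> real" where "Eg t = (if t < 0 then 0 else (\<integral>\<omega>. h (T t \<omega>) \<partial>M))"

text \<open>Adding and subtracting the jump brings the pairing into the form \<open>Z + c H\<close>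
  treated by \<open>time_equation\<close>.\<close>

lemma pairing_eq: "pairing u \<phi> = (\<lambda>t. (E\<phi> t - \<phi> 0 * heaviside t) + \<phi> 0 * heaviside t)"
  by (auto simp: pairing_def E\<phi>_def expectation_phi fun_eq_iff)

lemma expectation_T_bound:
  assumes "\<And>s. isCont f s" "\<And>s. \<bar>f s\<bar> \<le> (C::real)" "0 \<le> t"
  shows "\<bar>\<integral>\<omega>. f (T t \<omega>) \<partial>M\<bar> \<le> C"
proof -
  note [measurable] = T_measurable'[OF assms(3)] continuous_measurable[OF assms(1)]
  have "\<bar>\<integral>\<omega>. f (T t \<omega>) \<partial>M\<bar> \<le> (\<integral>\<omega>. \<bar>f (T t \<omega>)\<bar> \<partial>M)" by (rule integral_abs_bound)
  also have "\<dots> \<le> C"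
    using assms(2) by (intro integral_le_const integrable_abs integrable_const_bound[of _ C]) auto
  finally show ?thesis .
qed

lemma right_continuous_T:
  assumes "\<And>s. isCont f s" "\<And>s. \<bar>f s\<bar> \<le> (C::real)" "0 \<le> t"
  shows "continuous (at_right t) (\<lambda>t. if t < 0 then 0 else (\<integral>\<omega>. f (T t \<omega>) \<partial>M))"
proof -
  have "\<forall>\<^sub>F s in at_right t. (\<integral>\<omega>. f (T s \<omega>) \<partial>M) = (if s < 0 then 0 else (\<integral>\<omega>. f (T s \<omega>) \<partial>M))"
    using eventually_at_right_less[of t] by eventually_elim (use assms(3) in auto)
  from Lim_transform_eventually[OF expectation_T_right_continuous[OF assms] this]
  show ?thesis using assms(3) by (simp add: continuous_within)
qed

lemma isCont_T_expectation:
  assumes "\<And>s. isCont f s" "\<And>s. \<bar>f s\<bar> \<le> (C::real)" "0 < t" "0 < b"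
  shows "isCont (\<lambda>t. if t < 0 then 0 else (\<integral>\<omega>. f (T t \<omega>) \<partial>M)) t"
proof -
  have "\<forall>\<^sub>F s in nhds t. (\<integral>\<omega>. f (T s \<omega>) \<partial>M) = (if s < 0 then 0 else (\<integral>\<omega>. f (T s \<omega>) \<partial>M))"
    using eventually_nhds_in_open[of "{0<..}" t] assms(3) by (auto elim!: eventually_mono)
  from isCont_cong[OF this] expectation_T_isCont[OF assms] show ?thesis by blast
qed

lemma expectation_p_zero:
  assumes "0 < b" shows "(\<integral>\<omega>. p (T 0 \<omega>) \<partial>M) = \<phi> 0"
proof -
  have [measurable]: "T 0 \<in> borel_measurable M" by (rule T_measurable') simp
  note [measurable] = continuous_measurable[OF p_isCont]
  have "(\<integral>\<omega>. p (T 0 \<omega>) \<partial>M) = (\<integral>\<omega>. p 0 \<partial>M)"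
    using T_zero[OF assms] by (intro integral_cong_AE) (auto elim: eventually_mono)
  then show ?thesis by (simp add: prob_space p_zero)
qed

lemma heaviside_continuous:
  "0 \<le> t \<Longrightarrow> continuous (at_right t) heaviside" "0 < t \<Longrightarrow> isCont heaviside t"
proof -
  assume t: "0 \<le> t"
  have "\<forall>\<^sub>F s in at_right t. heaviside s = heaviside t"
    using eventually_at_right_less[of t] by eventually_elim (use t in \<open>simp add: heaviside_def\<close>)
  then show "continuous (at_right t) heaviside"
    by (simp add: continuous_within tendsto_eventually)
next
  assume t: "0 < t"
  have "\<forall>\<^sub>F s in nhds t. heaviside s = 1"
    using eventually_nhds_in_open[of "{0<..}" t] t by (auto simp: heaviside_def elim!: eventually_mono)
  from isCont_cong[OF this] show "isCont heaviside t" by simp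
qed

lemma governing_equation:
  assumes t: "0 < t"
  shows "0 < b \<longrightarrow> DC_differentiable \<beta> (pairing u \<phi>) t"
    and "complex_of_real (b powr \<beta> * DC_deriv \<beta> (pairing u \<phi>) t + lam powr \<gamma> * frac_shift \<gamma> (pairing u \<phi>) t)
      = (\<integral>x. generator (\<lambda>\<xi>. \<Psi> (- \<xi>)) (\<lambda>y. complex_of_real (\<phi> y)) x \<partial>u t)
        + complex_of_real (boundary_datum \<gamma> lam t * \<phi> 0)"
proof -
  \<comment> \<open>\<open>P\<close> and \<open>H\<close> are the transforms of \<open>p\<close> and
    \<open>h\<close>, taken at \<open>\<Phi> \<eta>\<close> in place of
    \<open>\<eta>\<close>.\<close>
  define P where "P \<eta> = (\<integral>s. exp (- (\<Phi> \<eta> * s)) * (heaviside s * p s) \<partial>lborel)" for \<eta>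
  define H where "H \<eta> = (\<integral>s. exp (- (\<Phi> \<eta> * s)) * (heaviside s * h s) \<partial>lborel)" for \<eta>
  interpret E: laplace_time_equation "\<lambda>t. E\<phi> t - \<phi> 0 * heaviside t" Eg
    "\<lambda>\<eta>. \<Phi> \<eta> / \<eta> * P \<eta> - \<phi> 0 * (1 / \<eta>)" "\<lambda>\<eta>. \<Phi> \<eta> / \<eta> * H \<eta>"
    b \<beta> \<gamma> lam "(\<integral>\<xi>. norm (fhat \<xi>) \<partial>lborel) + \<bar>\<phi> 0\<bar>"
  proof
    fix \<eta> :: real assume \<eta>: "0 < \<eta>"
    have "laplace_at E\<phi> \<eta> (\<Phi> \<eta> / \<eta> * P \<eta>)"
      unfolding E\<phi>_def[abs_def] P_def by (rule laplace_T[OF \<eta> continuous_measurable[OF p_isCont] p_bound])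
    from has_bochner_integral_diff[OF this has_bochner_integral_mult_right[OF laplace_heaviside[OF \<eta>], of "\<phi> 0"]]
    show "laplace_at (\<lambda>t. E\<phi> t - \<phi> 0 * heaviside t) \<eta> (\<Phi> \<eta> / \<eta> * P \<eta> - \<phi> 0 * (1 / \<eta>))"
      by (simp add: algebra_simps)
    show "laplace_at Eg \<eta> (\<Phi> \<eta> / \<eta> * H \<eta>)"
      unfolding Eg_def[abs_def] H_def by (rule laplace_T[OF \<eta> continuous_measurable[OF h_isCont] h_bound])
    \<comment> \<open>The bracket \<open>\<Phi> \<eta> * P \<eta> - \<phi> 0\<close> is the left
      side of \<open>resolvent\<close> at \<open>\<theta> = \<Phi> \<eta>\<close>, hence equal to
      \<open>H \<eta>\<close>.\<close>
    have "\<Phi> \<eta> * (\<Phi> \<eta> / \<eta> * P \<eta> - \<phi> 0 * (1 / \<eta>)) = \<Phi> \<eta> / \<eta> * (\<Phi> \<eta> * P \<eta> - \<phi> 0)"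
      using \<eta> by (simp add: field_simps)
    then show "(b powr \<beta> * \<eta> powr \<beta> + lam powr \<gamma> * (1 - exp (- \<eta>)) powr \<gamma>) * (\<Phi> \<eta> / \<eta> * P \<eta> - \<phi> 0 * (1 / \<eta>))
        = \<Phi> \<eta> / \<eta> * H \<eta>"
      using resolvent[OF \<Phi>_pos[OF \<eta>]] by (simp add: P_def H_def \<Phi>_def)
  next
    fix t :: real
    show "\<bar>E\<phi> t - \<phi> 0 * heaviside t\<bar> \<le> (\<integral>\<xi>. norm (fhat \<xi>) \<partial>lborel) + \<bar>\<phi> 0\<bar>"
    proof -
      have "\<bar>E\<phi> t\<bar> \<le> (\<integral>\<xi>. norm (fhat \<xi>) \<partial>lborel)"
        unfolding E\<phi>_def using expectation_T_bound[OF p_isCont p_bound] by auto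
      moreover have "\<bar>\<phi> 0 * heaviside t\<bar> \<le> \<bar>\<phi> 0\<bar>" by (simp add: heaviside_def)
      ultimately show ?thesis by linarith
    qed
  next
    fix t :: real assume t: "0 \<le> t"
    show "continuous (at_right t) (\<lambda>t. E\<phi> t - \<phi> 0 * heaviside t)"
      using right_continuous_T[OF p_isCont p_bound t] heaviside_continuous(1)[OF t]
      unfolding E\<phi>_def[abs_def, symmetric] by (intro continuous_intros)
    show "continuous (at_right t) Eg"
      unfolding Eg_def[abs_def] by (rule right_continuous_T[OF h_isCont h_bound t])
  next
    fix t :: real assume bt: "0 < b" "0 < t"
    show "isCont (\<lambda>t. E\<phi> t - \<phi> 0 * heaviside t) t"
      using isCont_T_expectation[OF p_isCont p_bound bt(2,1)] heaviside_continuous(2)[OF bt(2)]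
      unfolding E\<phi>_def[abs_def, symmetric] by (intro continuous_intros)
    show "isCont Eg t"
      unfolding Eg_def[abs_def] by (rule isCont_T_expectation[OF h_isCont h_bound bt(2,1)])
  qed (use b \<beta> \<gamma> lam expectation_p_zero in \<open>auto simp: E\<phi>_def Eg_def heaviside_def\<close>)
  show "0 < b \<longrightarrow> DC_differentiable \<beta> (pairing u \<phi>) t"
    by (rule E.time_equation(1)[OF pairing_eq t])
  have "(\<integral>x. generator (\<lambda>\<xi>. \<Psi> (- \<xi>)) (\<lambda>y. complex_of_real (\<phi> y)) x \<partial>u t) = complex_of_real (Eg t)"
    unfolding generator_eq_g using t by (simp add: Eg_def expectation_g)
  then show "complex_of_real (b powr \<beta> * DC_deriv \<beta> (pairing u \<phi>) t + lam powr \<gamma> * frac_shift \<gamma> (pairing u \<phi>) t)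
      = (\<integral>x. generator (\<lambda>\<xi>. \<Psi> (- \<xi>)) (\<lambda>y. complex_of_real (\<phi> y)) x \<partial>u t)
        + complex_of_real (boundary_datum \<gamma> lam t * \<phi> 0)"
    unfolding E.time_equation(2)[OF pairing_eq t] by simp
qed

lemma initial_limit:
  assumes "0 < b" shows "((\<lambda>t. \<integral>x. \<phi> x \<partial>u t) \<longlongrightarrow> \<phi> 0) (at_right 0)"
proof -
  have "((\<lambda>t. \<integral>\<omega>. p (T t \<omega>) \<partial>M) \<longlongrightarrow> \<phi> 0) (at_right 0)"
    using expectation_T_right_continuous[OF p_isCont p_bound, of 0] expectation_p_zero[OF assms] by simp
  moreover have "\<forall>\<^sub>F t in at_right 0. (\<integral>\<omega>. p (T t \<omega>) \<partial>M) = (\<integral>x. \<phi> x \<partial>u t)"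
    using eventually_at_right_less[of "0::real"] by eventually_elim (simp add: expectation_phi)
  ultimately show ?thesis by (rule Lim_transform_eventually)
qed

end

lemma starts_at_delta: "starts_at_delta b u"
  unfolding starts_at_delta_def
proof (intro conjI allI impI)
  fix t :: real assume t: "t < 0"
  \<comment> \<open>Measurability of \<open>T\<close> is available from time 0 on; at negative times
    the level is already exceeded by \<open>Y 0 = 0\<close>, so the map is constant.\<close>
  have "(\<lambda>\<omega>. X (T t \<omega>) \<omega>) \<in> borel_measurable M"
    by (rule measurable_cong[THEN iffD2, of _ _ "\<lambda>_. 0"]) (use t in \<open>auto simp: T_negative X_start\<close>)
  then show "u t = return borel 0"
    by (rule u_eq_delta) (use t in \<open>auto simp: T_negative\<close>)
next
  assume "0 < b"
  then show "u 0 = return borel 0" by (intro u_eq_delta XT_measurable T_zero) simp_all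
qed (rule initial_limit)

end

theorem theorem9:
  fixes M :: "'a measure"
    and X A B T :: "real \<Rightarrow> 'a \<Rightarrow> real"
    and N :: "real \<Rightarrow> 'a \<Rightarrow> nat"
    and m :: "real measure"
    and \<Psi> :: "real \<Rightarrow> complex"
    and u :: "real \<Rightarrow> real measure"
    and b \<beta> \<gamma> lam c :: real
  assumes "prob_space M"
    and "0 \<le> b" and "0 < \<beta>" and "\<beta> \<le> 1" and "0 < \<gamma>" and "\<gamma> \<le> 1" and "0 < lam"
    and "is_levy_measure m"
    and "\<Psi> = levy_symbol c m"
    and "levy_process M X"
    and "\<And>t \<mu>. 0 < t \<Longrightarrow> char (distr M borel (X t)) \<mu> = exp (- (complex_of_real t * \<Psi> \<mu>))"
    and "poisson_process M lam N"
    and "stable_subordinator M \<gamma> A"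
    and "stable_subordinator M \<beta> B"
    and "indep_processes3 M (\<lambda>t \<omega>. real (N t \<omega>)) A B"
    and "T = hitting_time N A b B"
    and "indep_time M X T"
    and "u = time_changed_law M X T"
  shows "solves_governing_equation b \<beta> \<gamma> lam \<Psi> (boundary_datum \<gamma> lam) u \<and> starts_at_delta b u"
proof -
  interpret prob_space M by fact
  interpret time_changed_levy M N A B b \<beta> \<gamma> lam X m c \<Psi>
    by standard (use assms in auto)
  show ?thesis
    unfolding \<open>u = _\<close> \<open>T = _\<close> solves_governing_equation_def
    using governing_equation starts_at_delta by blast
qed

end
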